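(* Let $z_0\in\mathbb{C}$, let $n$ be a non-negative integer, and let $K$ be a positive constant. Then all the weak solutions $\psi\in L^1_{\mathrm{loc}}(\mathbb{R}^2;\mathbb{R})$ of $-\Delta\psi=K|z-z_0|^{2n}e^{\psi}$ in $\mathbb{C}\cong\mathbb{R}^2$ which satisfy $\int_{\mathbb{R}^2}|z-z_0|^{2n}e^\psi<\infty$ are of the form $$\psi(z)=\log\left(\frac{8}{\left(|a(z-z_0)^{n+1}+c|^2+\frac{K}{|a|^2(n+1)^2}\right)^2}\right),\qquad z\in\mathbb{C},$$ where $c\in\mathbb{C}$ and $a\in\mathbb{C}\setminus\{0\}$. Furthermore, if $z_0=0$ and $\psi$ is radially symmetric, then $$\psi(z)=\log\left(\frac{8}{\left(|a|^2|z|^{2n+2}+\frac{K}{|a|^2(n+1)^2}\right)^2}\right)$$ for every $z\in\mathbb{C}$, where $a\in\mathbb{C}\setminus\{0\}$.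
   Context: $\mathbb{R}^2$ is identified with $\mathbb{C}$ via $z=x+\mathrm{i}y$; weak solution means solution in the sense of distributions; radially symmetric means depending only on $|z|$. *)

theory Defs
  imports "HOL-Analysis.Analysis"
begin

text \<open>Continuous differentiability of order \<open>k\<close> on the whole (finite-dimensional) space:
  all iterated directional derivatives up to order \<open>k\<close> exist as Frechet derivatives
  evaluated at fixed directions, and those of order \<open>k\<close> are continuous.\<close>

primrec Ck :: "nat \<Rightarrow> ('a::euclidean_space \<Rightarrow> real) \<Rightarrow> bool" where
  "Ck 0 f \<longleftrightarrow> continuous_on UNIV f"
| "Ck (Suc k) f \<longleftrightarrow>
     (\<forall>x. f differentiable (at x)) \<and> (\<forall>v. Ck k (\<lambda>x. frechet_derivative f (at x) v))"

definition test_function :: "('a::euclidean_space \<Rightarrow> real) \<Rightarrow> bool" where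
  "test_function \<phi> \<longleftrightarrow> (\<forall>k. Ck k \<phi>) \<and> compact (closure (support_on UNIV \<phi>))"

text \<open>The sum of the pure second partial derivatives. For \<^typ>\<open>complex\<close> the basis is
  \<open>{1, \<i>}\<close>, so this is \<open>\<partial>\<^sub>x\<partial>\<^sub>x + \<partial>\<^sub>y\<partial>\<^sub>y\<close> under \<open>z = x + \<i> y\<close>.\<close>

definition laplacian :: "('a::euclidean_space \<Rightarrow> real) \<Rightarrow> 'a \<Rightarrow> real" where
  "laplacian f x =
     (\<Sum>b\<in>Basis. frechet_derivative (\<lambda>y. frechet_derivative f (at y) b) (at x) b)"

definition locally_integrable :: "('a::euclidean_space \<Rightarrow> real) \<Rightarrow> bool" where
  "locally_integrable f \<longleftrightarrow> (\<forall>S. compact S \<longrightarrow> set_integrable lebesgue S f)"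

text \<open>\<open>- \<Delta> \<psi> = F\<close> in the sense of distributions, for locally integrable \<open>\<psi>\<close> and \<open>F\<close>.\<close>

definition weak_solution_neg_laplacian ::
    "('a::euclidean_space \<Rightarrow> real) \<Rightarrow> ('a \<Rightarrow> real) \<Rightarrow> bool" where
  "weak_solution_neg_laplacian \<psi> F \<longleftrightarrow>
     locally_integrable \<psi> \<and> locally_integrable F \<and>
     (\<forall>\<phi>. test_function \<phi> \<longrightarrow>
        - (\<integral>x. \<psi> x * laplacian \<phi> x \<partial>lebesgue) = (\<integral>x. F x * \<phi> x \<partial>lebesgue))"

text \<open>An element of \<open>L\<^sup>1\<^sub>l\<^sub>o\<^sub>c\<close> is represented by a function that is only determined almost
  everywhere, so radial symmetry is required of some representative.\<close>

definition radially_symmetric :: "(complex \<Rightarrow> real) \<Rightarrow> bool" where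
  "radially_symmetric \<psi> \<longleftrightarrow> (\<exists>g. AE z in lebesgue. \<psi> z = g (cmod z))"

end

theory Submission
  imports Defs "HOL-Complex_Analysis.Complex_Analysis"
begin

text \<open>Put \<open>F = K |z - z\<^sub>0|\<^bsup>2n\<^esup> e\<^bsup>\<psi>\<^esup>\<close>. Testing the equation with a cut-off times the regularised
  logarithm \<open>(1/2) ln (|z - x|\<^sup>2 + \<epsilon>\<^sup>2)\<close> and letting \<open>\<epsilon> \<rightarrow> 0\<close> writes \<open>\<psi>\<close> locally as a logarithmic
  potential of \<open>F\<close> plus the real part of a holomorphic function. Jensen's inequality (Brezis--Merle)
  then bounds \<open>F\<close> on the whole plane, since \<open>|z - z\<^sub>0|\<^bsup>2n\<^esup> e\<^bsup>Re A\<^esup>\<close> is the modulus of a holomorphic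
  function and hence controlled by \<open>\<integral> F\<close>. Globally, \<open>\<psi>\<close> plus the logarithmic potential of \<open>F\<close> is the
  real part of an entire function whose exponential has polynomial growth and no zeros, so it is
  constant.

  Let \<open>Q\<close> be the Cauchy transform of \<open>F\<close>, a multiple of \<open>\<partial>\<psi>/\<partial>z\<close>. Symmetrising the double integral
  for \<open>Q\<^sup>2\<close> gives the Riccati equation \<open>\<partial>Q/\<partial>z = n Q/(z - z\<^sub>0) - c Q\<^sup>2\<close>, that is,
  \<open>(z - z\<^sub>0) \<partial>\<^sup>2v/\<partial>z\<^sup>2 = n \<partial>v/\<partial>z\<close> for \<open>v = e\<^bsup>-\<psi>/2\<^esup>\<close>. As \<open>v\<close> is real, this forces
  \<open>v = \<alpha> + 2 Re (b \<zeta>) + \<gamma> |\<zeta>|\<^sup>2\<close> with \<open>\<zeta> = (z - z\<^sub>0)\<^bsup>n+1\<^esup>\<close>, and the equation itself relates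
  \<open>\<alpha>\<close>, \<open>b\<close> and \<open>\<gamma>\<close>.\<close>

section \<open>Lebesgue integrals on the plane\<close>

text \<open>The usual way to the Riccati equation is to show that a suitable combination of
  \<open>Q\<close>, \<open>Q^2\<close> and the z-derivative of \<open>Q\<close> is holomorphic and
  decays, which requires the asymptotics of the solution at infinity. Symmetrisation makes do
  without them: the z-derivative of \<open>Q\<close> is the Cauchy transform of the z-derivative of
  \<open>F\<close>, which is algebraic in \<open>F\<close>, \<open>Q\<close> and
  \<open>1/(z - z0)\<close>, and partial fractions evaluate that transform exactly. The only
  remainder is a multiple of the integral of \<open>n F/(z - z0)\<close>; it vanishes because the
  z-derivative of \<open>F\<close> has integral zero and the integral of \<open>F Q\<close> is zero
  by antisymmetry. Regularity comes in one cycle: a bounded integrable \<open>F\<close> has a C^1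
  potential, so \<open>F\<close> itself is C^1, so \<open>Q\<close> is C^1. Derivatives of singular
  integrals are obtained from identities integrated along segments, which Fubini's theorem carries
  through a convolution. Since n is an integer, \<open>|z - z0|^(2n)\<close> is the product of
  \<open>(z - z0)^n\<close> and its conjugate, hence smooth at \<open>z0\<close> and open to
  Wirtinger calculus.\<close>

lemma nn_integral_lborel_affine:
  fixes f :: "'a::euclidean_space \<Rightarrow> ennreal"
  assumes [measurable]: "f \<in> borel_measurable borel" and t: "t \<noteq> 0"
  shows "(\<integral>\<^sup>+x. f x \<partial>lborel) = ennreal (\<bar>t\<bar> ^ DIM('a)) * (\<integral>\<^sup>+x. f (c + t *\<^sub>R x) \<partial>lborel)"
  by (subst lborel_affine[OF t, of c])
     (simp add: nn_integral_density nn_integral_distr nn_integral_cmult)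

lemma integrable_lborel_affine:
  fixes f :: "'a::euclidean_space \<Rightarrow> 'b::{banach,second_countable_topology}"
  assumes f: "integrable lborel f" and t: "t \<noteq> 0"
  shows "integrable lborel (\<lambda>x. f (c + t *\<^sub>R x))"
proof -
  have [measurable]: "f \<in> borel_measurable borel" using f by auto
  have "(\<integral>\<^sup>+x. norm (f x) \<partial>lborel) < \<infinity>" using f by (simp add: integrable_iff_bounded)
  then have "(\<integral>\<^sup>+x. norm (f (c + t *\<^sub>R x)) \<partial>lborel) < \<infinity>"
    using t by (subst (asm) nn_integral_lborel_affine[OF _ t, of _ c]) (auto simp: ennreal_mult_less_top)
  then show ?thesis by (simp add: integrable_iff_bounded)
qed

lemma integral_lborel_affine:
  fixes f :: "'a::euclidean_space \<Rightarrow> 'b::{banach,second_countable_topology}"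
  assumes f: "integrable lborel f" and t: "t \<noteq> 0"
  shows "(\<integral>x. f (c + t *\<^sub>R x) \<partial>lborel) = (1 / \<bar>t\<bar> ^ DIM('a)) *\<^sub>R (\<integral>x. f x \<partial>lborel)"
proof -
  have [measurable]: "f \<in> borel_measurable borel" using f by auto
  have "(\<integral>x. f x \<partial>lborel) = (\<bar>t\<bar> ^ DIM('a)) *\<^sub>R (\<integral>x. f (c + t *\<^sub>R x) \<partial>lborel)"
    by (subst lborel_affine[OF t, of c])
      (simp add: integral_density integral_distr)
  then show ?thesis using t by simp
qed

lemma integrable_translate:
  fixes f :: "'a::euclidean_space \<Rightarrow> 'b::{banach,second_countable_topology}"
  assumes "integrable lborel f"
  shows "integrable lborel (\<lambda>x. f (c + x))" "integrable lborel (\<lambda>x. f (x + c))"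
    "integrable lborel (\<lambda>x. f (x - c))" "integrable lborel (\<lambda>x. f (c - x))"
  using integrable_lborel_affine[OF assms, of 1 c] integrable_lborel_affine[OF assms, of 1 "-c"]
    integrable_lborel_affine[OF assms, of "-1" c]
  by (auto simp: add.commute)

lemma integral_translate:
  fixes f :: "'a::euclidean_space \<Rightarrow> 'b::{banach,second_countable_topology}"
  assumes "integrable lborel f"
  shows "(\<integral>x. f (c + x) \<partial>lborel) = (\<integral>x. f x \<partial>lborel)" "(\<integral>x. f (x + c) \<partial>lborel) = (\<integral>x. f x \<partial>lborel)"
    "(\<integral>x. f (x - c) \<partial>lborel) = (\<integral>x. f x \<partial>lborel)" "(\<integral>x. f (c - x) \<partial>lborel) = (\<integral>x. f x \<partial>lborel)"
  using integral_lborel_affine[OF assms, of 1 c] integral_lborel_affine[OF assms, of 1 "-c"]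
    integral_lborel_affine[OF assms, of "-1" c]
  by (auto simp: add.commute)

lemma nn_integral_translate:
  fixes f :: "'a::euclidean_space \<Rightarrow> ennreal"
  assumes "f \<in> borel_measurable borel"
  shows "(\<integral>\<^sup>+x. f (x - c) \<partial>lborel) = (\<integral>\<^sup>+x. f x \<partial>lborel)" "(\<integral>\<^sup>+x. f (c - x) \<partial>lborel) = (\<integral>\<^sup>+x. f x \<partial>lborel)"
  using nn_integral_lborel_affine[OF assms, of 1 "-c"]
    nn_integral_lborel_affine[OF assms, of "-1" c]
  by (auto simp: add.commute)

text \<open>A substitute for polar coordinates: radial tails and singularities in the plane are
  dominated by products of functions of \<open>Re z\<close> and \<open>Im z\<close>.\<close>

lemma integrable_complex_prod:
  fixes f g :: "real \<Rightarrow> real"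
  assumes f: "integrable lborel f" and g: "integrable lborel g"
    and "\<And>x. 0 \<le> f x" "\<And>x. 0 \<le> g x"
  shows "integrable lborel (\<lambda>z::complex. f (Re z) * g (Im z))"
proof -
  have [measurable]: "f \<in> borel_measurable borel" "g \<in> borel_measurable borel" using f g by auto
  let ?h = "\<lambda>b::complex. if b = 1 then f else g"
  have "(\<integral>\<^sup>+z. ennreal (\<Prod>b\<in>Basis. ?h b (z \<bullet> b)) \<partial>lborel) = (\<integral>\<^sup>+z. (\<Prod>b\<in>Basis. ennreal (?h b (z \<bullet> b))) \<partial>lborel)"
    using assms(3,4) by (intro nn_integral_cong) (simp add: prod_ennreal)
  also have "\<dots> = (\<Prod>b\<in>Basis. \<integral>\<^sup>+x. ?h b x \<partial>lborel)"
    using assms(3,4) by (intro nn_integral_lborel_prod) auto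
  also have "\<dots> = (\<integral>\<^sup>+x. f x \<partial>lborel) * (\<integral>\<^sup>+x. g x \<partial>lborel)"
    by (simp add: Basis_complex_def)
  also have "\<dots> < \<infinity>"
    using f g assms(3,4) by (auto simp: integrable_iff_bounded ennreal_mult_less_top)
  finally have "(\<integral>\<^sup>+z. ennreal (f (Re z) * g (Im z)) \<partial>lborel) < \<infinity>"
    by (simp add: Basis_complex_def)
  then show ?thesis using assms(3,4) by (simp add: integrable_iff_bounded)
qed

lemma integrable_inverse_one_plus_square: "integrable lborel (\<lambda>x::real. 1 / (1 + x\<^sup>2))"
proof -
  have lim: "(arctan \<longlongrightarrow> pi/2) at_top" by (rule tendsto_arctan_at_top)
  have d: "(arctan has_real_derivative (1 / (1 + x\<^sup>2))) (at x)" for x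
    using DERIV_arctan[of x] by (simp add: inverse_eq_divide)
  have b: "(\<lambda>x::real. 1 / (1 + x\<^sup>2)) \<in> borel_measurable borel" by measurable
  have p: "(\<integral>\<^sup>+x. ennreal (1 / (1 + x\<^sup>2)) * indicator {0..} x \<partial>lborel) = ennreal (pi/2 - arctan 0)"
    by (rule nn_integral_FTC_atLeast[OF b d _ lim]) auto
  have "(\<integral>\<^sup>+x. ennreal (1 / (1 + x\<^sup>2)) * indicator {..0} x \<partial>lborel)
     = (\<integral>\<^sup>+x. ennreal (1 / (1 + (0 - x)\<^sup>2)) * indicator {..0} (0 - x) \<partial>lborel)"
    by (rule nn_integral_translate(2)[symmetric]) measurable
  also have "\<dots> = (\<integral>\<^sup>+x. ennreal (1 / (1 + x\<^sup>2)) * indicator {0..} x \<partial>lborel)"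
    by (intro nn_integral_cong) (auto simp: indicator_def)
  finally have n: "(\<integral>\<^sup>+x. ennreal (1 / (1 + x\<^sup>2)) * indicator {..0} x \<partial>lborel) = ennreal (pi/2 - arctan 0)"
    using p by simp
  have "(\<integral>\<^sup>+x. ennreal (1 / (1 + x\<^sup>2)) \<partial>lborel)
     \<le> (\<integral>\<^sup>+x. ennreal (1 / (1 + x\<^sup>2)) * indicator {0..} x + ennreal (1 / (1 + x\<^sup>2)) * indicator {..0} x \<partial>lborel)"
    by (intro nn_integral_mono) (auto simp: indicator_def)
  also have "\<dots> < \<infinity>" by (subst nn_integral_add) (auto simp: n p)
  finally show ?thesis by (auto simp: integrable_iff_bounded)
qed

lemma integrable_inverse_sqrt: "integrable lborel (\<lambda>x::real. indicator {-1..1} x * (1 / sqrt \<bar>x\<bar>))"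
proof -
  have "((\<lambda>x::real. x powr (-1/2)) has_integral (1 powr (-1/2+1) / (-1/2+1))) {0..1}"
    by (rule has_integral_powr_from_0) auto
  then have "((\<lambda>x::real. x powr (-1/2)) has_integral 2) {0..1}" by simp
  then have p': "(\<integral>\<^sup>+x. ennreal (x powr (-1/2)) * indicator {0..1::real} x \<partial>lborel) = ennreal 2"
    by (intro nn_integral_has_integral_lebesgue') auto
  have p: "(\<integral>\<^sup>+x. ennreal (1 / sqrt \<bar>x\<bar>) * indicator {0..1::real} x \<partial>lborel) = ennreal 2"
  proof -
    show ?thesis
      unfolding p'[symmetric] by (intro nn_integral_cong) (auto simp: powr_minus_divide powr_half_sqrt split: split_indicator)
  qed
  have "(\<integral>\<^sup>+x. ennreal (1 / sqrt \<bar>x\<bar>) * indicator {-1..0::real} x \<partial>lborel)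
     = (\<integral>\<^sup>+x. ennreal (1 / sqrt \<bar>0 - x\<bar>) * indicator {-1..0} (0 - x) \<partial>lborel)"
    by (rule nn_integral_translate(2)[symmetric]) measurable
  also have "\<dots> = (\<integral>\<^sup>+x. ennreal (1 / sqrt \<bar>x\<bar>) * indicator {0..1} x \<partial>lborel)"
    by (intro nn_integral_cong) (auto simp: indicator_def)
  finally have n: "(\<integral>\<^sup>+x. ennreal (1 / sqrt \<bar>x\<bar>) * indicator {-1..0::real} x \<partial>lborel) = ennreal 2"
    using p by simp
  have "(\<integral>\<^sup>+x. ennreal (indicator {-1..1} x * (1 / sqrt \<bar>x\<bar>)) \<partial>lborel)
     \<le> (\<integral>\<^sup>+x. ennreal (1 / sqrt \<bar>x\<bar>) * indicator {-1..0} x + ennreal (1 / sqrt \<bar>x\<bar>) * indicator {0..1} x \<partial>lborel)"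
    by (intro nn_integral_mono) (auto simp: indicator_def)
  also have "\<dots> < \<infinity>" by (subst nn_integral_add) (auto simp: n p)
  finally show ?thesis by (auto simp: integrable_iff_bounded abs_mult)
qed

text \<open>The Laplacian of \<open>(1/2) ln (|z|^2 + e^2)\<close>; half of it is the derivative
  with respect to \<open>cnj z\<close> of the regularised inverse
  \<open>cnj z / (|z|^2 + e^2)\<close>. For e > 0 its mass does not depend on e, so it is an
  approximate identity as e tends to 0.\<close>

definition kern :: "real \<Rightarrow> complex \<Rightarrow> real"
  where "kern e z = 2 * e\<^sup>2 / ((cmod z)\<^sup>2 + e\<^sup>2)\<^sup>2"

text \<open>Its value \<open>2\<pi>\<close> is never needed.\<close>

definition kern_mass :: real where "kern_mass = (\<integral>z. kern 1 z \<partial>lborel)"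

lemma kern_borel[measurable]: "kern e \<in> borel_measurable borel"
  unfolding kern_def by measurable

lemma kern_nonneg: "0 \<le> kern e z" by (simp add: kern_def)

lemma integrable_kern1: "integrable lborel (kern 1)"
proof (rule Bochner_Integration.integrable_bound)
  have "integrable lborel (\<lambda>x::real. 2 * (1 / (1 + x\<^sup>2)))"
    by (intro integrable_mult_right integrable_inverse_one_plus_square)
  then show "integrable lborel (\<lambda>z::complex. (2 / (1 + (Re z)\<^sup>2)) * (1 / (1 + (Im z)\<^sup>2)))"
    using integrable_inverse_one_plus_square by (intro integrable_complex_prod) auto
  show "AE z in lborel. norm (kern 1 z) \<le> norm (2 / (1 + (Re z)\<^sup>2) * (1 / (1 + (Im z)\<^sup>2)))"
  proof (intro AE_I2)
    fix z :: complex
    have "(1 + (Re z)\<^sup>2) * (1 + (Im z)\<^sup>2) \<le> ((cmod z)\<^sup>2 + 1)\<^sup>2"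
    proof -
      have "(1 + a) * (1 + b) \<le> (a + b + 1)\<^sup>2" if "0 \<le> a" "0 \<le> b" for a b :: real
        using that by (simp add: power2_eq_square algebra_simps)
      then show ?thesis by (simp add: cmod_power2)
    qed
    moreover have "0 < (1 + (Re z)\<^sup>2) * (1 + (Im z)\<^sup>2)" by (intro mult_pos_pos add_pos_nonneg) auto
    ultimately have "2 / ((cmod z)\<^sup>2 + 1)\<^sup>2 \<le> 2 / ((1 + (Re z)\<^sup>2) * (1 + (Im z)\<^sup>2))"
      by (intro divide_left_mono mult_pos_pos) (auto intro: add_nonneg_pos add_pos_nonneg)
    then show "norm (kern 1 z) \<le> norm (2 / (1 + (Re z)\<^sup>2) * (1 / (1 + (Im z)\<^sup>2)))"
      by (simp add: kern_def)
  qed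
qed measurable

lemma kern_mass_pos: "0 < kern_mass"
proof -
  have "kern_mass \<noteq> 0"
  proof
    assume "kern_mass = 0"
    then have "AE z in lborel. kern 1 z = 0"
      using integral_nonneg_eq_0_iff_AE[OF integrable_kern1] kern_nonneg by (auto simp: kern_mass_def)
    moreover have "kern 1 z \<noteq> 0" for z
    proof -
      have "(cmod z)\<^sup>2 + 1 > 0" by (intro add_nonneg_pos) auto
      then show ?thesis by (simp add: kern_def)
    qed
    ultimately have "AE z in lborel::complex measure. False" by simp
    then show False using AE_iff_null[of lborel "\<lambda>_::complex. False"] by (simp add: null_sets_def)
  qed
  moreover have "0 \<le> kern_mass" unfolding kern_mass_def by (intro Bochner_Integration.integral_nonneg kern_nonneg)
  ultimately show ?thesis by simp
qed

lemma integrable_kern: assumes "e > 0" shows "integrable lborel (kern e)"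
proof -
  have "integrable lborel (\<lambda>z. (1/e\<^sup>2) * kern 1 (0 + (1/e) *\<^sub>R z))"
    using assms by (intro integrable_mult_right integrable_lborel_affine integrable_kern1) auto
  moreover have "(1/e\<^sup>2) * kern 1 (0 + (1/e) *\<^sub>R z) = kern e z" for z
  proof -
    have "(cmod z)\<^sup>2 + e\<^sup>2 > 0" using assms by (intro add_nonneg_pos) auto
    moreover have "(cmod z)\<^sup>2 / e\<^sup>2 + 1 = ((cmod z)\<^sup>2 + e\<^sup>2) / e\<^sup>2" using assms by (simp add: field_simps)
    ultimately show ?thesis
      using assms unfolding kern_def by (simp add: norm_mult power_mult_distrib power_divide)
        (simp add: divide_simps power2_eq_square power4_eq_xxxx)
  qed
  ultimately show ?thesis by simp
qed

text \<open>The substitution \<open>z = x + e y\<close> trades the concentrating kernel for the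
  fixed kernel \<open>kern 1\<close> acting on dilates of \<open>g\<close>, the form in which
  dominated convergence applies.\<close>

lemma kern_scale:
  assumes e: "e > 0" and x: "integrable lborel (\<lambda>z. kern e (z - x) *\<^sub>R g z)"
  shows "(\<integral>z. kern e (z - x) *\<^sub>R (g z::'b::{banach,second_countable_topology}) \<partial>lborel) = (\<integral>y. kern 1 y *\<^sub>R g (x + e *\<^sub>R y) \<partial>lborel)"
proof -
  have "(\<integral>y. kern e (x + e *\<^sub>R y - x) *\<^sub>R g (x + e *\<^sub>R y) \<partial>lborel) = (1 / e\<^sup>2) *\<^sub>R (\<integral>z. kern e (z - x) *\<^sub>R g z \<partial>lborel)"
    using integral_lborel_affine[OF x, of e x] e by simp
  moreover have "kern e (e *\<^sub>R y) = (1/e\<^sup>2) * kern 1 y" for y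
  proof -
    have "(cmod y)\<^sup>2 + 1 > 0" by (intro add_nonneg_pos) auto
    moreover have "e\<^sup>2 * (cmod y)\<^sup>2 + e\<^sup>2 = e\<^sup>2 * ((cmod y)\<^sup>2 + 1)" by (simp add: algebra_simps)
    ultimately show ?thesis
      using e unfolding kern_def by (simp add: norm_mult power_mult_distrib)
        (simp add: divide_simps power2_eq_square power4_eq_xxxx)
  qed
  ultimately have "(1/e\<^sup>2) *\<^sub>R (\<integral>y. kern 1 y *\<^sub>R g (x + e *\<^sub>R y) \<partial>lborel) = (1 / e\<^sup>2) *\<^sub>R (\<integral>z. kern e (z - x) *\<^sub>R g z \<partial>lborel)"
    unfolding integral_scaleR_right[symmetric] scaleR_scaleR by simp
  then show ?thesis using e by simp
qed

lemma negligible_AE_lborel: "negligible S \<Longrightarrow> AE z in lborel. z \<notin> S"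
  using AE_not_in[of S lebesgue] by (simp add: negligible_iff_null_sets AE_completion_iff)

text \<open>From \<open>|Re z| |Im z| \<le> |z|^2\<close> one gets
  \<open>1/|z| \<le> 1/(sqrt |Re z| sqrt |Im z|)\<close>, a product of integrable functions. On the
  axes division by zero makes the right-hand side 0, so this null set is set aside.\<close>

lemma integrable_inverse_norm_ball:
  "integrable lborel (\<lambda>z::complex. indicator (ball 0 1) z * (1 / cmod z))"
proof (rule Bochner_Integration.integrable_bound)
  let ?f = "\<lambda>x::real. indicator {-1..1} x * (1 / sqrt \<bar>x\<bar>) :: real"
  show "integrable lborel (\<lambda>z::complex. ?f (Re z) * ?f (Im z))"
    by (intro integrable_complex_prod integrable_inverse_sqrt) auto
  have "AE z in lborel::complex measure. Re z \<noteq> 0 \<and> Im z \<noteq> 0"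
  proof -
    have "AE z in lborel. z \<notin> {z::complex. 1 \<bullet> z = 0}" "AE z in lborel. z \<notin> {z::complex. \<i> \<bullet> z = 0}"
      by (intro negligible_AE_lborel negligible_hyperplane; simp)+
    then show ?thesis by eventually_elim auto
  qed
  then show "AE z in lborel. norm (indicator (ball 0 1) z * (1 / cmod z) :: real) \<le> norm (?f (Re z) * ?f (Im z))"
  proof eventually_elim
    fix z :: complex assume nz: "Re z \<noteq> 0 \<and> Im z \<noteq> 0"
    show "norm (indicator (ball 0 1) z * (1 / cmod z) :: real) \<le> norm (?f (Re z) * ?f (Im z))"
    proof (cases "z \<in> ball 0 1")
      case True
      then have "\<bar>Re z\<bar> \<le> 1" "\<bar>Im z\<bar> \<le> 1" using abs_Re_le_cmod[of z] abs_Im_le_cmod[of z] by auto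
      then have i: "Re z \<in> {-1..1}" "Im z \<in> {-1..1}" by auto
      have "\<bar>Re z\<bar> * \<bar>Im z\<bar> \<le> cmod z * cmod z"
        by (intro mult_mono abs_Re_le_cmod abs_Im_le_cmod) auto
      then have "sqrt \<bar>Re z\<bar> * sqrt \<bar>Im z\<bar> \<le> cmod z"
        by (metis norm_ge_zero power2_eq_square real_le_lsqrt real_sqrt_mult abs_ge_zero mult_nonneg_nonneg)
      then have "1 / cmod z \<le> 1 / (sqrt \<bar>Re z\<bar> * sqrt \<bar>Im z\<bar>)"
        using nz by (intro divide_left_mono mult_pos_pos) auto
      then show ?thesis using True i by (simp add: abs_mult)
    qed auto
  qed
qed (auto intro!: borel_measurable_times borel_measurable_divide borel_measurable_indicator)

section \<open>Wirtinger derivatives and the Cauchy transform\<close>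

lemma continuous_on_integral_dominated:
  fixes k :: "'x::metric_space \<Rightarrow> 'a \<Rightarrow> 'b::{banach,second_countable_topology}"
  assumes meas: "\<And>x. x \<in> S \<Longrightarrow> k x \<in> borel_measurable M"
    and cont: "\<And>y. continuous_on S (\<lambda>x. k x y)"
    and bound: "\<And>x y. x \<in> S \<Longrightarrow> norm (k x y) \<le> w y" and w: "integrable M w"
  shows "continuous_on S (\<lambda>x. \<integral>y. k x y \<partial>M)"
proof (rule continuous_on_sequentiallyI)
  fix x X assume X: "\<forall>n. X n \<in> S" "X \<longlonglongrightarrow> x" and x: "x \<in> S"
  show "(\<lambda>n. \<integral>y. k (X n) y \<partial>M) \<longlonglongrightarrow> (\<integral>y. k x y \<partial>M)"
  proof (rule integral_dominated_convergence[where w=w])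
    show "AE y in M. (\<lambda>n. k (X n) y) \<longlonglongrightarrow> k x y"
      using cont X x unfolding continuous_on_sequentially o_def by auto
  qed (use meas bound w x X in auto)
qed

text \<open>Cauchy's inequality turns the majorant \<open>G\<close> of the functions into the
  majorant \<open>G/r\<close> of their difference quotients, so that dominated convergence applies.
  The derivative in the parameter is measurable as a limit of difference quotients.\<close>

lemma holomorphic_on_integral:
  fixes \<Phi> :: "complex \<Rightarrow> 'a \<Rightarrow> complex"
  assumes S: "open S"
    and meas: "\<And>x. x \<in> S \<Longrightarrow> \<Phi> x \<in> borel_measurable M"
    and hol: "\<And>y. (\<lambda>x. \<Phi> x y) holomorphic_on S"
    and bound: "\<And>x y. x \<in> S \<Longrightarrow> norm (\<Phi> x y) \<le> G y" and G: "integrable M G"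
  shows "(\<lambda>x. \<integral>y. \<Phi> x y \<partial>M) holomorphic_on S"
proof -
  have "\<exists>D. ((\<lambda>x. \<integral>y. \<Phi> x y \<partial>M) has_field_derivative D) (at x)" if x: "x \<in> S" for x
  proof -
    obtain e where e: "e > 0" "cball x e \<subseteq> S" using S x open_contains_cball by blast
    \<comment> \<open>Half the radius, so that a closed ball of radius r around any point of
      \<open>ball x r\<close> still lies in \<open>S\<close>.\<close>
    define r where "r = e / 2"
    have r: "r > 0" "r + r = e" using e by (auto simp: r_def)
    have int: "integrable M (\<Phi> z)" if "z \<in> S" for z
      by (rule Bochner_Integration.integrable_bound[OF G]) (use bound that meas in \<open>auto intro: order_trans[OF _ abs_ge_self]\<close>)
    have der: "norm (deriv (\<lambda>x. \<Phi> x y) z) \<le> G y / r" if "z \<in> ball x r" for y z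
    proof -
      have sub: "cball z r \<subseteq> S"
      proof
        fix t assume "t \<in> cball z r"
        then have "dist x t \<le> r + r" using that dist_triangle[of x t z] by auto
        then show "t \<in> S" using e r by auto
      qed
      have "norm ((deriv ^^ 1) (\<lambda>x. \<Phi> x y) z) \<le> fact 1 * G y / r ^ 1"
      proof (rule Cauchy_inequality)
        show "(\<lambda>x. \<Phi> x y) holomorphic_on ball z r" using hol sub by (meson ball_subset_cball holomorphic_on_subset order_trans)
        show "continuous_on (cball z r) (\<lambda>x. \<Phi> x y)" using hol sub by (meson holomorphic_on_imp_continuous_on holomorphic_on_subset)
        show "norm (\<Phi> t y) \<le> G y" if "norm (z - t) = r" for t
          using that sub bound by (auto simp: dist_norm)
      qed (use r in auto)
      then show ?thesis by simp
    qed
    have lip: "norm (\<Phi> (x + h) y - \<Phi> x y) \<le> G y / r * norm h" if "norm h < r" for h y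
    proof -
      have "norm (\<Phi> (x + h) y - \<Phi> x y) \<le> G y / r * norm ((x + h) - x)"
      proof (rule field_differentiable_bound[where S="ball x r" and f'="deriv (\<lambda>x. \<Phi> x y)"])
        fix z assume z: "z \<in> ball x r"
        then have "z \<in> S" using e r by auto
        then show "((\<lambda>x. \<Phi> x y) has_field_derivative deriv (\<lambda>x. \<Phi> x y) z) (at z within ball x r)"
          using hol S holomorphic_derivI has_field_derivative_at_within by blast
      qed (use that r der in \<open>auto simp: dist_norm\<close>)
      then show ?thesis by simp
    qed
    define D where "D = (\<integral>y. deriv (\<lambda>x. \<Phi> x y) x \<partial>M)"
    have "((\<lambda>h. ((\<integral>y. \<Phi> (x + h) y \<partial>M) - (\<integral>y. \<Phi> x y \<partial>M)) / h) \<longlongrightarrow> D) (at 0)"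
      unfolding tendsto_at_iff_sequentially o_def
    proof (intro allI impI)
      fix X :: "nat \<Rightarrow> complex" assume X0: "\<forall>i. X i \<in> UNIV - {0}" and X: "X \<longlonglongrightarrow> 0"
      from X r have "\<forall>\<^sub>F n in sequentially. norm (X n) < r"
        using order_tendstoD(2)[OF tendsto_norm[OF X], of r] by auto
      then obtain N where N: "\<And>n. n \<ge> N \<Longrightarrow> norm (X n) < r" by (auto simp: eventually_sequentially)
      \<comment> \<open>The tail on which every increment is shorter than r: the dominated
        convergence theorem wants the bound for all indices.\<close>
      define Y where "Y = (\<lambda>n. X (n + N))"
      have Y: "Y \<longlonglongrightarrow> 0" "\<And>n. norm (Y n) < r" "\<And>n. Y n \<noteq> 0"
        using LIMSEQ_ignore_initial_segment[OF X, of N] X0 N by (auto simp: Y_def)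
      have YS: "x + Y n \<in> S" for n using Y(2)[of n] e r by (auto simp: subset_iff dist_norm)
      have lim: "(\<lambda>n. (\<Phi> (x + Y n) y - \<Phi> x y) / Y n) \<longlonglongrightarrow> deriv (\<lambda>x. \<Phi> x y) x" for y
      proof -
        have "((\<lambda>x. \<Phi> x y) has_field_derivative deriv (\<lambda>x. \<Phi> x y) x) (at x)"
          using hol S x holomorphic_derivI by blast
        then have "((\<lambda>h. (\<Phi> (x + h) y - \<Phi> x y) / h) \<longlongrightarrow> deriv (\<lambda>x. \<Phi> x y) x) (at 0)"
          by (simp add: DERIV_def)
        then show ?thesis using Y unfolding tendsto_at_iff_sequentially o_def by auto
      qed
      have "(\<lambda>n. \<integral>y. (\<Phi> (x + Y n) y - \<Phi> x y) / Y n \<partial>M) \<longlonglongrightarrow> D"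
        unfolding D_def
      proof (rule integral_dominated_convergence[where w="\<lambda>y. G y / r"])
        show m: "(\<lambda>y. (\<Phi> (x + Y n) y - \<Phi> x y) / Y n) \<in> borel_measurable M" for n
          using meas[OF YS] meas[OF x] by measurable
        show "(\<lambda>y. deriv (\<lambda>x. \<Phi> x y) x) \<in> borel_measurable M"
          by (rule borel_measurable_LIMSEQ_metric[where f="\<lambda>n y. (\<Phi> (x + Y n) y - \<Phi> x y) / Y n"])
             (use lim m in auto)
        show "AE y in M. norm ((\<Phi> (x + Y n) y - \<Phi> x y) / Y n) \<le> G y / r" for n
          using lip[OF Y(2)[of n]] Y(3)[of n] by (auto simp: norm_divide field_simps)
      qed (use lim G in auto)
      moreover have "(\<integral>y. (\<Phi> (x + Y n) y - \<Phi> x y) / Y n \<partial>M) = ((\<integral>y. \<Phi> (x + Y n) y \<partial>M) - (\<integral>y. \<Phi> x y \<partial>M)) / Y n" for n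
        using int[OF YS] int[OF x] by simp
      ultimately have "(\<lambda>n. ((\<integral>y. \<Phi> (x + Y n) y \<partial>M) - (\<integral>y. \<Phi> x y \<partial>M)) / Y n) \<longlonglongrightarrow> D" by (simp only:)
      then show "(\<lambda>n. ((\<integral>y. \<Phi> (x + X n) y \<partial>M) - (\<integral>y. \<Phi> x y \<partial>M)) / X n) \<longlonglongrightarrow> D"
        unfolding Y_def by (rule LIMSEQ_offset)
    qed
    then show ?thesis unfolding DERIV_def by blast
  qed
  then show ?thesis
    using S by (auto simp: holomorphic_on_open field_differentiable_def)
qed

text \<open>\<open>a\<close> and \<open>b\<close> play the roles of \<open>\<partial>f/\<partial>z\<close> and \<open>\<partial>f/\<partial>(cnj z)\<close>.\<close>

definition wirtinger :: "(complex \<Rightarrow> complex) \<Rightarrow> complex \<Rightarrow> complex \<Rightarrow> complex \<Rightarrow> bool"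
  where "wirtinger f a b x \<longleftrightarrow> (f has_derivative (\<lambda>v. v * a + cnj v * b)) (at x)"

lemma wirtinger_mult:
  assumes "wirtinger f a b x" "wirtinger g c d x"
  shows "wirtinger (\<lambda>z. f z * g z) (a * g x + f x * c) (b * g x + f x * d) x"
proof -
  have "(\<lambda>v. f x * (v * c + cnj v * d) + (v * a + cnj v * b) * g x) =
    (\<lambda>v. v * (a * g x + f x * c) + cnj v * (b * g x + f x * d))" by (auto simp: algebra_simps)
  then show ?thesis
    using has_derivative_mult[OF assms[unfolded wirtinger_def]] by (simp add: wirtinger_def)
qed

lemma wirtinger_continuous: "(\<And>x. wirtinger f (A x) (B x) x) \<Longrightarrow> continuous_on S f"
  unfolding wirtinger_def by (meson continuous_at_imp_continuous_on has_derivative_continuous)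

lemma wirtinger_unique:
  assumes "wirtinger f a b x" "wirtinger f c d x"
  shows "a = c" "b = d"
proof -
  have e: "(\<lambda>v. v * a + cnj v * b) = (\<lambda>v. v * c + cnj v * d)"
    using has_derivative_unique assms unfolding wirtinger_def by blast
  have 1: "a + b = c + d" using fun_cong[OF e, of 1] by simp
  have 2: "\<i> * (a - b) = \<i> * (c - d)" using fun_cong[OF e, of \<i>] by (simp add: algebra_simps)
  then have "a - b = c - d" by simp
  with 1 show "a = c" "b = d" by (auto simp: complex_eq_iff)
qed

lemma wirtinger_field_derivative:
  "wirtinger f a 0 x \<longleftrightarrow> (f has_field_derivative a) (at x)"
proof -
  have "(\<lambda>v. v * a + cnj v * 0) = (*) a" by (auto simp: mult.commute)
  then show ?thesis by (simp add: wirtinger_def has_field_derivative_def)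
qed

lemma wirtinger_cnj:
  assumes "wirtinger f a b x" shows "wirtinger (\<lambda>z. cnj (f z)) (cnj b) (cnj a) x"
proof -
  have "((\<lambda>z. cnj (f z)) has_derivative (\<lambda>v. cnj (v * a + cnj v * b))) (at x)"
    using assms unfolding wirtinger_def by (rule bounded_linear.has_derivative[OF bounded_linear_cnj])
  then show ?thesis by (simp add: wirtinger_def add.commute)
qed

text \<open>The fundamental theorem of calculus along a segment. This integrated form of the
  derivative survives convolution with a singular kernel, since only Fubini's theorem is
  involved.\<close>

lemma wirtinger_segment:
  assumes d: "\<And>x. wirtinger f (A x) (B x) x" and c: "continuous_on UNIV A" "continuous_on UNIV B"
  shows "f (x + v) - f x = (\<integral>s. indicator {0..1::real} s *\<^sub>R (v * A (x + s *\<^sub>R v) + cnj v * B (x + s *\<^sub>R v)) \<partial>lborel)"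
proof -
  let ?g = "\<lambda>s::real. v * A (x + s *\<^sub>R v) + cnj v * B (x + s *\<^sub>R v)"
  have "(?g has_integral (f (x + 1 *\<^sub>R v) - f (x + 0 *\<^sub>R v))) {0..1}"
  proof (rule fundamental_theorem_of_calculus)
    fix s :: real
    have "((\<lambda>s::real. f (x + s *\<^sub>R v)) has_derivative (\<lambda>h. (h *\<^sub>R v) * A (x + s *\<^sub>R v) + cnj (h *\<^sub>R v) * B (x + s *\<^sub>R v))) (at s within {0..1})"
      by (rule has_derivative_compose[where g=f and f="\<lambda>s. x + s *\<^sub>R v", OF _ d[of "x + s *\<^sub>R v", unfolded wirtinger_def]]) (auto intro!: derivative_eq_intros)
    then show "((\<lambda>s. f (x + s *\<^sub>R v)) has_vector_derivative ?g s) (at s within {0..1})"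
      by (simp add: has_vector_derivative_def scaleR_conv_of_real algebra_simps)
  qed simp
  then have 1: "integral {0..1} ?g = f (x + v) - f x" by (simp add: integral_unique)
  have "continuous_on {0..1} ?g"
    by (intro continuous_intros continuous_on_compose2[OF c(1)] continuous_on_compose2[OF c(2)]) auto
  then have "set_integrable lborel {0..1} ?g" by (rule borel_integrable_atLeastAtMost')
  then have "(LINT s:{0..1}|lborel. ?g s) = integral {0..1} ?g" by (rule set_borel_integral_eq_integral)
  with 1 show ?thesis by (simp add: set_lebesgue_integral_def)
qed

text \<open>The way back to a derivative: by continuity the integrand differs from its value at s =
  0 by at most \<open>e |v|\<close> once v is short.\<close>

lemma wirtinger_from_segments:
  fixes f :: "complex \<Rightarrow> complex"
  assumes c: "continuous_on UNIV A" "continuous_on UNIV B"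
    and seg: "\<And>v. f (x + v) - f x = (\<integral>s. indicator {0..1::real} s *\<^sub>R (v * A (x + s *\<^sub>R v) + cnj v * B (x + s *\<^sub>R v)) \<partial>lborel)"
  shows "wirtinger f (A x) (B x) x"
  unfolding wirtinger_def has_derivative_at_alt
proof (intro conjI allI impI)
  show "bounded_linear (\<lambda>v. v * A x + cnj v * B x)"
    by (intro bounded_linear_add bounded_linear_mult_left bounded_linear_compose[OF bounded_linear_mult_left bounded_linear_cnj])
  fix e :: real assume e: "e > 0"
  have "isCont A x" "isCont B x" using c by (auto simp: continuous_on_eq_continuous_at)
  then obtain d1 d2 where d: "d1 > 0" "\<And>y. dist y x < d1 \<Longrightarrow> dist (A y) (A x) < e/2"
    "d2 > 0" "\<And>y. dist y x < d2 \<Longrightarrow> dist (B y) (B x) < e/2"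
    unfolding continuous_at_eps_delta using e by (metis half_gt_zero)
  show "\<exists>d>0. \<forall>y. norm (y - x) < d \<longrightarrow> norm (f y - f x - ((y - x) * A x + cnj (y - x) * B x)) \<le> e * norm (y - x)"
  proof (intro exI[of _ "min d1 d2"] conjI allI impI)
    fix y assume y: "norm (y - x) < min d1 d2"
    define v where "v = y - x"
    let ?g = "\<lambda>s::real. v * A (x + s *\<^sub>R v) + cnj v * B (x + s *\<^sub>R v)"
    let ?L = "v * A x + cnj v * B x"
    have "continuous_on {0..1} ?g"
      by (intro continuous_intros continuous_on_compose2[OF c(1)] continuous_on_compose2[OF c(2)]) auto
    then have i: "integrable lborel (\<lambda>s. indicator {0..1::real} s *\<^sub>R ?g s)"
      using borel_integrable_atLeastAtMost' unfolding set_integrable_def by blast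
    have i2: "integrable lborel (\<lambda>s. indicator {0..1::real} s *\<^sub>R ?L)" by simp
    have "(\<integral>s. indicator {0..1::real} s *\<^sub>R ?L \<partial>lborel) = ?L" by simp
    then have "f y - f x - ?L = (\<integral>s. indicator {0..1::real} s *\<^sub>R ?g s \<partial>lborel) - (\<integral>s. indicator {0..1::real} s *\<^sub>R ?L \<partial>lborel)"
      using seg[of v] by (simp add: v_def)
    also have "\<dots> = (\<integral>s. indicator {0..1::real} s *\<^sub>R (?g s - ?L) \<partial>lborel)"
      using i i2 by (simp add: scaleR_diff_right)
    finally have eq: "f y - f x - ?L = (\<integral>s. indicator {0..1::real} s *\<^sub>R (?g s - ?L) \<partial>lborel)" .
    have "norm (\<integral>s. indicator {0..1::real} s *\<^sub>R (?g s - ?L) \<partial>lborel) \<le> (\<integral>s. indicator {0..1::real} s * (e * norm v) \<partial>lborel)"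
    proof (rule Bochner_Integration.integral_norm_bound_integral)
      show "integrable lborel (\<lambda>s. indicator {0..1::real} s *\<^sub>R (?g s - ?L))"
        using i i2 by (simp add: scaleR_diff_right)
      show "integrable lborel (\<lambda>s. indicator {0..1::real} s * (e * norm v))" by simp
      fix s :: real
      show "norm (indicator {0..1::real} s *\<^sub>R (?g s - ?L)) \<le> indicator {0..1::real} s * (e * norm v)"
      proof (cases "s \<in> {0..1}")
        case True
        then have "dist (x + s *\<^sub>R v) x \<le> norm v" by (auto simp: dist_norm mult_left_le_one_le)
        then have a: "norm (A (x + s *\<^sub>R v) - A x) \<le> e/2" "norm (B (x + s *\<^sub>R v) - B x) \<le> e/2"
          using d(2)[of "x + s *\<^sub>R v"] d(4)[of "x + s *\<^sub>R v"] y by (auto simp: v_def dist_norm)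
        have "?g s - ?L = v * (A (x + s *\<^sub>R v) - A x) + cnj v * (B (x + s *\<^sub>R v) - B x)" by (simp add: algebra_simps)
        also have "norm \<dots> \<le> norm v * (e/2) + norm v * (e/2)"
          unfolding norm_mult[symmetric] using a
          by (intro order_trans[OF norm_triangle_ineq add_mono]) (auto simp only: norm_mult complex_mod_cnj intro!: mult_left_mono norm_ge_zero)
        finally show ?thesis using True by (simp add: mult.commute)
      qed simp
    qed
    then show "norm (f y - f x - ((y - x) * A x + cnj (y - x) * B x)) \<le> e * norm (y - x)"
      using eq by (simp add: v_def)
  qed (use d in auto)
qed


text \<open>Provides the hypothesis of Fubini's theorem for a segment identity integrated against
  \<open>g\<close>. A bound on the inner integrals that is uniform in x suffices because s ranges
  over an interval of length 1.\<close>

lemma segment_integrable: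
  fixes D :: "complex \<Rightarrow> complex" and g :: "complex \<Rightarrow> complex"
  assumes [measurable]: "D \<in> borel_measurable borel" "g \<in> borel_measurable borel"
    and int: "\<And>x. integrable lborel (\<lambda>y. D (x - y) * g y)"
    and bd: "\<And>x. (\<integral>y. norm (D (x - y) * g y) \<partial>lborel) \<le> C"
  shows "integrable (lborel \<Otimes>\<^sub>M lborel) (\<lambda>(s, y). indicator {0..1::real} s *\<^sub>R (D (x + s *\<^sub>R v - y) * g y))"
proof (rule lborel_pair.Fubini_integrable)
  let ?h = "\<lambda>s y. indicator {0..1::real} s *\<^sub>R (D (x + s *\<^sub>R v - y) * g y)"
  show "(\<lambda>(s, y). ?h s y) \<in> borel_measurable (lborel \<Otimes>\<^sub>M lborel)" by measurable
  show "AE s in lborel. integrable lborel (\<lambda>y. case (s, y) of (s, y) \<Rightarrow> ?h s y)"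
    using int by auto
  show "integrable lborel (\<lambda>s. \<integral>y. norm (case (s, y) of (s, y) \<Rightarrow> ?h s y) \<partial>lborel)"
  proof (rule Bochner_Integration.integrable_bound)
    show "integrable lborel (\<lambda>s. indicator {0..1::real} s * C)" by simp
    show "(\<lambda>s. \<integral>y. norm (case (s, y) of (s, y) \<Rightarrow> ?h s y) \<partial>lborel) \<in> borel_measurable lborel" by measurable
    show "AE s in lborel. norm (\<integral>y. norm (case (s, y) of (s, y) \<Rightarrow> ?h s y) \<partial>lborel) \<le> norm (indicator {0..1::real} s * C)"
    proof (intro AE_I2)
      fix s :: real
      have "0 \<le> (\<integral>y. norm (D (x + s *\<^sub>R v - y) * g y) \<partial>lborel)" by simp
      then show "norm (\<integral>y. norm (case (s, y) of (s, y) \<Rightarrow> ?h s y) \<partial>lborel) \<le> norm (indicator {0..1::real} s * C)"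
        using bd[of "x + s *\<^sub>R v"] by (auto simp: indicator_def)
    qed
  qed
qed

text \<open>By translation invariance the integral of \<open>X (y + v) - X y\<close> is 0, and by
  the segment identity it is \<open>v\<close> times the integral of \<open>A\<close> plus
  \<open>cnj v\<close> times that of \<open>B\<close>. The choices v = 1 and v = i separate the two.
  This plays the part of Stokes' theorem without boundary terms.\<close>

lemma wirtinger_integral_zero:
  assumes d: "\<And>x. wirtinger X (A x) (B x) x" and c: "continuous_on UNIV A" "continuous_on UNIV B"
    and X: "integrable lborel X" and A: "integrable lborel A" and B: "integrable lborel B"
  shows "(\<integral>x. A x \<partial>lborel) = 0" "(\<integral>x. B x \<partial>lborel) = 0"
proof -
  have [measurable]: "A \<in> borel_measurable borel" "B \<in> borel_measurable borel"
    using c by (auto intro: borel_measurable_continuous_onI)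
  have key: "v * (\<integral>x. A x \<partial>lborel) + cnj v * (\<integral>x. B x \<partial>lborel) = 0" for v
  proof -
    define D where "D z = v * A z + cnj v * B z" for z
    have [measurable]: "D \<in> borel_measurable borel" unfolding D_def by measurable
    have D: "integrable lborel D" unfolding D_def using A B by simp
    have i: "integrable (lborel \<Otimes>\<^sub>M lborel) (\<lambda>(s, y). indicator {0..1::real} s *\<^sub>R D (y + s *\<^sub>R v))"
    proof (rule lborel_pair.Fubini_integrable)
      show "(\<lambda>(s, y). indicator {0..1::real} s *\<^sub>R D (y + s *\<^sub>R v)) \<in> borel_measurable (lborel \<Otimes>\<^sub>M lborel)" by measurable
      have "(\<integral>y. norm (D (y + s *\<^sub>R v)) \<partial>lborel) = (\<integral>y. norm (D y) \<partial>lborel)" for s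
        using integral_translate(2)[OF integrable_norm[OF D]] by simp
      then show "integrable lborel (\<lambda>s. \<integral>y. norm (case (s, y) of (s, y) \<Rightarrow> indicator {0..1::real} s *\<^sub>R D (y + s *\<^sub>R v)) \<partial>lborel)"
        by simp
      show "AE s in lborel. integrable lborel (\<lambda>y. case (s, y) of (s, y) \<Rightarrow> indicator {0..1::real} s *\<^sub>R D (y + s *\<^sub>R v))"
        using integrable_translate(2)[OF D] by auto
    qed
    have "0 = (\<integral>y. X (y + v) - X y \<partial>lborel)"
      using integral_translate(2)[OF X, of v] integrable_translate(2)[OF X, of v] X by simp
    also have "\<dots> = (\<integral>y. (\<integral>s. indicator {0..1::real} s *\<^sub>R D (y + s *\<^sub>R v) \<partial>lborel) \<partial>lborel)"
      using wirtinger_segment[OF d c] unfolding D_def by simp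
    also have "\<dots> = (\<integral>s. (\<integral>y. indicator {0..1::real} s *\<^sub>R D (y + s *\<^sub>R v) \<partial>lborel) \<partial>lborel)"
      using lborel_pair.Fubini_integral[OF i] by simp
    also have "\<dots> = (\<integral>s. indicator {0..1::real} s *\<^sub>R (\<integral>y. D y \<partial>lborel) \<partial>lborel)"
      using integral_translate(2)[OF D] by simp
    also have "\<dots> = (\<integral>y. D y \<partial>lborel)" by simp
    finally show ?thesis unfolding D_def using A B by simp
  qed
  have 1: "(\<integral>x. A x \<partial>lborel) + (\<integral>x. B x \<partial>lborel) = 0" using key[of 1] by simp
  have "\<i> * ((\<integral>x. A x \<partial>lborel) - (\<integral>x. B x \<partial>lborel)) = 0" using key[of \<i>] by (simp add: algebra_simps)
  then have "(\<integral>x. A x \<partial>lborel) - (\<integral>x. B x \<partial>lborel) = 0" by simp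
  with 1 show "(\<integral>x. A x \<partial>lborel) = 0" "(\<integral>x. B x \<partial>lborel) = 0" by (auto simp: complex_eq_iff)
qed

text \<open>Without the customary factor 1/pi. At y = x the integrand has the default value 0 of
  division by zero, on a null set.\<close>

definition cauchy_transform :: "(complex \<Rightarrow> complex) \<Rightarrow> complex \<Rightarrow> complex"
  where "cauchy_transform f x = (\<integral>y. f y / (x - y) \<partial>lborel)"

definition inv_norm_mass :: real where "inv_norm_mass = (\<integral>z. indicator (ball 0 1) z * (1 / cmod z) \<partial>lborel)"

lemma inv_norm_mass_nonneg: "0 \<le> inv_norm_mass"
  unfolding inv_norm_mass_def by (intro Bochner_Integration.integral_nonneg) auto

text \<open>Separates the singularity, paid for by the sup bound C, from the tail, paid for by t
  itself. Integrated, this gives bounds for Cauchy transforms that are uniform in x.\<close>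

lemma inverse_norm_split:
  assumes "0 \<le> t" "t \<le> C"
  shows "t / cmod z \<le> C * (indicator (ball 0 1) z * (1 / cmod z)) + t"
proof (cases "cmod z < 1")
  case True
  then have "t / cmod z \<le> C / cmod z" using assms by (intro divide_right_mono) auto
  then show ?thesis using True assms by (simp add: indicator_def)
next
  case False
  then have "t / cmod z \<le> t / 1" using assms by (intro divide_left_mono) auto
  then show ?thesis using False assms by (simp add: indicator_def)
qed

lemma cauchy_transform_integrable:
  fixes f :: "complex \<Rightarrow> 'a::{banach,second_countable_topology}"
  assumes f: "integrable lborel f" and bd: "\<And>y. norm (f y) \<le> C"
  shows "integrable lborel (\<lambda>y. norm (f y) / cmod (x - y))"
    "(\<integral>y. norm (f y) / cmod (x - y) \<partial>lborel) \<le> C * inv_norm_mass + (\<integral>y. norm (f y) \<partial>lborel)"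
proof -
  let ?k = "\<lambda>z. indicator (ball 0 1) z * (1 / cmod z) :: real"
  have [measurable]: "f \<in> borel_measurable borel" using f by auto
  have k: "integrable lborel (\<lambda>y. ?k (x - y))" "(\<integral>y. ?k (x - y) \<partial>lborel) = inv_norm_mass"
    using integrable_translate(4)[OF integrable_inverse_norm_ball, of x]
      integral_translate(4)[OF integrable_inverse_norm_ball, of x] by (auto simp: inv_norm_mass_def)
  have i: "integrable lborel (\<lambda>y. C * ?k (x - y) + norm (f y))"
    using k f by (intro Bochner_Integration.integrable_add integrable_mult_right integrable_norm)
  have le: "norm (f y) / cmod (x - y) \<le> C * ?k (x - y) + norm (f y)" for y
    by (rule inverse_norm_split) (use bd in auto)
  show 1: "integrable lborel (\<lambda>y. norm (f y) / cmod (x - y))"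
    by (rule Bochner_Integration.integrable_bound[OF i]) (use le in \<open>auto intro: order_trans[OF _ abs_ge_self]\<close>)
  have "(\<integral>y. norm (f y) / cmod (x - y) \<partial>lborel) \<le> (\<integral>y. C * ?k (x - y) + norm (f y) \<partial>lborel)"
    by (rule integral_mono[OF 1 i]) (use le in auto)
  also have "\<dots> = C * inv_norm_mass + (\<integral>y. norm (f y) \<partial>lborel)"
    by (subst Bochner_Integration.integral_add, intro integrable_mult_right k(1), intro integrable_norm f,
        simp only: integral_mult_right_zero k(2))
  finally show "(\<integral>y. norm (f y) / cmod (x - y) \<partial>lborel) \<le> C * inv_norm_mass + (\<integral>y. norm (f y) \<partial>lborel)" .
qed

lemma cauchy_transform_integrable':
  assumes f: "integrable lborel f" and bd: "\<And>y. cmod (f y) \<le> C"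
  shows "integrable lborel (\<lambda>y. f y / (x - y))"
proof -
  have [measurable]: "f \<in> borel_measurable borel" using f by auto
  show ?thesis
    by (rule Bochner_Integration.integrable_bound[OF cauchy_transform_integrable(1)[OF f bd, of x]]) (auto simp: norm_divide)
qed

lemma cauchy_transform_bound:
  assumes f: "integrable lborel f" and bd: "\<And>y. cmod (f y) \<le> C"
  shows "cmod (cauchy_transform f x) \<le> C * inv_norm_mass + (\<integral>y. norm (f y) \<partial>lborel)"
proof -
  have "cmod (cauchy_transform f x) \<le> (\<integral>y. norm (f y / (x - y)) \<partial>lborel)" unfolding cauchy_transform_def by (rule integral_norm_bound)
  then show ?thesis using cauchy_transform_integrable(2)[OF f bd, of x] by (simp add: norm_divide)
qed

text \<open>Puts the dependence on x into \<open>f\<close>, so that derivatives fall on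
  \<open>f\<close> and not on the singular kernel.\<close>

lemma cauchy_transform_flip:
  assumes f: "integrable lborel f" and bd: "\<And>y. cmod (f y) \<le> C"
  shows "integrable lborel (\<lambda>y. f (x - y) / y)" "cauchy_transform f x = (\<integral>y. f (x - y) / y \<partial>lborel)"
  using integrable_translate(4)[OF cauchy_transform_integrable'[OF f bd, of x], of x]
    integral_translate(4)[OF cauchy_transform_integrable'[OF f bd, of x], of x] by (auto simp: cauchy_transform_def)

text \<open>A uniform limit of continuous functions: replacing \<open>1/z\<close> by a bounded
  continuous kernel changes the integral by at most C times the integral of \<open>1/|z|\<close>
  over the ball of radius \<open>d n\<close>, whatever x is, and that integral tends to 0.\<close>

lemma cauchy_transform_continuous:
  assumes f: "integrable lborel f" and bd: "\<And>y. cmod (f y) \<le> C"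
  shows "continuous_on S (cauchy_transform f)"
proof -
  have [measurable]: "f \<in> borel_measurable borel" using f by auto
  have C: "0 \<le> C" using bd[of 0] norm_ge_zero order_trans by blast
  define d where "d n = 1 / real (Suc n)" for n
  have d: "0 < d n" "d n \<le> 1" for n by (auto simp: d_def)
  \<comment> \<open>Equal to \<open>1/z\<close> for \<open>|z| \<ge> d n\<close> and to the linear
    function \<open>cnj z / (d n)^2\<close> inside, hence continuous across the circle.\<close>
  define k where "k n z = cnj z /\<^sub>R (max (cmod z) (d n))\<^sup>2" for n z
  have mpos: "0 < max (cmod z) (d n)" for z n using d(1)[of n] by (simp add: max.strict_coboundedI2)
  have [measurable]: "k n \<in> borel_measurable borel" for n
    unfolding k_def by (intro borel_measurable_continuous_onI continuous_intros) (use mpos in \<open>auto simp: less_le\<close>)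
  have kb: "cmod (k n z) \<le> 1 / d n" for n z
  proof -
    have "cmod (k n z) = cmod z / (max (cmod z) (d n))\<^sup>2" by (simp add: k_def divide_inverse mult.commute)
    also have "\<dots> \<le> max (cmod z) (d n) / (max (cmod z) (d n))\<^sup>2" by (intro divide_right_mono) auto
    also have "\<dots> = 1 / max (cmod z) (d n)" using mpos[of z n] by (simp add: power2_eq_square)
    also have "\<dots> \<le> 1 / d n" using d(1)[of n] by (intro divide_left_mono mult_pos_pos mpos) auto
    finally show ?thesis .
  qed
  have kd: "cmod (1 / z - k n z) \<le> indicator (ball 0 (d n)) z * (1 / cmod z)" for n z
  proof (cases "cmod z < d n")
    case True
    show ?thesis
    proof (cases "z = 0")
      case False
      have k: "k n z = cnj z / (d n)\<^sup>2" using True by (simp add: k_def scaleR_conv_of_real divide_inverse mult.commute)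
      have "1 / z = cnj z / (cmod z)\<^sup>2"
        using False complex_div_cnj[of 1 z] by simp
      then have "1 / z - k n z = cnj z * of_real (1 / (cmod z)\<^sup>2 - 1 / (d n)\<^sup>2)"
        by (simp add: k algebra_simps)
      then have "cmod (1 / z - k n z) = cmod z * \<bar>1 / (cmod z)\<^sup>2 - 1 / (d n)\<^sup>2\<bar>"
        by (simp only: norm_mult complex_mod_cnj norm_of_real)
      moreover have "1 / (d n)\<^sup>2 \<le> 1 / (cmod z)\<^sup>2"
        using True False d(1)[of n] by (intro divide_left_mono power_mono) auto
      ultimately have "cmod (1 / z - k n z) = cmod z * (1 / (cmod z)\<^sup>2 - 1 / (d n)\<^sup>2)" by simp
      also have "\<dots> \<le> cmod z * (1 / (cmod z)\<^sup>2)" by (intro mult_left_mono) auto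
      finally have "cmod (1 / z - k n z) \<le> cmod z * (1 / (cmod z)\<^sup>2)" .
      then show ?thesis using True False by (simp add: power2_eq_square)
    qed (simp add: k_def)
  next
    case False
    then have "z \<noteq> 0" using d(1)[of n] by auto
    have "k n z = cnj z / (cmod z)\<^sup>2" using False by (simp add: k_def scaleR_conv_of_real divide_inverse mult.commute max_def)
    also have "\<dots> = 1 / z" using \<open>z \<noteq> 0\<close> complex_div_cnj[of 1 z] by simp
    finally show ?thesis using False by simp
  qed
  let ?I = "\<lambda>n z. indicator (ball 0 (d n)) z * (1 / cmod z) :: real"
  have Ii: "integrable lborel (?I n)" for n
    by (rule Bochner_Integration.integrable_bound[OF integrable_inverse_norm_ball])
       (use d(2)[of n] in \<open>auto simp: indicator_def intro!: borel_measurable_times borel_measurable_divide borel_measurable_indicator\<close>)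
  have Ilim: "(\<lambda>n. \<integral>z. ?I n z \<partial>lborel) \<longlonglongrightarrow> integral\<^sup>L lborel (\<lambda>z::complex. 0::real)"
  proof (rule integral_dominated_convergence[where w="\<lambda>z. indicator (ball 0 1) z * (1 / cmod z)"])
    show "AE z in lborel. (\<lambda>n. ?I n z) \<longlonglongrightarrow> 0"
    proof (intro AE_I2)
      fix z :: complex
      show "(\<lambda>n. ?I n z) \<longlonglongrightarrow> 0"
      proof (cases "z = 0")
        case False
        have "d \<longlonglongrightarrow> 0" unfolding d_def using LIMSEQ_inverse_real_of_nat by (simp add: inverse_eq_divide)
        then have "\<forall>\<^sub>F n in sequentially. d n < cmod z" using False order_tendstoD(2) by fastforce
        then have "\<forall>\<^sub>F n in sequentially. ?I n z = 0" by eventually_elim (simp add: indicator_def)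
        then show ?thesis by (rule tendsto_eventually)
      qed simp
    qed
    show "AE z in lborel. norm (?I n z) \<le> indicator (ball 0 1) z * (1 / cmod z)" for n
      using d(2)[of n] by (auto simp: indicator_def)
  qed (use Ii integrable_inverse_norm_ball in auto)
  have "uniform_limit UNIV (\<lambda>n x. \<integral>y. f y * k n (x - y) \<partial>lborel) (cauchy_transform f) sequentially"
  proof (rule uniform_limitI)
    fix e :: real assume e: "e > 0"
    have "(\<lambda>n. C * (\<integral>z. ?I n z \<partial>lborel)) \<longlonglongrightarrow> 0" using tendsto_mult_left[OF Ilim, of C] by simp
    then have "\<forall>\<^sub>F n in sequentially. C * (\<integral>z. ?I n z \<partial>lborel) < e" using e order_tendstoD(2) by blast
    then show "\<forall>\<^sub>F n in sequentially. \<forall>x\<in>UNIV. dist (\<integral>y. f y * k n (x - y) \<partial>lborel) (cauchy_transform f x) < e"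
    proof (eventually_elim, intro ballI)
      fix n x assume n: "C * (\<integral>z. ?I n z \<partial>lborel) < e"
      have ik: "integrable lborel (\<lambda>y. f y * k n (x - y))"
      proof (rule Bochner_Integration.integrable_bound)
        show "integrable lborel (\<lambda>y. (1 / d n) * norm (f y))" using f by simp
        show "AE y in lborel. norm (f y * k n (x - y)) \<le> norm ((1 / d n) * norm (f y))"
          using d(1)[of n] mult_left_mono[OF kb norm_ge_zero] by (auto simp: norm_mult abs_mult)
      qed measurable
      have "dist (\<integral>y. f y * k n (x - y) \<partial>lborel) (cauchy_transform f x) = norm (\<integral>y. f y / (x - y) - f y * k n (x - y) \<partial>lborel)"
        unfolding cauchy_transform_def dist_norm using ik cauchy_transform_integrable'[OF f bd, of x] by (simp add: norm_minus_commute)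
      also have "\<dots> \<le> (\<integral>y. C * ?I n (x - y) \<partial>lborel)"
      proof (rule Bochner_Integration.integral_norm_bound_integral)
        show "integrable lborel (\<lambda>y. f y / (x - y) - f y * k n (x - y))" using ik cauchy_transform_integrable'[OF f bd, of x] by simp
        show "integrable lborel (\<lambda>y. C * ?I n (x - y))" by (intro integrable_mult_right integrable_translate Ii)
        fix y
        have "f y / (x - y) - f y * k n (x - y) = f y * (1 / (x - y) - k n (x - y))" by (simp add: algebra_simps)
        also have "norm \<dots> \<le> C * ?I n (x - y)" unfolding norm_mult by (intro mult_mono bd kd C norm_ge_zero)
        finally show "norm (f y / (x - y) - f y * k n (x - y)) \<le> C * ?I n (x - y)" .
      qed
      also have "\<dots> = C * (\<integral>z. ?I n z \<partial>lborel)" using integral_translate(4)[OF Ii[of n], of x] by (simp only: integral_mult_right_zero)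
      finally show "dist (\<integral>y. f y * k n (x - y) \<partial>lborel) (cauchy_transform f x) < e" using n by simp
    qed
  qed
  moreover have "continuous_on UNIV (\<lambda>x. \<integral>y. f y * k n (x - y) \<partial>lborel)" for n
  proof (rule continuous_on_integral_dominated)
    show "integrable lborel (\<lambda>y. (1 / d n) * norm (f y))" using f by simp
    show "norm (f y * k n (x - y)) \<le> (1 / d n) * norm (f y)" for x y
      using d(1)[of n] mult_left_mono[OF kb norm_ge_zero] by (auto simp: norm_mult)
    show "continuous_on UNIV (\<lambda>x. f y * k n (x - y))" for y
      unfolding k_def by (intro continuous_intros) (use mpos in \<open>auto simp: less_le\<close>)
  qed measurable
  ultimately have "continuous_on UNIV (cauchy_transform f)"
    by (intro uniform_limit_theorem[where F=sequentially]) auto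
  then show ?thesis using continuous_on_subset by blast
qed

text \<open>Derivatives commute with convolution: after the flip an increment of the transform is
  the integral of increments of \<open>f\<close>, the segment identity rewrites these through
  \<open>A\<close> and \<open>B\<close>, and Fubini's theorem yields the segment identity of the
  transform.\<close>

lemma wirtinger_cauchy_transform:
  assumes d: "\<And>x. wirtinger f (A x) (B x) x" and c: "continuous_on UNIV A" "continuous_on UNIV B"
    and f: "integrable lborel f" and A: "integrable lborel A" and B: "integrable lborel B"
    and bd: "\<And>y. cmod (f y) \<le> C" "\<And>y. cmod (A y) \<le> C" "\<And>y. cmod (B y) \<le> C"
  shows "wirtinger (cauchy_transform f) (cauchy_transform A x) (cauchy_transform B x) x"
proof (rule wirtinger_from_segments)
  show "continuous_on UNIV (cauchy_transform A)" "continuous_on UNIV (cauchy_transform B)"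
    using cauchy_transform_continuous A B bd by blast+
  fix v
  have [measurable]: "A \<in> borel_measurable borel" "B \<in> borel_measurable borel"
    using A B by auto
  \<comment> \<open>The derivative of \<open>f\<close> in the direction v.\<close>
  define D where "D z = v * A z + cnj v * B z" for z
  have [measurable]: "D \<in> borel_measurable borel" unfolding D_def by measurable
  have D: "integrable lborel D" unfolding D_def using A B by simp
  have Db: "cmod (D z) \<le> cmod v * C + cmod v * C" for z
    unfolding D_def by (rule order_trans[OF norm_triangle_ineq add_mono]) (auto simp: norm_mult intro!: mult_left_mono bd)
  have cD: "cauchy_transform D z = v * cauchy_transform A z + cnj v * cauchy_transform B z" for z
  proof -
    have "cauchy_transform D z = (\<integral>y. v * (A y / (z - y)) + cnj v * (B y / (z - y)) \<partial>lborel)"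
      by (simp add: cauchy_transform_def D_def add_divide_distrib)
    also have "\<dots> = v * cauchy_transform A z + cnj v * cauchy_transform B z"
      unfolding cauchy_transform_def using cauchy_transform_integrable'[OF A bd(2), of z] cauchy_transform_integrable'[OF B bd(3), of z]
      by (simp del: times_divide_eq_right)
    finally show ?thesis .
  qed
  have i: "integrable (lborel \<Otimes>\<^sub>M lborel) (\<lambda>(s, y). indicator {0..1::real} s *\<^sub>R (D (x + s *\<^sub>R v - y) * (1 / y)))"
  proof (rule segment_integrable)
    fix x
    show "integrable lborel (\<lambda>y. D (x - y) * (1 / y))" using cauchy_transform_flip(1)[OF D Db, of x] by simp
    have "(\<integral>y. norm (D (x - y) * (1 / y)) \<partial>lborel) = (\<integral>y. norm (D y) / norm (x - y) \<partial>lborel)"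
      using integral_translate(4)[OF cauchy_transform_integrable(1)[OF D Db, of x], of x] by (simp add: norm_divide norm_mult)
    then show "(\<integral>y. norm (D (x - y) * (1 / y)) \<partial>lborel) \<le> (cmod v * C + cmod v * C) * inv_norm_mass + (\<integral>y. norm (D y) \<partial>lborel)"
      using cauchy_transform_integrable(2)[OF D Db, of x] by simp
  qed measurable
  have "cauchy_transform f (x + v) - cauchy_transform f x = (\<integral>y. f (x + v - y) / y - f (x - y) / y \<partial>lborel)"
    using cauchy_transform_flip[OF f bd(1)] by simp
  also have "\<dots> = (\<integral>y. (\<integral>s. indicator {0..1::real} s *\<^sub>R (D (x + s *\<^sub>R v - y) * (1 / y)) \<partial>lborel) \<partial>lborel)"
  proof (rule Bochner_Integration.integral_cong[OF refl])
    fix y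
    have "f (x + v - y) / y - f (x - y) / y = (f ((x - y) + v) - f (x - y)) * (1 / y)" by (simp add: algebra_simps diff_divide_distrib)
    also have "\<dots> = (\<integral>s. indicator {0..1::real} s *\<^sub>R D ((x - y) + s *\<^sub>R v) \<partial>lborel) * (1 / y)"
      using wirtinger_segment[OF d c, of "x - y" v] by (simp add: D_def)
    also have "\<dots> = (\<integral>s. indicator {0..1::real} s *\<^sub>R D ((x - y) + s *\<^sub>R v) * (1 / y) \<partial>lborel)"
      by (rule integral_mult_left_zero[symmetric])
    finally show "f (x + v - y) / y - f (x - y) / y = (\<integral>s. indicator {0..1::real} s *\<^sub>R (D (x + s *\<^sub>R v - y) * (1 / y)) \<partial>lborel)"
      by (simp add: algebra_simps)
  qed
  also have "\<dots> = (\<integral>s. (\<integral>y. indicator {0..1::real} s *\<^sub>R (D (x + s *\<^sub>R v - y) * (1 / y)) \<partial>lborel) \<partial>lborel)"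
    using lborel_pair.Fubini_integral[OF i] by simp
  also have "\<dots> = (\<integral>s. indicator {0..1::real} s *\<^sub>R cauchy_transform D (x + s *\<^sub>R v) \<partial>lborel)"
    using cauchy_transform_flip(2)[OF D Db] by simp
  finally show "cauchy_transform f (x + v) - cauchy_transform f x = (\<integral>s. indicator {0..1::real} s *\<^sub>R (v * cauchy_transform A (x + s *\<^sub>R v) + cnj v * cauchy_transform B (x + s *\<^sub>R v)) \<partial>lborel)"
    by (simp add: cD)
qed

section \<open>Cauchy--Pompeiu formula and logarithmic potential\<close>

text \<open>Boundedness of \<open>X\<close> together with continuity at the single point x is
  enough: after rescaling, \<open>X (x + e y)\<close> converges for each y under the majorant
  \<open>C * kern 1 y\<close>. Indicators of boxes can therefore be used later.\<close>

lemma kern_approx_identity: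
  fixes X :: "complex \<Rightarrow> 'b::{banach,second_countable_topology}"
  assumes [measurable]: "X \<in> borel_measurable borel" and bd: "\<And>z. norm (X z) \<le> C" and c: "isCont X x"
  shows "(\<lambda>n. \<integral>z. kern (1 / real (Suc n)) (z - x) *\<^sub>R X z \<partial>lborel) \<longlonglongrightarrow> kern_mass *\<^sub>R X x"
proof -
  define e where "e n = 1 / real (Suc n)" for n
  have e: "0 < e n" for n by (simp add: e_def)
  have lim: "e \<longlonglongrightarrow> 0" unfolding e_def using LIMSEQ_inverse_real_of_nat by (simp add: inverse_eq_divide)
  have i: "integrable lborel (\<lambda>z. kern (e n) (z - x) *\<^sub>R X z)" for n
  proof (rule Bochner_Integration.integrable_bound)
    show "integrable lborel (\<lambda>z. C * kern (e n) (z - x))"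
      using integrable_translate(3)[OF integrable_kern[OF e]] by simp
    show "AE z in lborel. norm (kern (e n) (z - x) *\<^sub>R X z) \<le> norm (C * kern (e n) (z - x))"
      by (auto simp: abs_mult kern_nonneg mult.commute intro!: mult_right_mono order_trans[OF bd abs_ge_self])
  qed measurable
  have "(\<lambda>n. \<integral>y. kern 1 y *\<^sub>R X (x + e n *\<^sub>R y) \<partial>lborel) \<longlonglongrightarrow> (\<integral>y. kern 1 y *\<^sub>R X x \<partial>lborel)"
  proof (rule integral_dominated_convergence[where w="\<lambda>y. C * kern 1 y"])
    show "AE y in lborel. (\<lambda>n. kern 1 y *\<^sub>R X (x + e n *\<^sub>R y)) \<longlonglongrightarrow> kern 1 y *\<^sub>R X x"
    proof (intro AE_I2 tendsto_intros)
      fix y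
      have "(\<lambda>n. x + e n *\<^sub>R y) \<longlonglongrightarrow> x + 0 *\<^sub>R y" by (intro tendsto_intros lim)
      then show "(\<lambda>n. X (x + e n *\<^sub>R y)) \<longlonglongrightarrow> X x" using isCont_tendsto_compose[OF c] by simp
    qed
    show "AE y in lborel. norm (kern 1 y *\<^sub>R X (x + e n *\<^sub>R y)) \<le> C * kern 1 y" for n
      using mult_left_mono[OF bd kern_nonneg] by (auto simp: kern_nonneg mult.commute[of C])
  qed (use integrable_kern1 in auto)
  moreover have "(\<integral>y. kern 1 y *\<^sub>R X x \<partial>lborel) = kern_mass *\<^sub>R X x"
    using integrable_kern1 by (simp add: kern_mass_def)
  ultimately show ?thesis unfolding kern_scale[OF e i] e_def[symmetric] by simp
qed

section \<open>The regularised inverse and the Cauchy--Pompeiu formula\<close>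

lemma wirtinger_id: "wirtinger (\<lambda>z. z) 1 0 x" by (simp add: wirtinger_def)

lemma wirtinger_const: "wirtinger (\<lambda>z. c) 0 0 x" by (simp add: wirtinger_def)

lemma wirtinger_add:
  assumes "wirtinger f a b x" "wirtinger g c d x"
  shows "wirtinger (\<lambda>z. f z + g z) (a + c) (b + d) x"
  using has_derivative_add[OF assms[unfolded wirtinger_def]]
  by (simp add: wirtinger_def algebra_simps)

lemma wirtinger_compose_field:
  assumes f: "wirtinger f a b x" and h: "(h has_field_derivative h') (at (f x))"
  shows "wirtinger (\<lambda>z. h (f z)) (h' * a) (h' * b) x"
proof -
  have "((\<lambda>z. h (f z)) has_derivative (\<lambda>v. h' * (v * a + cnj v * b))) (at x)"
    using has_derivative_compose[OF f[unfolded wirtinger_def] h[unfolded has_field_derivative_def]] .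
  then show ?thesis by (simp add: wirtinger_def algebra_simps)
qed

lemma wirtinger_translate: "wirtinger f a b (x - c) \<Longrightarrow> wirtinger (\<lambda>z. f (z - c)) a b x"
  unfolding wirtinger_def
  by (rule has_derivative_compose[where f="\<lambda>z. z - c" and g=f and f'="\<lambda>v. v"])
     (auto intro!: derivative_eq_intros)

lemma integrable_bounded_mult:
  fixes f k :: "complex \<Rightarrow> complex"
  assumes f: "integrable lborel f" and [measurable]: "k \<in> borel_measurable borel" and bd: "\<And>z. cmod (k z) \<le> C"
  shows "integrable lborel (\<lambda>z. f z * k z)"
proof (rule Bochner_Integration.integrable_bound)
  have [measurable]: "f \<in> borel_measurable borel" using f by auto
  show "integrable lborel (\<lambda>z. C * norm (f z))" using f by simp
  show "AE z in lborel. norm (f z * k z) \<le> norm (C * norm (f z))"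
    using mult_left_mono[OF order_trans[OF bd abs_ge_self] norm_ge_zero] by (auto simp: norm_mult abs_mult mult.commute)
qed (use f in measurable)

text \<open>\<open>k\<close> is twice the z-derivative of \<open>(1/2) ln (|z|^2 + e^2)\<close> and
  approximates \<open>1/z\<close>; its derivative with respect to \<open>cnj z\<close> is
  \<open>e^2 / (|z|^2 + e^2)^2\<close>, half the kernel. Writing \<open>|z|^2\<close> as
  \<open>z * cnj z\<close> makes the product and chain rules applicable.\<close>

lemma reg_inverse:
  fixes e :: real
  assumes e: "e > 0"
  defines "k \<equiv> \<lambda>z. cnj z * inverse (z * cnj z + of_real (e\<^sup>2))"
  shows "wirtinger k (- (cnj z)\<^sup>2 * (inverse (z * cnj z + of_real (e\<^sup>2)))\<^sup>2) (of_real (kern e z / 2)) z"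
    "cmod (k z) \<le> 1 / cmod z" "cmod (k z) \<le> 1 / e"
    "cmod (- (cnj z)\<^sup>2 * (inverse (z * cnj z + of_real (e\<^sup>2)))\<^sup>2) \<le> 1 / e\<^sup>2"
    "cmod (of_real (kern e z / 2) :: complex) \<le> 1 / e\<^sup>2"
    "z * cnj z + of_real (e\<^sup>2) \<noteq> 0"
proof -
  let ?r = "\<lambda>z. z * cnj z + of_real (e\<^sup>2)"
  define r where "r = (cmod z)\<^sup>2 + e\<^sup>2"
  have r: "?r z = of_real r" by (simp add: r_def complex_norm_square[symmetric] del: of_real_power)
  have rp: "r > 0" using e by (auto simp: r_def intro: add_nonneg_pos)
  show nz: "?r z \<noteq> 0" unfolding r using rp by simp
  have "wirtinger ?r (1 * cnj z + z * 0 + 0) (0 * cnj z + z * 1 + 0) z"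
    using wirtinger_add[OF wirtinger_mult[OF wirtinger_id wirtinger_cnj[OF wirtinger_id]] wirtinger_const] by simp
  then have "wirtinger ?r (cnj z) z z" by simp
  then have "wirtinger (\<lambda>z. inverse (?r z)) (- (inverse (?r z))\<^sup>2 * cnj z) (- (inverse (?r z))\<^sup>2 * z) z"
    using DERIV_inverse[OF nz] unfolding numeral_2_eq_2 by (rule wirtinger_compose_field[where h=inverse])
  from wirtinger_mult[OF wirtinger_cnj[OF wirtinger_id] this]
  have w: "wirtinger k (cnj 0 * inverse (?r z) + cnj z * (- (inverse (?r z))\<^sup>2 * cnj z)) (cnj 1 * inverse (?r z) + cnj z * (- (inverse (?r z))\<^sup>2 * z)) z"
    unfolding k_def .
  have "cnj 1 * inverse (?r z) + cnj z * (- (inverse (?r z))\<^sup>2 * z) = (inverse (?r z))\<^sup>2 * (?r z - z * cnj z)"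
  proof -
    have "cnj 1 * inverse r + cnj z * (- (inverse r)\<^sup>2 * z) = (inverse r)\<^sup>2 * (r - z * cnj z)" if "r \<noteq> 0" for r :: complex
      using that by (simp add: field_simps power2_eq_square)
    then show ?thesis using nz by blast
  qed
  also have "?r z - z * cnj z = of_real (e\<^sup>2)" by simp
  also have "(inverse (?r z))\<^sup>2 * of_real (e\<^sup>2) = of_real ((inverse r)\<^sup>2 * e\<^sup>2)"
    unfolding r by simp
  also have "(inverse r)\<^sup>2 * e\<^sup>2 = kern e z / 2"
    unfolding kern_def r_def[symmetric] by (simp add: field_simps)
  finally have b: "cnj 1 * inverse (?r z) + cnj z * (- (inverse (?r z))\<^sup>2 * z) = of_real (kern e z / 2)" .
  have a: "cnj 0 * inverse q + cnj z * (- (inverse q)\<^sup>2 * cnj z) = - (cnj z)\<^sup>2 * (inverse q)\<^sup>2" for q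
    by (simp add: power2_eq_square)
  show "wirtinger k (- (cnj z)\<^sup>2 * (inverse (?r z))\<^sup>2) (of_real (kern e z / 2)) z"
    using w unfolding a b .
  have kz: "cmod (k z) = cmod z / r" using rp unfolding k_def r by (simp add: norm_mult norm_inverse divide_inverse)
  show "cmod (k z) \<le> 1 / cmod z"
  proof (cases "z = 0")
    case False
    have "cmod z / r \<le> cmod z / (cmod z)\<^sup>2" using False by (intro divide_left_mono) (auto simp: r_def rp intro!: mult_pos_pos add_nonneg_pos rp[unfolded r_def])
    then show ?thesis using False kz by (simp add: power2_eq_square)
  qed (simp add: k_def)
  have er: "e\<^sup>2 \<le> r" "(cmod z)\<^sup>2 \<le> r" by (auto simp: r_def)
  have "e * cmod z \<le> r"
  proof -
    have "0 \<le> (e - cmod z)\<^sup>2" by simp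
    then have "2 * (e * cmod z) \<le> r" by (simp add: power2_diff r_def)
    moreover have "0 \<le> e * cmod z" using e by simp
    ultimately show ?thesis by linarith
  qed
  then show "cmod (k z) \<le> 1 / e" unfolding kz using rp e by (simp add: field_simps)
  have a: "t / r\<^sup>2 \<le> 1 / e\<^sup>2" if "t \<le> r" for t
  proof -
    have "t / r\<^sup>2 \<le> r / r\<^sup>2" using that by (intro divide_right_mono) auto
    also have "\<dots> = 1 / r" using rp by (simp add: power2_eq_square)
    also have "\<dots> \<le> 1 / e\<^sup>2" using er e rp by (intro divide_left_mono) auto
    finally show ?thesis .
  qed
  show "cmod (- (cnj z)\<^sup>2 * (inverse (?r z))\<^sup>2) \<le> 1 / e\<^sup>2"
    using a[OF er(2)] rp unfolding r by (simp add: norm_mult norm_power norm_inverse divide_inverse power_inverse)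
  show "cmod (of_real (kern e z / 2) :: complex) \<le> 1 / e\<^sup>2"
  proof -
    have "kern e z / 2 = e\<^sup>2 / r\<^sup>2" by (simp add: kern_def r_def)
    then show ?thesis using a[OF er(1)] by (simp only: norm_of_real) simp
  qed
qed

text \<open>The function \<open>X z * k n (z - x)\<close> is integrable and C^1, so its derivative
  with respect to \<open>cnj z\<close> has integral zero. As n grows, the term with \<open>B\<close>
  converges by the majorant \<open>1/|z - x|\<close>, and the term with \<open>kern\<close> picks
  out \<open>X x\<close>.\<close>

lemma cauchy_pompeiu:
  assumes d: "\<And>x. wirtinger X (A x) (B x) x" and c: "continuous_on UNIV A" "continuous_on UNIV B"
    and X: "integrable lborel X" and A: "integrable lborel A" and B: "integrable lborel B"
    and bd: "\<And>y. cmod (X y) \<le> C" "\<And>y. cmod (B y) \<le> C"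
  shows "cauchy_transform B x = of_real (kern_mass / 2) * X x"
proof -
  have cX: "continuous_on UNIV X" using wirtinger_continuous[OF d] .
  have [measurable]: "X \<in> borel_measurable borel" "A \<in> borel_measurable borel" "B \<in> borel_measurable borel"
    using X A B by auto
  define e where "e n = 1 / real (Suc n)" for n
  have e: "0 < e n" for n by (simp add: e_def)
  have lim: "e \<longlonglongrightarrow> 0" unfolding e_def using LIMSEQ_inverse_real_of_nat by (simp add: inverse_eq_divide)
  define r where "r n z = z * cnj z + of_real ((e n)\<^sup>2)" for n z
  define k where "k n z = cnj z * inverse (r n z)" for n z
  define ka where "ka n z = - (cnj z)\<^sup>2 * (inverse (r n z))\<^sup>2" for n z
  define kb where "kb n z = (of_real (kern (e n) z / 2) :: complex)" for n z
  note reg = reg_inverse[OF e, folded r_def, folded k_def ka_def kb_def]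
  have rnz: "r n z \<noteq> 0" for n z using reg(6) .
  have ck: "continuous_on UNIV (k n)" "continuous_on UNIV (ka n)" "continuous_on UNIV (kb n)" for n
  proof -
    have cr: "continuous_on UNIV (r n)" unfolding r_def by (intro continuous_intros)
    show "continuous_on UNIV (k n)" "continuous_on UNIV (ka n)"
      unfolding k_def ka_def by (intro continuous_intros cr ballI rnz)+
    have "(cmod z)\<^sup>2 + (e n)\<^sup>2 \<noteq> 0" for z using e[of n] by (simp add: add_nonneg_eq_0_iff)
    then show "continuous_on UNIV (kb n)" unfolding kb_def kern_def by (intro continuous_intros) auto
  qed
  have [measurable]: "k n \<in> borel_measurable borel" "ka n \<in> borel_measurable borel" "kb n \<in> borel_measurable borel" for n
    using ck by (auto intro: borel_measurable_continuous_onI)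
  have zero: "(\<integral>z. B z * k n (z - x) \<partial>lborel) + (\<integral>z. X z * kb n (z - x) \<partial>lborel) = 0" for n
  proof -
    have i: "integrable lborel (\<lambda>z. A z * k n (z - x))" "integrable lborel (\<lambda>z. X z * k n (z - x))"
      "integrable lborel (\<lambda>z. B z * k n (z - x))" "integrable lborel (\<lambda>z. X z * ka n (z - x))" "integrable lborel (\<lambda>z. X z * kb n (z - x))"
      by (rule integrable_bounded_mult[OF A _ reg(3)] integrable_bounded_mult[OF B _ reg(3)] integrable_bounded_mult[OF X _ reg(3)]
          integrable_bounded_mult[OF X _ reg(4)] integrable_bounded_mult[OF X _ reg(5)]; measurable)+
    have ct: "continuous_on UNIV (\<lambda>z. h (z - x))" if "continuous_on UNIV h" for h :: "complex \<Rightarrow> complex"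
      by (rule continuous_on_compose2[OF that]) (auto intro!: continuous_intros)
    have "(\<integral>z. B z * k n (z - x) + X z * kb n (z - x) \<partial>lborel) = 0"
    proof (rule wirtinger_integral_zero(2)[where X="\<lambda>z. X z * k n (z - x)" and A="\<lambda>z. A z * k n (z - x) + X z * ka n (z - x)"])
      show "wirtinger (\<lambda>z. X z * k n (z - x)) (A z * k n (z - x) + X z * ka n (z - x)) (B z * k n (z - x) + X z * kb n (z - x)) z" for z
        by (intro wirtinger_mult d wirtinger_translate reg(1))
    qed (intro continuous_intros c cX ct ck Bochner_Integration.integrable_add i)+
    then show ?thesis using i by simp
  qed
  have l1: "(\<lambda>n. \<integral>z. B z * k n (z - x) \<partial>lborel) \<longlonglongrightarrow> (\<integral>z. B z / (z - x) \<partial>lborel)"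
  proof (rule integral_dominated_convergence[where w="\<lambda>z. norm (B z) / cmod (x - z)"])
    show "AE z in lborel. (\<lambda>n. B z * k n (z - x)) \<longlonglongrightarrow> B z / (z - x)"
    proof (intro AE_I2)
      fix z
      have "(\<lambda>n. k n y) \<longlonglongrightarrow> 1 / y" for y
      proof (cases "y = 0")
        case False
        have "(\<lambda>n. k n y) \<longlonglongrightarrow> cnj y * inverse (y * cnj y + of_real (0\<^sup>2))"
          unfolding k_def r_def using False by (intro tendsto_intros lim) auto
        then show ?thesis using False by (simp add: field_simps)
      qed (simp add: k_def)
      then show "(\<lambda>n. B z * k n (z - x)) \<longlonglongrightarrow> B z / (z - x)"
        using tendsto_mult_left[of "\<lambda>n. k n (z - x)" "1 / (z - x)" sequentially "B z"] by simp
    qed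
    show "AE z in lborel. norm (B z * k n (z - x)) \<le> norm (B z) / cmod (x - z)" for n
    proof (intro AE_I2)
      fix z
      show "norm (B z * k n (z - x)) \<le> norm (B z) / cmod (x - z)"
        using mult_left_mono[OF reg(2)[of n "z - x"] norm_ge_zero[of "B z"]] by (simp add: norm_mult norm_minus_commute)
    qed
  qed (use cauchy_transform_integrable(1)[OF B bd(2)] in auto)
  have l2: "(\<lambda>n. \<integral>z. X z * kb n (z - x) \<partial>lborel) \<longlonglongrightarrow> of_real (kern_mass / 2) * X x"
  proof -
    have "(\<lambda>n. (1/2) * (\<integral>z. kern (e n) (z - x) *\<^sub>R X z \<partial>lborel)) \<longlonglongrightarrow> (1/2) * (kern_mass *\<^sub>R X x)"
      unfolding e_def
      by (intro tendsto_intros kern_approx_identity[OF _ bd(1)]) (use cX in \<open>auto simp: continuous_on_eq_continuous_at\<close>)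
    moreover have "(1/2) * (\<integral>z. kern (e n) (z - x) *\<^sub>R X z \<partial>lborel) = (\<integral>z. X z * kb n (z - x) \<partial>lborel)" for n
      by (subst integral_mult_right_zero[symmetric]) (simp add: kb_def scaleR_conv_of_real mult.commute)
    ultimately show ?thesis by (simp add: scaleR_conv_of_real)
  qed
  have "(\<integral>z. B z / (z - x) \<partial>lborel) + of_real (kern_mass / 2) * X x = 0"
    using LIMSEQ_unique[OF tendsto_add[OF l1 l2]] zero by simp
  \<comment> \<open>The transform has \<open>x - y\<close> in the denominator, the regularised
    kernel was centred as \<open>z - x\<close>; hence the sign.\<close>
  moreover have "cauchy_transform B x = - (\<integral>z. B z / (z - x) \<partial>lborel)"
    unfolding cauchy_transform_def by (subst integral_minus[symmetric]) (metis minus_diff_eq minus_divide_right)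
  ultimately show ?thesis by (simp add: add_eq_0_iff)
qed

text \<open>Subtracting \<open>ln (1 + cmod y)\<close> makes the integral converge for every bounded
  integrable \<open>f\<close>, even if \<open>f\<close> has no logarithmic moment. The point y = x
  contributes through \<open>ln 0 = 0\<close>.\<close>

definition log_potential :: "(complex \<Rightarrow> real) \<Rightarrow> complex \<Rightarrow> real"
  where "log_potential f x = (\<integral>y. f y * (ln (cmod (x - y)) - ln (1 + cmod y)) \<partial>lborel)"

text \<open>Logarithms of \<open>|x - y| \<le> (1 + |x|) (1 + |y|)\<close> and of
  \<open>1 + |y| \<le> (1 + |x|) (1 + |x - y|)\<close>. The case x = y holds by the default values
  of \<open>ln\<close> and of division.\<close>

lemma ln_bound:
  "ln (cmod (x - y)) - ln (1 + cmod y) \<le> ln (1 + cmod x)"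
  "- (ln (cmod (x - y)) - ln (1 + cmod y)) \<le> ln (1 + cmod x) + 1 / cmod (x - y)"
proof -
  have p: "0 < 1 + cmod x" "0 < 1 + cmod y" by (auto intro: add_pos_nonneg)
  have 0: "0 \<le> ln (1 + cmod x)" "0 \<le> ln (1 + cmod y)" by auto
  show "ln (cmod (x - y)) - ln (1 + cmod y) \<le> ln (1 + cmod x)"
  proof (cases "x = y")
    case False
    have "cmod (x - y) \<le> cmod x + cmod y" by (rule norm_triangle_ineq4)
    also have "\<dots> \<le> (1 + cmod x) * (1 + cmod y)" by (simp add: algebra_simps)
    finally have "ln (cmod (x - y)) \<le> ln ((1 + cmod x) * (1 + cmod y))" using False p by (subst ln_le_cancel_iff) auto
    then show ?thesis using p by (simp add: ln_mult)
  qed (use 0 in simp)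
  show "- (ln (cmod (x - y)) - ln (1 + cmod y)) \<le> ln (1 + cmod x) + 1 / cmod (x - y)"
  proof (cases "x = y")
    case False
    define t where "t = cmod (x - y)"
    have t: "t > 0" using False by (simp add: t_def)
    have "cmod y \<le> cmod x + t" unfolding t_def using norm_triangle_ineq3[of x y] by linarith
    moreover have "0 \<le> t * cmod x" using t by simp
    ultimately have "1 + cmod y \<le> (1 + cmod x) * (1 + t)" by (simp add: algebra_simps)
    also have "\<dots> = (1 + cmod x) * t * (1 + 1 / t)" using t by (simp add: field_simps)
    finally have "ln (1 + cmod y) \<le> ln ((1 + cmod x) * t * (1 + 1 / t))" using p t by (subst ln_le_cancel_iff) (auto intro!: mult_pos_pos add_pos_pos)
    also have "\<dots> = ln (1 + cmod x) + ln t + ln (1 + 1 / t)"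
    proof -
      have "0 < 1 + 1 / t" using t by (auto intro: add_pos_pos)
      then show ?thesis using p t by (simp add: ln_mult del: distrib_left)
    qed
    also have "ln (1 + 1 / t) \<le> 1 / t" using t by (intro ln_add_one_self_le_self) auto
    finally show ?thesis by (simp add: t_def)
  qed (use 0 in simp)
qed

lemma log_potential_integrable:
  assumes f: "integrable lborel f" and bd: "\<And>y. \<bar>f y\<bar> \<le> C"
  shows "integrable lborel (\<lambda>y. f y * (ln (cmod (x - y)) - ln (1 + cmod y)))"
proof (rule Bochner_Integration.integrable_bound)
  have [measurable]: "f \<in> borel_measurable borel" using f by auto
  have f': "integrable lborel (\<lambda>y. norm (f y))" using f by simp
  show "integrable lborel (\<lambda>y. ln (1 + cmod x) * norm (f y) + norm (f y) / cmod (x - y))"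
    using cauchy_transform_integrable(1)[OF f, of C x] bd f' by (intro Bochner_Integration.integrable_add integrable_mult_right) auto
  show "AE y in lborel. norm (f y * (ln (cmod (x - y)) - ln (1 + cmod y))) \<le> norm (ln (1 + cmod x) * norm (f y) + norm (f y) / cmod (x - y))"
  proof (intro AE_I2)
    fix y
    have "\<bar>ln (cmod (x - y)) - ln (1 + cmod y)\<bar> \<le> ln (1 + cmod x) + 1 / cmod (x - y)"
      using ln_bound[of x y] by (smt (verit) divide_nonneg_nonneg norm_ge_zero)
    then have "\<bar>f y\<bar> * \<bar>ln (cmod (x - y)) - ln (1 + cmod y)\<bar> \<le> \<bar>f y\<bar> * (ln (1 + cmod x) + 1 / cmod (x - y))" by (intro mult_left_mono) auto
    then have "norm (f y * (ln (cmod (x - y)) - ln (1 + cmod y))) \<le> \<bar>f y\<bar> * (ln (1 + cmod x) + 1 / cmod (x - y))"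
      unfolding real_norm_def abs_mult .
    also have "\<dots> \<le> norm (ln (1 + cmod x) * norm (f y) + norm (f y) / cmod (x - y))"
      by (simp add: distrib_left mult.commute)
    finally show "norm (f y * (ln (cmod (x - y)) - ln (1 + cmod y))) \<le> norm (ln (1 + cmod x) * norm (f y) + norm (f y) / cmod (x - y))" .
  qed
qed (use f in measurable)

text \<open>The growth information at infinity: the potential grows at most logarithmically, with
  rate the total mass, so its exponential grows at most polynomially.\<close>

lemma log_potential_le:
  assumes f: "integrable lborel f" and bd: "\<And>y. \<bar>f y\<bar> \<le> C" and nn: "\<And>y. 0 \<le> f y"
  shows "log_potential f x \<le> (\<integral>y. f y \<partial>lborel) * ln (1 + cmod x)"
proof -
  have "log_potential f x \<le> (\<integral>y. f y * ln (1 + cmod x) \<partial>lborel)"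
    unfolding log_potential_def by (intro integral_mono log_potential_integrable[OF f bd] integrable_mult_left f mult_left_mono ln_bound nn)
  then show ?thesis by simp
qed

lemma inner_sgn_over_norm: "z \<noteq> 0 \<Longrightarrow> (h \<bullet> sgn z) / cmod z = Re (h / z)"
  by (simp add: sgn_div_norm inner_complex_def Re_divide cmod_power2[symmetric] divide_inverse)
     (simp add: power2_eq_square algebra_simps)

lemma has_derivative_ln_cmod:
  assumes "z \<noteq> 0" shows "((\<lambda>z. ln (cmod z)) has_derivative (\<lambda>h. (h \<bullet> sgn z) / cmod z)) (at z)"
proof -
  have n: "(cmod has_derivative (\<lambda>h. h \<bullet> sgn z)) (at z)"
    using has_derivative_norm[OF assms] .
  have "(ln has_derivative (\<lambda>h. h / cmod z)) (at (cmod z))"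
  proof -
    have "(\<lambda>h. h / cmod z) = (*) (inverse (cmod z))" by (simp add: fun_eq_iff divide_inverse mult.commute)
    then show ?thesis using DERIV_ln[of "cmod z"] assms by (simp add: has_field_derivative_def)
  qed
  from has_derivative_compose[OF n this] show ?thesis .
qed

text \<open>The derivative of \<open>ln |z|\<close> in the direction v is \<open>Re (v / z)\<close>.
  The complex integral is kept under \<open>Re\<close> because it becomes a Cauchy transform after
  integration over the density.\<close>

lemma segment_ln:
  assumes nz: "\<And>s. 0 \<le> s \<Longrightarrow> s \<le> 1 \<Longrightarrow> x + s *\<^sub>R v \<noteq> 0"
  shows "ln (cmod (x + v)) - ln (cmod x) = Re (\<integral>s. indicator {0..1::real} s *\<^sub>R (v / (x + s *\<^sub>R v)) \<partial>lborel)"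
    "integrable lborel (\<lambda>s. indicator {0..1::real} s *\<^sub>R (v / (x + s *\<^sub>R v)))"
proof -
  let ?g = "\<lambda>s::real. v / (x + s *\<^sub>R v)"
  have hi: "((\<lambda>s. Re (?g s)) has_integral (ln (cmod (x + 1 *\<^sub>R v)) - ln (cmod (x + 0 *\<^sub>R v)))) {0..1}"
  proof (rule fundamental_theorem_of_calculus)
    fix s :: real assume s: "s \<in> {0..1}"
    define z where "z = x + s *\<^sub>R v"
    have z: "z \<noteq> 0" using nz s by (auto simp: z_def)
    have 1: "((\<lambda>z. ln (cmod z)) has_derivative (\<lambda>h. (h \<bullet> sgn z) / cmod z)) (at (x + s *\<^sub>R v))"
      using has_derivative_ln_cmod[OF z] by (simp add: z_def)
    have "((\<lambda>s::real. ln (cmod (x + s *\<^sub>R v))) has_derivative (\<lambda>h. ((h *\<^sub>R v) \<bullet> sgn z) / cmod z)) (at s within {0..1})"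
      by (rule has_derivative_compose[where g="\<lambda>z. ln (cmod z)" and f="\<lambda>s. x + s *\<^sub>R v", OF _ 1]) (auto intro!: derivative_eq_intros)
    moreover have "((h *\<^sub>R v) \<bullet> sgn z) / cmod z = h * Re (?g s)" for h
      using inner_sgn_over_norm[OF z, of v] unfolding z_def[symmetric] by (simp flip: times_divide_eq_right)
    ultimately show "((\<lambda>s. ln (cmod (x + s *\<^sub>R v))) has_vector_derivative Re (?g s)) (at s within {0..1})"
      by (simp add: has_vector_derivative_def)
  qed simp
  have c: "continuous_on {0..1} ?g" by (intro continuous_intros) (use nz in auto)
  show i: "integrable lborel (\<lambda>s. indicator {0..1::real} s *\<^sub>R ?g s)"
    using borel_integrable_atLeastAtMost'[OF c] unfolding set_integrable_def .
  have "set_integrable lborel {0..1} (\<lambda>s. Re (?g s))"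
    by (rule borel_integrable_atLeastAtMost') (intro continuous_intros c)
  then have "(LINT s:{0..1}|lborel. Re (?g s)) = integral {0..1} (\<lambda>s. Re (?g s))" by (rule set_borel_integral_eq_integral)
  also have "\<dots> = ln (cmod (x + v)) - ln (cmod x)" using hi by (simp add: integral_unique)
  finally show "ln (cmod (x + v)) - ln (cmod x) = Re (\<integral>s. indicator {0..1::real} s *\<^sub>R ?g s \<partial>lborel)"
    using integral_Re[OF i] by (simp add: set_lebesgue_integral_def)
qed

text \<open>For almost every y the segment from x to x + v avoids y, so increments of
  \<open>ln |x - y|\<close> are segment integrals of \<open>Re (v / (x - y))\<close>. Fubini's
  theorem turns them into the real part of v times the Cauchy transform; a real part is half the sum
  with the conjugate, whence the two derivatives.\<close>

lemma wirtinger_log_potential: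
  assumes f: "integrable lborel f" and bd: "\<And>y. \<bar>f y\<bar> \<le> C"
  shows "wirtinger (\<lambda>x. of_real (log_potential f x)) (cauchy_transform (\<lambda>y. of_real (f y)) x / 2) (cnj (cauchy_transform (\<lambda>y. of_real (f y)) x) / 2) x"
proof (rule wirtinger_from_segments)
  have [measurable]: "f \<in> borel_measurable borel" using f by auto
  let ?f = "\<lambda>y. complex_of_real (f y)"
  have F: "integrable lborel ?f" using f by simp
  have Fb: "cmod (?f y) \<le> C" for y using bd by simp
  have cc: "continuous_on UNIV (cauchy_transform ?f)" by (rule cauchy_transform_continuous[OF F Fb])
  then show "continuous_on UNIV (\<lambda>x. cauchy_transform ?f x / 2)" "continuous_on UNIV (\<lambda>x. cnj (cauchy_transform ?f x) / 2)"
    by (intro continuous_intros; simp)+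
  fix v
  let ?I = "\<lambda>s. indicator {0..1::real} s :: real"
  let ?D = "\<lambda>z::complex. v / z"
  have ni: "integrable lborel (\<lambda>y. v * (?f y / (x - y)))" for x
    by (intro integrable_mult_right cauchy_transform_integrable'[OF F Fb])
  have i: "integrable (lborel \<Otimes>\<^sub>M lborel) (\<lambda>(s, y). ?I s *\<^sub>R (?D (x + s *\<^sub>R v - y) * ?f y))"
  proof (rule segment_integrable)
    fix x
    show "integrable lborel (\<lambda>y. v / (x - y) * ?f y)" using ni[of x] by simp
    have "(\<integral>y. norm (v / (x - y) * ?f y) \<partial>lborel) = (\<integral>y. cmod v * (norm (f y) / cmod (x - y)) \<partial>lborel)"
      by (simp add: norm_mult norm_divide)
    also have "\<dots> \<le> cmod v * (C * inv_norm_mass + (\<integral>y. norm (f y) \<partial>lborel))"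
      unfolding integral_mult_right_zero using cauchy_transform_integrable(2)[OF f, of C x] bd by (intro mult_left_mono) auto
    finally show "(\<integral>y. norm (v / (x - y) * ?f y) \<partial>lborel) \<le> cmod v * (C * inv_norm_mass + (\<integral>y. norm (f y) \<partial>lborel))" .
  qed measurable
  have ae: "AE y in lborel. f y * (ln (cmod (x + v - y)) - ln (cmod (x - y))) = Re (\<integral>s. ?I s *\<^sub>R (?D (x + s *\<^sub>R v - y) * ?f y) \<partial>lborel)"
  proof (cases "v = 0")
    case False
    \<comment> \<open>The line through x in the direction v, written with its normal
      \<open>\<i> * v\<close>.\<close>
    have "negligible {y. (\<i> * v) \<bullet> y = (\<i> * v) \<bullet> x}" by (rule negligible_hyperplane) (use False in auto)
    from negligible_AE_lborel[OF this] show ?thesis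
    proof eventually_elim
      fix y assume y: "y \<notin> {y. (\<i> * v) \<bullet> y = (\<i> * v) \<bullet> x}"
      have nz: "(x - y) + s *\<^sub>R v \<noteq> 0" for s
      proof
        assume "(x - y) + s *\<^sub>R v = 0"
        then have "y = x + s *\<^sub>R v" by (simp add: algebra_simps)
        then show False using y by (simp add: inner_add_right inner_complex_def algebra_simps)
      qed
      have "(\<integral>s. ?I s *\<^sub>R (?D (x + s *\<^sub>R v - y) * ?f y) \<partial>lborel) = (\<integral>s. ?f y * (?I s *\<^sub>R (v / (x - y + s *\<^sub>R v))) \<partial>lborel)"
        by (intro Bochner_Integration.integral_cong refl) (simp add: algebra_simps)
      also have "\<dots> = ?f y * (\<integral>s. ?I s *\<^sub>R (v / (x - y + s *\<^sub>R v)) \<partial>lborel)" by (rule integral_mult_right_zero)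
      finally show "f y * (ln (cmod (x + v - y)) - ln (cmod (x - y))) = Re (\<integral>s. ?I s *\<^sub>R (?D (x + s *\<^sub>R v - y) * ?f y) \<partial>lborel)"
        using segment_ln(1)[of "x - y" v] nz by (simp add: algebra_simps)
    qed
  qed simp
  have i1: "integrable lborel (\<lambda>y. \<integral>s. ?I s *\<^sub>R (?D (x + s *\<^sub>R v - y) * ?f y) \<partial>lborel)"
    using lborel_pair.integrable_snd[OF i] by simp
  have "log_potential f (x + v) - log_potential f x = (\<integral>y. f y * (ln (cmod (x + v - y)) - ln (cmod (x - y))) \<partial>lborel)"
    unfolding log_potential_def using log_potential_integrable[OF f bd]
    by (subst Bochner_Integration.integral_diff[symmetric]) (auto simp: algebra_simps)
  also have "\<dots> = (\<integral>y. Re (\<integral>s. ?I s *\<^sub>R (?D (x + s *\<^sub>R v - y) * ?f y) \<partial>lborel) \<partial>lborel)"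
    by (rule integral_cong_AE) (use ae i1 in auto)
  also have "\<dots> = Re (\<integral>y. (\<integral>s. ?I s *\<^sub>R (?D (x + s *\<^sub>R v - y) * ?f y) \<partial>lborel) \<partial>lborel)"
    using i1 by simp
  also have "(\<integral>y. (\<integral>s. ?I s *\<^sub>R (?D (x + s *\<^sub>R v - y) * ?f y) \<partial>lborel) \<partial>lborel) = (\<integral>s. (\<integral>y. ?I s *\<^sub>R (?D (x + s *\<^sub>R v - y) * ?f y) \<partial>lborel) \<partial>lborel)"
    using lborel_pair.Fubini_integral[OF i] by simp
  also have "\<dots> = (\<integral>s. ?I s *\<^sub>R (v * cauchy_transform ?f (x + s *\<^sub>R v)) \<partial>lborel)"
    unfolding cauchy_transform_def integral_mult_right_zero[symmetric] by (simp add: algebra_simps)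
  finally have eq: "log_potential f (x + v) - log_potential f x = Re (\<integral>s. ?I s *\<^sub>R (v * cauchy_transform ?f (x + s *\<^sub>R v)) \<partial>lborel)" .
  have "continuous_on {0..1} (\<lambda>s::real. v * cauchy_transform ?f (x + s *\<^sub>R v))"
    by (intro continuous_intros continuous_on_compose2[OF cc]) auto
  then have i2: "integrable lborel (\<lambda>s. ?I s *\<^sub>R (v * cauchy_transform ?f (x + s *\<^sub>R v)))"
    using borel_integrable_atLeastAtMost' unfolding set_integrable_def by blast
  have "complex_of_real (log_potential f (x + v) - log_potential f x) = of_real (\<integral>s. Re (?I s *\<^sub>R (v * cauchy_transform ?f (x + s *\<^sub>R v))) \<partial>lborel)"
    unfolding eq integral_Re[OF i2] ..
  also have "\<dots> = (\<integral>s. of_real (Re (?I s *\<^sub>R (v * cauchy_transform ?f (x + s *\<^sub>R v)))) \<partial>lborel)"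
    by (rule integral_complex_of_real[symmetric])
  also have "\<dots> = (\<integral>s. ?I s *\<^sub>R (v * (cauchy_transform ?f (x + s *\<^sub>R v) / 2) + cnj v * (cnj (cauchy_transform ?f (x + s *\<^sub>R v)) / 2)) \<partial>lborel)"
    by (intro Bochner_Integration.integral_cong refl) (auto simp: complex_eq_iff add_divide_distrib diff_divide_distrib)
  finally show "complex_of_real (log_potential f (x + v)) - of_real (log_potential f x) = (\<integral>s. ?I s *\<^sub>R (v * (cauchy_transform ?f (x + s *\<^sub>R v) / 2) + cnj v * (cnj (cauchy_transform ?f (x + s *\<^sub>R v)) / 2)) \<partial>lborel)"
    by simp
qed

section \<open>Smooth cut-off functions\<close>

lemma Ck_Suc_D: "Ck (Suc k) f \<Longrightarrow> Ck k f"
proof (induction k arbitrary: f)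
  case 0
  then show ?case
    by (auto intro!: differentiable_imp_continuous_on simp: differentiable_on_def)
next
  case (Suc k)
  then show ?case by (subst Ck.simps(2), subst (asm) (2) Ck.simps(2)) auto
qed

lemma Ck_SucI:
  assumes "\<And>x. (f has_derivative D x) (at x)" "\<And>v. Ck k (\<lambda>x. D x v)"
  shows "Ck (Suc k) f"
proof -
  have "frechet_derivative f (at x) = D x" for x using frechet_derivative_at[OF assms(1)] by simp
  then show ?thesis using assms by (auto intro: differentiableI)
qed

lemma Ck_SucE:
  assumes "Ck (Suc k) f"
  obtains "\<And>x. (f has_derivative frechet_derivative f (at x)) (at x)" "\<And>v. Ck k (\<lambda>x. frechet_derivative f (at x) v)"
  using assms by (auto simp: frechet_derivative_works)

lemma Ck_const: "Ck k (\<lambda>x. c)"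
proof (induction k arbitrary: c)
  case (Suc k) show ?case by (rule Ck_SucI[where D="\<lambda>x v. 0"]) (auto intro: Suc)
qed simp

lemma Ck_add: "Ck k f \<Longrightarrow> Ck k g \<Longrightarrow> Ck k (\<lambda>x. f x + g x)"
proof (induction k arbitrary: f g)
  case (Suc k)
  from Suc(2) obtain f: "\<And>x. (f has_derivative frechet_derivative f (at x)) (at x)" "\<And>v. Ck k (\<lambda>x. frechet_derivative f (at x) v)" using Ck_SucE by blast
  from Suc(3) obtain g: "\<And>x. (g has_derivative frechet_derivative g (at x)) (at x)" "\<And>v. Ck k (\<lambda>x. frechet_derivative g (at x) v)" using Ck_SucE by blast
  show ?case by (rule Ck_SucI[OF has_derivative_add[OF f(1) g(1)]]) (intro Suc.IH f g)
qed (auto intro: continuous_intros)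

lemma Ck_mult: "Ck k f \<Longrightarrow> Ck k g \<Longrightarrow> Ck k (\<lambda>x. f x * g x)"
proof (induction k arbitrary: f g)
  case (Suc k)
  from Suc(2) obtain f: "\<And>x. (f has_derivative frechet_derivative f (at x)) (at x)" "\<And>v. Ck k (\<lambda>x. frechet_derivative f (at x) v)" using Ck_SucE by blast
  from Suc(3) obtain g: "\<And>x. (g has_derivative frechet_derivative g (at x)) (at x)" "\<And>v. Ck k (\<lambda>x. frechet_derivative g (at x) v)" using Ck_SucE by blast
  show ?case
    by (rule Ck_SucI[OF has_derivative_mult[OF f(1) g(1)]]) (intro Ck_add Suc.IH f g Ck_Suc_D[OF Suc(2)] Ck_Suc_D[OF Suc(3)])
qed (auto intro: continuous_intros)

lemma Ck_inverse:
  assumes nz: "\<And>x. f x \<noteq> 0"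
  shows "Ck k f \<Longrightarrow> Ck k (\<lambda>x. inverse (f x))"
proof (induction k)
  case (Suc k)
  then obtain f: "\<And>x. (f has_derivative frechet_derivative f (at x)) (at x)" "\<And>v. Ck k (\<lambda>x. frechet_derivative f (at x) v)" using Ck_SucE by blast
  have i: "Ck k (\<lambda>x. inverse (f x))" using Suc Ck_Suc_D by blast
  show ?case
  proof (rule Ck_SucI[where D="\<lambda>x v. (- 1) * (inverse (f x) * frechet_derivative f (at x) v * inverse (f x))"])
    show "((\<lambda>x. inverse (f x)) has_derivative (\<lambda>v. (- 1) * (inverse (f x) * frechet_derivative f (at x) v * inverse (f x)))) (at x)" for x
      using Deriv.has_derivative_inverse[OF nz f(1)] by simp
  qed (intro Ck_mult Ck_const i f)
qed (use nz in \<open>auto intro!: continuous_intros\<close>)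

lemma Ck_inner: "Ck k (\<lambda>x. (x - a) \<bullet> v)"
proof (cases k)
  case (Suc k)
  have "((\<lambda>x. (x - a) \<bullet> v) has_derivative (\<lambda>h. h \<bullet> v)) (at x)" for x
    by (auto intro!: derivative_eq_intros)
  from Ck_SucI[OF this Ck_const] show ?thesis using Suc by simp
qed (auto intro!: continuous_intros)

lemma has_derivative_norm_square:
  "((\<lambda>x. (norm (x - a))\<^sup>2) has_derivative (\<lambda>h. 2 * ((x - a) \<bullet> h))) (at x)" for a :: "'a::real_inner"
  unfolding power2_norm_eq_inner by (auto intro!: derivative_eq_intros simp: inner_commute)

lemma Ck_norm_square: "Ck k (\<lambda>x. (norm (x - a))\<^sup>2)"
proof (cases k)
  case (Suc k)
  show ?thesis unfolding Suc
    by (rule Ck_SucI[OF has_derivative_norm_square]) (intro Ck_mult Ck_const Ck_inner)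
qed (auto intro!: continuous_intros)

text \<open>Dividing by \<open>t ^ m\<close> closes the family under differentiation: the derivative
  of a member is a combination of the members with indices m + 2 and m + 1. Smoothness is then an
  induction over the order, for all m at once.\<close>

definition flat :: "nat \<Rightarrow> real \<Rightarrow> real"
  where "flat m t = (if t > 0 then exp (- 1 / t) / t ^ m else 0)"

lemma power_le_exp: "0 \<le> s \<Longrightarrow> s ^ m \<le> fact m * exp (s::real)"
proof -
  assume s: "0 \<le> s"
  have "(\<Sum>n\<in>{m}. s ^ n /\<^sub>R fact n) \<le> (\<Sum>n. s ^ n /\<^sub>R fact n)"
    by (rule sum_le_suminf[OF summable_exp_generic]) (use s in auto)
  then show ?thesis by (simp add: exp_def field_simps)
qed

lemma flat_nonneg: "0 \<le> flat m t" and flat_pos: "t > 0 \<Longrightarrow> 0 < flat m t" by (auto simp: flat_def)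

text \<open>One term of the exponential series, of order m + 2, beats \<open>1 / t ^ m\<close> and
  leaves a factor \<open>t^2\<close>; this gives the derivative 0 at the origin.\<close>

lemma flat_le: "\<bar>flat m t\<bar> \<le> fact (m + 2) * t\<^sup>2"
proof (cases "t > 0")
  case True
  have "(1/t) ^ (m + 2) \<le> fact (m + 2) * exp (1/t)" using True by (intro power_le_exp) auto
  then have "1 / t ^ (m + 2) * exp (-1/t) \<le> fact (m + 2) * exp (1/t) * exp (-1/t)"
    by (intro mult_right_mono) (auto simp: power_divide)
  moreover have "exp (1/t) * exp (-1/t) = 1" by (simp flip: exp_add)
  ultimately have "1 / t ^ (m + 2) * exp (-1/t) \<le> fact (m + 2)" by (simp only: mult.assoc mult_1_right)
  then have "1 / t ^ (m + 2) * exp (-1/t) * t\<^sup>2 \<le> fact (m + 2) * t\<^sup>2" by (rule mult_right_mono) simp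
  moreover have "1 / t ^ (m + 2) * exp (-1/t) * t\<^sup>2 = \<bar>flat m t\<bar>"
    using True by (simp add: flat_def power_add power2_eq_square)
  ultimately show ?thesis by simp
qed (simp add: flat_def)

lemma DERIV_flat: "(flat m has_real_derivative (flat (m + 2) t - real m * flat (m + 1) t)) (at t)"
proof -
  consider "t > 0" | "t < 0" | "t = 0" by linarith
  then show ?thesis
  proof cases
    case 1
    have "((\<lambda>t. exp (- 1 / t) / t ^ m) has_real_derivative (flat (m + 2) t - real m * flat (m + 1) t)) (at t)"
    proof -
      have "((\<lambda>t. exp (- 1 / t) / t ^ m) has_real_derivative ((exp (-1/t) * (1 / t\<^sup>2)) * t ^ m - exp (-1/t) * (real m * t ^ (m - 1))) / (t ^ m)\<^sup>2) (at t)"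
        using 1 by (auto intro!: derivative_eq_intros simp: power2_eq_square)
      moreover have "((exp (-1/t) * (1 / t\<^sup>2)) * t ^ m - exp (-1/t) * (real m * t ^ (m - 1))) / (t ^ m)\<^sup>2 = flat (m + 2) t - real m * flat (m + 1) t"
        using 1 by (cases m) (auto simp: flat_def field_simps power2_eq_square)
      ultimately show ?thesis by simp
    qed
    then show ?thesis
      by (rule has_field_derivative_transform_within_open[where S="{0<..}"]) (use 1 in \<open>auto simp: flat_def\<close>)
  next
    case 2
    have "((\<lambda>t. 0) has_real_derivative (flat (m + 2) t - real m * flat (m + 1) t)) (at t)"
      using 2 by (simp add: flat_def)
    then show ?thesis
      by (rule has_field_derivative_transform_within_open[where S="{..<0}"]) (use 2 in \<open>auto simp: flat_def\<close>)
  next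
    case 3
    have "((\<lambda>h. flat m h / h) \<longlongrightarrow> 0) (at 0)"
    proof (rule Lim_null_comparison)
      show "\<forall>\<^sub>F h in at 0. norm (flat m h / h) \<le> fact (m + 2) * \<bar>h\<bar>"
      proof (intro always_eventually allI)
        fix h :: real
        have "norm (flat m h / h) \<le> fact (m + 2) * h\<^sup>2 / \<bar>h\<bar>"
          unfolding real_norm_def abs_divide by (intro divide_right_mono flat_le) simp
        also have "h\<^sup>2 = \<bar>h\<bar> * \<bar>h\<bar>" by (simp add: power2_eq_square)
        also have "c * (a * a) / a = c * a" for a c :: real by simp
        finally show "norm (flat m h / h) \<le> fact (m + 2) * \<bar>h\<bar>" .
      qed
      show "((\<lambda>h::real. fact (m + 2) * \<bar>h\<bar>) \<longlongrightarrow> 0) (at 0)" by (auto intro!: tendsto_eq_intros)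
    qed
    then show ?thesis using 3 by (simp add: DERIV_def flat_def)
  qed
qed

text \<open>The inner function is fixed to be a quadratic polynomial in the norm, whose derivatives
  are explicit; this takes the place of a chain rule for \<open>Ck\<close>.\<close>

lemma Ck_flat:
  fixes x0 :: "'a::euclidean_space"
  shows "Ck k (\<lambda>x. flat m (a + b * (norm (x - x0))\<^sup>2))"
proof (induction k arbitrary: m)
  case 0
  have "continuous_on UNIV (flat m)"
    using DERIV_flat by (meson DERIV_isCont continuous_at_imp_continuous_on)
  then show ?case by (auto intro!: continuous_intros continuous_on_compose2[of UNIV "flat m"])
next
  case (Suc k)
  let ?q = "\<lambda>x. a + b * (norm (x - x0))\<^sup>2"
  show ?case
  proof (rule Ck_SucI[where D="\<lambda>x v. (flat (m + 2) (?q x) + (- real m) * flat (m + 1) (?q x)) * (b * (2 * ((x - x0) \<bullet> v)))"])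
    fix x
    have q: "(?q has_derivative (\<lambda>v. b * (2 * ((x - x0) \<bullet> v)))) (at x)"
      using has_derivative_add[OF has_derivative_const has_derivative_mult_right[OF has_derivative_norm_square]] by simp
    show "((\<lambda>x. flat m (?q x)) has_derivative (\<lambda>v. (flat (m + 2) (?q x) + (- real m) * flat (m + 1) (?q x)) * (b * (2 * ((x - x0) \<bullet> v))))) (at x)"
      using has_derivative_compose[OF q DERIV_flat[unfolded has_field_derivative_def]] by simp
  qed (intro Ck_mult Ck_add Ck_const Suc.IH Ck_inner)
qed

text \<open>The quotient f/(f + g), where f is positive exactly for
  \<open>norm (x - x0) < 2 r\<close> and g exactly for \<open>norm (x - x0) > r\<close>. For r > 0
  one of them is always positive. The factors \<open>(-1)\<close> and \<open>1\<close> match the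
  form of \<open>Ck_flat\<close>.\<close>

definition cutoff :: "'a::euclidean_space \<Rightarrow> real \<Rightarrow> 'a \<Rightarrow> real"
  where "cutoff x0 r x = flat 0 (4 * r\<^sup>2 + (-1) * (norm (x - x0))\<^sup>2) *
    inverse (flat 0 (4 * r\<^sup>2 + (-1) * (norm (x - x0))\<^sup>2) + flat 0 (- r\<^sup>2 + 1 * (norm (x - x0))\<^sup>2))"

lemma cutoff_den_pos:
  assumes "r > 0"
  shows "flat 0 (4 * r\<^sup>2 + (-1) * (norm (x - x0))\<^sup>2) + flat 0 (- r\<^sup>2 + 1 * (norm (x - x0))\<^sup>2) > 0"
proof (cases "(norm (x - x0))\<^sup>2 < 4 * r\<^sup>2")
  case True then show ?thesis by (intro add_pos_nonneg[OF flat_pos flat_nonneg]) simp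
next
  case False
  moreover have "r\<^sup>2 < 4 * r\<^sup>2" using assms by simp
  ultimately show ?thesis by (intro add_nonneg_pos[OF flat_nonneg flat_pos]) linarith
qed

lemma Ck_cutoff: "r > 0 \<Longrightarrow> Ck k (cutoff x0 r)"
  unfolding cutoff_def[abs_def]
  by (intro Ck_mult Ck_inverse Ck_add Ck_flat) (use cutoff_den_pos less_irrefl in metis)

lemma cutoff_bounds:
  assumes r: "r > 0"
  shows "0 \<le> cutoff x0 r x" "cutoff x0 r x \<le> 1" "norm (x - x0) \<le> r \<Longrightarrow> cutoff x0 r x = 1" "2 * r \<le> norm (x - x0) \<Longrightarrow> cutoff x0 r x = 0"
proof -
  let ?a = "flat 0 (4 * r\<^sup>2 + (-1) * (norm (x - x0))\<^sup>2)" and ?b = "flat 0 (- r\<^sup>2 + 1 * (norm (x - x0))\<^sup>2)"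
  have eq: "cutoff x0 r x = ?a / (?a + ?b)" by (simp add: cutoff_def divide_inverse)
  have p: "?a + ?b > 0" "0 \<le> ?a" "0 \<le> ?b" using cutoff_den_pos[OF r, of x x0] flat_nonneg by auto
  show "0 \<le> cutoff x0 r x" "cutoff x0 r x \<le> 1" unfolding eq using p by (auto simp: divide_simps)
  show "cutoff x0 r x = 1" if "norm (x - x0) \<le> r"
  proof -
    have "(norm (x - x0))\<^sup>2 \<le> r\<^sup>2" using that by (intro power_mono) auto
    then have "?b = 0" by (simp add: flat_def)
    then show ?thesis unfolding eq using p by simp
  qed
  show "cutoff x0 r x = 0" if "2 * r \<le> norm (x - x0)"
  proof -
    have "(2 * r)\<^sup>2 \<le> (norm (x - x0))\<^sup>2" using that r by (intro power_mono) auto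
    then have "?a = 0" by (simp add: flat_def power_mult_distrib)
    then show ?thesis unfolding eq by simp
  qed
qed

section \<open>The regularised logarithm and its localisation as a test function\<close>

definition reg_log :: "real \<Rightarrow> complex \<Rightarrow> complex \<Rightarrow> real"
  where "reg_log e x z = (1/2) * ln ((cmod (z - x))\<^sup>2 + e\<^sup>2)"

lemma reg_pos: "e > 0 \<Longrightarrow> 0 < (cmod z)\<^sup>2 + (e::real)\<^sup>2" by (intro add_nonneg_pos) auto

lemma reg_log_has_derivative:
  assumes "e > 0"
  shows "(reg_log e x has_derivative (\<lambda>v. ((z - x) \<bullet> v) * inverse ((cmod (z - x))\<^sup>2 + e\<^sup>2))) (at z)"
proof -
  have q: "((\<lambda>z. (cmod (z - x))\<^sup>2 + e\<^sup>2) has_derivative (\<lambda>v. 2 * ((z - x) \<bullet> v))) (at z)"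
    using has_derivative_add[OF has_derivative_norm_square has_derivative_const] by simp
  have "((\<lambda>z. (1/2) * ln ((cmod (z - x))\<^sup>2 + e\<^sup>2)) has_derivative (\<lambda>v. (1/2) * (inverse ((cmod (z - x))\<^sup>2 + e\<^sup>2) * (2 * ((z - x) \<bullet> v))))) (at z)"
    using has_derivative_compose[OF q DERIV_ln[OF reg_pos[OF assms], unfolded has_field_derivative_def]]
    by (rule has_derivative_mult_right)
  then show ?thesis unfolding reg_log_def by (simp add: mult.commute)
qed

lemma Ck_reg_inverse: "e > 0 \<Longrightarrow> Ck k (\<lambda>z. inverse ((cmod (z - x))\<^sup>2 + e\<^sup>2))"
  by (intro Ck_inverse Ck_add Ck_norm_square Ck_const) (use reg_pos less_irrefl in metis)

lemma Ck_reg_log: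
  assumes "e > 0" shows "Ck k (reg_log e x)"
proof -
  have "Ck (Suc k) (reg_log e x)"
    by (rule Ck_SucI[OF reg_log_has_derivative[OF assms]]) (intro Ck_mult Ck_inner Ck_reg_inverse assms)
  then show ?thesis by (rule Ck_Suc_D)
qed

lemma laplacian_reg_log:
  assumes "e > 0" shows "laplacian (reg_log e x) z = kern e (z - x)"
proof -
  define R where "R = (cmod (z - x))\<^sup>2 + e\<^sup>2"
  have R: "R > 0" using reg_pos[OF assms] by (simp add: R_def)
  have 1: "(\<lambda>y. frechet_derivative (reg_log e x) (at y) b) = (\<lambda>y. ((y - x) \<bullet> b) * inverse ((cmod (y - x))\<^sup>2 + e\<^sup>2))" for b
    using frechet_derivative_at[OF reg_log_has_derivative[OF assms]] by metis
  have 2: "frechet_derivative (\<lambda>y. ((y - x) \<bullet> b) * inverse ((cmod (y - x))\<^sup>2 + e\<^sup>2)) (at z) b = (b \<bullet> b) / R - 2 * ((z - x) \<bullet> b)\<^sup>2 / R\<^sup>2" for b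
  proof -
    have l: "((\<lambda>y. (y - x) \<bullet> b) has_derivative (\<lambda>h. h \<bullet> b)) (at z)" by (auto intro!: derivative_eq_intros)
    have q: "((\<lambda>z. (cmod (z - x))\<^sup>2 + e\<^sup>2) has_derivative (\<lambda>v. 2 * ((z - x) \<bullet> v))) (at z)"
      using has_derivative_add[OF has_derivative_norm_square has_derivative_const] by simp
    have nz: "(cmod (z - x))\<^sup>2 + e\<^sup>2 \<noteq> 0" by (rule less_imp_neq[OF reg_pos[OF assms], THEN not_sym])
    from has_derivative_mult[OF l Deriv.has_derivative_inverse[OF nz q]]
    have "((\<lambda>y. ((y - x) \<bullet> b) * inverse ((cmod (y - x))\<^sup>2 + e\<^sup>2)) has_derivative
       (\<lambda>h. ((z - x) \<bullet> b) * - (inverse R * (2 * ((z - x) \<bullet> h)) * inverse R) + (h \<bullet> b) * inverse R)) (at z)"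
      by (simp add: R_def)
    from fun_cong[OF frechet_derivative_at[OF this], of b] show ?thesis
      using R by (simp add: field_simps power2_eq_square)
  qed
  have "laplacian (reg_log e x) z = (\<Sum>b\<in>{1, \<i>}. (b \<bullet> b) / R - 2 * ((z - x) \<bullet> b)\<^sup>2 / R\<^sup>2)"
    unfolding laplacian_def 1 2 Basis_complex_def ..
  also have "\<dots> = 2 / R - 2 * ((Re (z - x))\<^sup>2 + (Im (z - x))\<^sup>2) / R\<^sup>2" by (simp add: inner_complex_def add_divide_distrib distrib_left)
  also have "\<dots> = (2 * R - 2 * (cmod (z - x))\<^sup>2) / R\<^sup>2" unfolding cmod_power2[symmetric] using R by (simp add: field_simps power2_eq_square)
  also have "\<dots> = kern e (z - x)" by (simp add: R_def kern_def)
  finally show ?thesis .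
qed

lemma laplacian_mult:
  assumes f: "Ck (Suc (Suc 0)) f" and g: "Ck (Suc (Suc 0)) g"
  shows "laplacian (\<lambda>x. f x * g x) x = laplacian f x * g x + 2 * (\<Sum>b\<in>Basis. frechet_derivative f (at x) b * frechet_derivative g (at x) b) + f x * laplacian g x"
proof -
  from f have f1: "\<And>x. (f has_derivative frechet_derivative f (at x)) (at x)" and f2: "\<And>v. Ck (Suc 0) (\<lambda>x. frechet_derivative f (at x) v)" using Ck_SucE by blast+
  from g have g1: "\<And>x. (g has_derivative frechet_derivative g (at x)) (at x)" and g2: "\<And>v. Ck (Suc 0) (\<lambda>x. frechet_derivative g (at x) v)" using Ck_SucE by blast+
  note f3 = Ck_SucE[OF f2] note g3 = Ck_SucE[OF g2]
  have 1: "(\<lambda>y. frechet_derivative (\<lambda>x. f x * g x) (at y) b) = (\<lambda>y. f y * frechet_derivative g (at y) b + frechet_derivative f (at y) b * g y)" for b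
    using frechet_derivative_at[OF has_derivative_mult[OF f1 g1]] by metis
  have 2: "frechet_derivative (\<lambda>y. f y * frechet_derivative g (at y) b + frechet_derivative f (at y) b * g y) (at x) b =
     f x * frechet_derivative (\<lambda>y. frechet_derivative g (at y) b) (at x) b + frechet_derivative f (at x) b * frechet_derivative g (at x) b
     + (frechet_derivative f (at x) b * frechet_derivative g (at x) b + frechet_derivative (\<lambda>y. frechet_derivative f (at y) b) (at x) b * g x)" for b
  proof -
    have fb: "((\<lambda>y. frechet_derivative f (at y) b) has_derivative frechet_derivative (\<lambda>y. frechet_derivative f (at y) b) (at x)) (at x)" using f3[of b] by metis
    have gb: "((\<lambda>y. frechet_derivative g (at y) b) has_derivative frechet_derivative (\<lambda>y. frechet_derivative g (at y) b) (at x)) (at x)" using g3[of b] by metis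
    show ?thesis
      using fun_cong[OF frechet_derivative_at[OF has_derivative_add[OF has_derivative_mult[OF f1 gb] has_derivative_mult[OF fb g1]]], of b] by simp
  qed
  have "laplacian (\<lambda>x. f x * g x) x = (\<Sum>b\<in>Basis. frechet_derivative (\<lambda>y. frechet_derivative f (at y) b) (at x) b * g x
      + 2 * (frechet_derivative f (at x) b * frechet_derivative g (at x) b) + f x * frechet_derivative (\<lambda>y. frechet_derivative g (at y) b) (at x) b)"
    unfolding laplacian_def[of "\<lambda>x. f x * g x"] 1 2 by (rule sum.cong[OF refl]) linarith
  then show ?thesis by (simp only: sum.distrib sum_distrib_left sum_distrib_right laplacian_def)
qed

lemma frechet_derivative_locally_const:
  assumes "open S" "x \<in> S" "\<And>y. y \<in> S \<Longrightarrow> f y = c"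
  shows "frechet_derivative f (at x) v = 0"
proof -
  have "((\<lambda>y. c) has_derivative (\<lambda>h. 0)) (at x)" by simp
  then have "(f has_derivative (\<lambda>h. 0)) (at x)"
    by (rule has_derivative_transform_within_open[OF _ assms(1,2)]) (use assms(3) in auto)
  then show ?thesis using frechet_derivative_at by metis
qed

lemma laplacian_locally_const:
  assumes "open S" "x \<in> S" "\<And>y. y \<in> S \<Longrightarrow> f y = c"
  shows "laplacian f x = 0"
proof -
  have "frechet_derivative (\<lambda>y. frechet_derivative f (at y) b) (at x) b = 0" for b
    by (rule frechet_derivative_locally_const[OF assms(1,2)])
       (rule frechet_derivative_locally_const[OF assms(1) _ assms(3)])
  then show ?thesis by (simp add: laplacian_def)
qed

definition grad :: "(complex \<Rightarrow> real) \<Rightarrow> complex \<Rightarrow> complex"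
  where "grad f x = Complex (frechet_derivative f (at x) 1) (frechet_derivative f (at x) \<i>)"

text \<open>Derivatives of the cut-off live on the closed annulus between the radii r and 2r. The
  terms they produce therefore keep a distance from the centre and are harmonic near it.\<close>

lemma cutoff_locally_const:
  fixes x0 :: complex
  assumes r: "r > 0" and x: "cmod (x - x0) < r \<or> 2 * r < cmod (x - x0)"
  shows "grad (cutoff x0 r) x = 0" "laplacian (cutoff x0 r) x = 0"
proof -
  have o: "open (ball x0 r)" "open (- cball x0 (2 * r))" by auto
  consider "x \<in> ball x0 r" | "x \<in> - cball x0 (2 * r)" using x by (auto simp: dist_norm norm_minus_commute)
  then have "grad (cutoff x0 r) x = 0 \<and> laplacian (cutoff x0 r) x = 0"
  proof cases
    case 1
    have 3: "cutoff x0 r y = 1" if "y \<in> ball x0 r" for y using that by (intro cutoff_bounds(3)[OF r]) (simp add: dist_norm norm_minus_commute)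
    then show ?thesis
      using frechet_derivative_locally_const[OF o(1) 1 3] laplacian_locally_const[OF o(1) 1 3] by (auto simp: grad_def complex_eq_iff)
  next
    case 2
    have 3: "cutoff x0 r y = 0" if "y \<in> - cball x0 (2 * r)" for y using that by (intro cutoff_bounds(4)[OF r]) (simp add: dist_norm norm_minus_commute)
    then show ?thesis
      using frechet_derivative_locally_const[OF o(2) 2 3] laplacian_locally_const[OF o(2) 2 3] by (auto simp: grad_def complex_eq_iff)
  qed
  then show "grad (cutoff x0 r) x = 0" "laplacian (cutoff x0 r) x = 0" by auto
qed

lemma cutoff_continuous:
  assumes r: "r > 0"
  shows "continuous_on S (cutoff x0 r)" "continuous_on S (grad (cutoff x0 r))" "continuous_on S (laplacian (cutoff x0 r))"
proof -
  have c: "Ck k (cutoff x0 r)" for k :: nat and x0 :: complex using Ck_cutoff[OF r] .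
  have "continuous_on UNIV (cutoff x0 r)" using c[of 0 x0] by simp
  then show "continuous_on S (cutoff x0 r)" using continuous_on_subset by blast
  have 1: "\<And>v. Ck (Suc 0) (\<lambda>x. frechet_derivative (cutoff x0 r) (at x) v)" using Ck_SucE[OF c[of "Suc (Suc 0)" x0]] by blast
  have "continuous_on UNIV (\<lambda>x. frechet_derivative (cutoff x0 r) (at x) v)" for v using Ck_Suc_D[OF 1, of v] by simp
  then have "continuous_on UNIV (grad (cutoff x0 r))" unfolding grad_def Complex_eq by (intro continuous_intros)
  then show "continuous_on S (grad (cutoff x0 r))" using continuous_on_subset by blast
  have "continuous_on UNIV (\<lambda>x. frechet_derivative (\<lambda>x. frechet_derivative (cutoff x0 r) (at x) v) (at x) w)" for v w
    using Ck_SucE[OF 1[of v]] by (metis Ck.simps(1))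
  then have "continuous_on UNIV (laplacian (cutoff x0 r))" unfolding laplacian_def by (intro continuous_intros)
  then show "continuous_on S (laplacian (cutoff x0 r))" using continuous_on_subset by blast
qed

text \<open>In the Leibniz formula the last term is an approximate identity at x, which recovers the
  solution there; the other two are supported on the annulus.\<close>

lemma cutoff_reg_log:
  assumes r: "r > 0" and e: "e > 0"
  shows "test_function (\<lambda>z. cutoff x0 r z * reg_log e x z)"
    "laplacian (\<lambda>z. cutoff x0 r z * reg_log e x z) z =
      laplacian (cutoff x0 r) z * reg_log e x z + 2 * ((grad (cutoff x0 r) z \<bullet> (z - x)) / ((cmod (z - x))\<^sup>2 + e\<^sup>2)) + cutoff x0 r z * kern e (z - x)"
proof -
  have "support_on UNIV (\<lambda>z. cutoff x0 r z * reg_log e x z) \<subseteq> cball x0 (2 * r)"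
  proof
    fix z assume "z \<in> support_on UNIV (\<lambda>z. cutoff x0 r z * reg_log e x z)"
    then have "cutoff x0 r z \<noteq> 0" by (auto simp: support_on_def)
    then have "\<not> 2 * r \<le> cmod (z - x0)" using cutoff_bounds(4)[OF r] by blast
    then show "z \<in> cball x0 (2 * r)" by (simp add: dist_norm norm_minus_commute)
  qed
  then have "bounded (support_on UNIV (\<lambda>z. cutoff x0 r z * reg_log e x z))" using bounded_cball bounded_subset by blast
  then show "test_function (\<lambda>z. cutoff x0 r z * reg_log e x z)"
    unfolding test_function_def by (auto intro!: Ck_mult Ck_cutoff r Ck_reg_log e)
  have n: "frechet_derivative (reg_log e x) (at z) b = ((z - x) \<bullet> b) * inverse ((cmod (z - x))\<^sup>2 + e\<^sup>2)" for b
    using frechet_derivative_at[OF reg_log_has_derivative[OF e]] by metis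
  have s: "(\<Sum>b\<in>Basis. frechet_derivative (cutoff x0 r) (at z) b * frechet_derivative (reg_log e x) (at z) b) = (grad (cutoff x0 r) z \<bullet> (z - x)) / ((cmod (z - x))\<^sup>2 + e\<^sup>2)"
    unfolding n by (simp add: Basis_complex_def grad_def inner_complex_def divide_inverse algebra_simps)
  show "laplacian (\<lambda>z. cutoff x0 r z * reg_log e x z) z =
      laplacian (cutoff x0 r) z * reg_log e x z + 2 * ((grad (cutoff x0 r) z \<bullet> (z - x)) / ((cmod (z - x))\<^sup>2 + e\<^sup>2)) + cutoff x0 r z * kern e (z - x)"
    using laplacian_mult[OF Ck_cutoff[OF r] Ck_reg_log[OF e], of x0 x z] unfolding s laplacian_reg_log[OF e] .
qed

section \<open>Representation of weak solutions\<close>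

text \<open>Lebesgue's differentiation theorem along cubes with a corner at x: all averages vanish,
  so their limit \<open>u x\<close> does at almost every x.\<close>

lemma AE_zero_if_box_integrals_zero:
  fixes u :: "'a::euclidean_space \<Rightarrow> real"
  assumes int: "\<And>a b. integrable lborel (\<lambda>x. indicator (cbox a b) x * u x)"
    and zero: "\<And>a b. (\<integral>x. indicator (cbox a b) x * u x \<partial>lborel) = 0"
  shows "AE x in lborel. u x = 0"
proof -
  have hi: "(u has_integral 0) (cbox a b)" for a b
  proof -
    have "((\<lambda>x. indicator (cbox a b) x * u x) has_integral 0) UNIV"
      using has_integral_integral_lborel[OF int[of a b]] zero[of a b] by simp
    moreover have "(\<lambda>x. indicator (cbox a b) x * u x) = (\<lambda>x. if x \<in> cbox a b then u x else 0)"
      by (auto simp: indicator_def)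
    ultimately show ?thesis by (simp only: has_integral_restrict_UNIV)
  qed
  obtain N where N: "negligible N" "\<And>x e. \<lbrakk>x \<notin> N; 0 < e\<rbrakk> \<Longrightarrow> \<exists>d>0. \<forall>h. 0 < h \<and> h < d \<longrightarrow>
      norm (integral (cbox x (x + h *\<^sub>R One)) u /\<^sub>R h ^ DIM('a) - u x) < e"
    using integrable_ccontinuous_explicit[of u] hi by (metis has_integral_integrable)
  have "u x = 0" if x: "x \<notin> N" for x
  proof (rule ccontr)
    assume "u x \<noteq> 0"
    then obtain d where d: "d > 0" "\<And>h. 0 < h \<and> h < d \<Longrightarrow> norm (integral (cbox x (x + h *\<^sub>R One)) u /\<^sub>R h ^ DIM('a) - u x) < \<bar>u x\<bar>"
      using N(2)[OF x, of "\<bar>u x\<bar>"] by auto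
    have "norm (integral (cbox x (x + (d/2) *\<^sub>R One)) u /\<^sub>R (d/2) ^ DIM('a) - u x) < \<bar>u x\<bar>" using d by auto
    then show False using hi[of x "x + (d/2) *\<^sub>R One"] by (simp add: integral_unique)
  qed
  then show ?thesis using negligible_AE_lborel[OF N(1)] by (auto elim!: eventually_mono)
qed

lemma kern_minus_commute: "kern e (x - y) = kern e (y - x)" by (simp add: kern_def norm_minus_commute)

lemma integral_kern: "e > 0 \<Longrightarrow> (\<integral>z. kern e (z - x) \<partial>lborel) = kern_mass"
  using kern_scale[of e x "\<lambda>_. 1::real"] integrable_translate(3)[OF integrable_kern] by (simp add: kern_mass_def)

text \<open>Fubini's theorem moves the kernel from \<open>f\<close>, which is merely integrable,
  onto the indicator of the box. The indicator is bounded and continuous off the boundary, a null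
  set, so the approximate identity converges almost everywhere.\<close>

lemma kern_box_limit:
  fixes f :: "complex \<Rightarrow> real"
  assumes f: "integrable lborel f"
  shows "(\<lambda>n. \<integral>x. indicator (cbox a b) x * (\<integral>z. f z * kern (1 / real (Suc n)) (z - x) \<partial>lborel) \<partial>lborel)
    \<longlonglongrightarrow> kern_mass * (\<integral>x. indicator (cbox a b) x * f x \<partial>lborel)"
proof -
  have [measurable]: "f \<in> borel_measurable borel" using f by auto
  let ?I = "\<lambda>x. indicator (cbox a b) x :: real"
  define e where "e n = 1 / real (Suc n)" for n
  have e: "0 < e n" for n by (simp add: e_def)
  define B where "B n z = (\<integral>x. kern (e n) (x - z) *\<^sub>R ?I x \<partial>lborel)" for n z
  have ki: "integrable lborel (\<lambda>x. kern (e n) (x - z))" for n z using integrable_translate(3)[OF integrable_kern[OF e]] .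
  have ki': "integrable lborel (\<lambda>x. kern (e n) (x - z) *\<^sub>R ?I x)" for n z
    by (rule Bochner_Integration.integrable_bound[OF ki[of n z]]) (auto simp: kern_nonneg indicator_def)
  have B: "0 \<le> B n z" "B n z \<le> kern_mass" for n z
  proof -
    show "0 \<le> B n z" unfolding B_def by (intro Bochner_Integration.integral_nonneg) (auto simp: kern_nonneg)
    have "B n z \<le> (\<integral>x. kern (e n) (x - z) \<partial>lborel)" unfolding B_def
      by (rule integral_mono[OF ki' ki]) (auto simp: indicator_def kern_nonneg)
    then show "B n z \<le> kern_mass" using integral_kern[OF e] by simp
  qed
  have [measurable]: "B n \<in> borel_measurable borel" for n unfolding B_def by measurable
  have i: "integrable (lborel \<Otimes>\<^sub>M lborel) (\<lambda>(z, x). f z * (?I x * kern (e n) (z - x)))" for n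
  proof (rule lborel_pair.Fubini_integrable)
    show "(\<lambda>(z, x). f z * (?I x * kern (e n) (z - x))) \<in> borel_measurable (lborel \<Otimes>\<^sub>M lborel)" by measurable
    show "AE z in lborel. integrable lborel (\<lambda>x. case (z, x) of (z, x) \<Rightarrow> f z * (?I x * kern (e n) (z - x)))"
      using ki'[of n] by (auto simp: mult.commute kern_minus_commute[of "e n"])
    have "(\<integral>x. norm (case (z, x) of (z, x) \<Rightarrow> f z * (?I x * kern (e n) (z - x))) \<partial>lborel) = \<bar>f z\<bar> * B n z" for z
      unfolding B_def by (subst integral_mult_right_zero[symmetric]) (simp add: abs_mult kern_nonneg mult.commute kern_minus_commute[of "e n"])
    then show "integrable lborel (\<lambda>z. \<integral>x. norm (case (z, x) of (z, x) \<Rightarrow> f z * (?I x * kern (e n) (z - x))) \<partial>lborel)"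
    proof (simp only:, intro Bochner_Integration.integrable_bound[where f="\<lambda>z. kern_mass * \<bar>f z\<bar>" and g="\<lambda>z. \<bar>f z\<bar> * B n z"])
      show "AE z in lborel. norm (\<bar>f z\<bar> * B n z) \<le> norm (kern_mass * \<bar>f z\<bar>)"
        using B kern_mass_pos by (auto simp: abs_mult mult.commute intro!: mult_right_mono)
    qed (use f in auto)
  qed
  have eq: "(\<integral>x. ?I x * (\<integral>z. f z * kern (e n) (z - x) \<partial>lborel) \<partial>lborel) = (\<integral>z. f z * B n z \<partial>lborel)" for n
  proof -
    have "(\<integral>x. ?I x * (\<integral>z. f z * kern (e n) (z - x) \<partial>lborel) \<partial>lborel) = (\<integral>x. (\<integral>z. f z * (?I x * kern (e n) (z - x)) \<partial>lborel) \<partial>lborel)"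
      unfolding integral_mult_right_zero[symmetric] by (simp add: mult.left_commute)
    also have "\<dots> = (\<integral>z. (\<integral>x. f z * (?I x * kern (e n) (z - x)) \<partial>lborel) \<partial>lborel)"
      using lborel_pair.Fubini_integral[OF i[of n]] by simp
    also have "\<dots> = (\<integral>z. f z * B n z \<partial>lborel)"
      unfolding B_def integral_mult_right_zero by (simp add: mult.commute kern_minus_commute[of "e n"])
    finally show ?thesis .
  qed
  have "(\<lambda>n. \<integral>z. f z * B n z \<partial>lborel) \<longlonglongrightarrow> (\<integral>z. f z * (kern_mass * ?I z) \<partial>lborel)"
  proof (rule integral_dominated_convergence[where w="\<lambda>z. kern_mass * \<bar>f z\<bar>"])
    have "negligible (frontier (cbox a b))" by (intro negligible_convex_frontier convex_box)
    from negligible_AE_lborel[OF this] show "AE z in lborel. (\<lambda>n. f z * B n z) \<longlonglongrightarrow> f z * (kern_mass * ?I z)"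
    proof eventually_elim
      fix z assume "z \<notin> frontier (cbox a b)"
      then have "isCont ?I z" by (simp add: isCont_indicator)
      then have "(\<lambda>n. B n z) \<longlonglongrightarrow> kern_mass *\<^sub>R ?I z"
        unfolding B_def e_def by (intro kern_approx_identity[where C=1]) (auto simp: indicator_def)
      then show "(\<lambda>n. f z * B n z) \<longlonglongrightarrow> f z * (kern_mass * ?I z)" by (intro tendsto_intros) simp
    qed
    show "AE z in lborel. norm (f z * B n z) \<le> kern_mass * \<bar>f z\<bar>" for n
      using B[of n] by (auto simp: abs_mult mult.commute intro!: mult_right_mono)
  qed (use f in auto)
  moreover have "(\<integral>z. f z * (kern_mass * ?I z) \<partial>lborel) = kern_mass * (\<integral>x. ?I x * f x \<partial>lborel)"
    by (subst integral_mult_right_zero[symmetric]) (simp add: mult.commute mult.left_commute)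
  ultimately show ?thesis unfolding eq[unfolded e_def] e_def by simp
qed

text \<open>One majorant for every singular kernel in the representation: the logarithm, its
  regularisations for 0 < e \<le> 1, and the gradient kernel \<open>1 / cmod y\<close>.\<close>

definition log_kernel_bound :: "complex \<Rightarrow> real" where "log_kernel_bound y = 1 / cmod y + cmod y"

lemma log_kernel_bound_measurable[measurable]: "log_kernel_bound \<in> borel_measurable borel" unfolding log_kernel_bound_def by measurable
lemma log_kernel_bound_nonneg: "0 \<le> log_kernel_bound y" by (simp add: log_kernel_bound_def)

lemma reg_log_bound:
  assumes "0 < e" "e \<le> 1" "z \<noteq> x" shows "\<bar>reg_log e x z\<bar> \<le> log_kernel_bound (z - x)"
proof -
  define t where "t = cmod (z - x)"
  have t: "t > 0" using assms by (simp add: t_def)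
  have n: "reg_log e x z = (1/2) * ln (t\<^sup>2 + e\<^sup>2)" by (simp add: reg_log_def t_def)
  have e: "0 < e\<^sup>2" "e\<^sup>2 \<le> 1" using assms by (auto simp: power_le_one)
  have "ln (t\<^sup>2) \<le> ln (t\<^sup>2 + e\<^sup>2)" using t e by (subst ln_le_cancel_iff) (auto intro: add_pos_pos)
  then have 1: "ln t \<le> reg_log e x z" using t by (simp add: n ln_realpow)
  have "1 - 1 / t \<le> ln t" using ln_ge_iff[of "1/t"] ln_le_minus_one[of "1/t"] t by (simp add: ln_div)
  then have 2: "- (1 / t) \<le> ln t" by linarith
  have "0 < t\<^sup>2 + e\<^sup>2" "0 < (1 + t)\<^sup>2" "t\<^sup>2 + e\<^sup>2 \<le> (1 + t)\<^sup>2" using t e by (auto simp: power2_sum intro: add_pos_pos add_nonneg_pos zero_less_power)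
  then have "ln (t\<^sup>2 + e\<^sup>2) \<le> ln ((1 + t)\<^sup>2)" by (subst ln_le_cancel_iff)
  also have "\<dots> = 2 * ln (1 + t)" using t by (simp add: ln_realpow)
  also have "ln (1 + t) \<le> t" using t by (intro ln_add_one_self_le_self) auto
  finally have 3: "reg_log e x z \<le> t" by (simp add: n)
  show ?thesis using 1 2 3 t unfolding log_kernel_bound_def t_def[symmetric]
    by (smt (verit) divide_pos_pos)
qed

lemma ln_cmod_bound: "\<bar>ln (cmod y)\<bar> \<le> log_kernel_bound y"
proof (cases "y = 0")
  case False
  then have t: "cmod y > 0" by simp
  have "1 - 1 / cmod y \<le> ln (cmod y)" using ln_le_minus_one[of "1 / cmod y"] t by (simp add: ln_div)
  moreover have "ln (cmod y) \<le> cmod y - 1" using ln_le_minus_one t by blast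
  moreover have "0 < 1 / cmod y" using t by simp
  ultimately show ?thesis using t unfolding log_kernel_bound_def by linarith
qed (simp add: log_kernel_bound_def)

text \<open>With z in a bounded set and x in a box, the linear part of the majorant is bounded and
  \<open>1/|z - x|\<close> has an integral over x that is bounded uniformly in z. Fubini's theorem
  then makes the potential of \<open>m\<close> finite at almost every x.\<close>

lemma log_kernel_bound_potential_integrable:
  fixes m :: "complex \<Rightarrow> real"
  assumes m: "integrable lborel m" and supp: "\<And>z. R < cmod (z - x0) \<Longrightarrow> m z = 0"
  shows "integrable (lborel \<Otimes>\<^sub>M lborel) (\<lambda>(z, x). m z * (indicator (cbox a b) x * log_kernel_bound (z - x)))"
proof (rule lborel_pair.Fubini_integrable)
  have [measurable]: "m \<in> borel_measurable borel" using m by auto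
  let ?I = "\<lambda>x. indicator (cbox a b) x :: real"
  let ?k = "\<lambda>z. indicator (ball 0 1) z * (1 / cmod z) :: real"
  obtain \<rho> where \<rho>: "\<And>x. x \<in> cbox a b \<Longrightarrow> cmod (x - x0) \<le> \<rho>"
    using bounded_cbox[of a b] unfolding bounded_any_center[of _ x0] by (auto simp: dist_norm norm_minus_commute)
  \<comment> \<open>The 1 covers \<open>1/|z - x|\<close> away from the singularity, the rest bounds
    \<open>|z - x|\<close> on the support and the box.\<close>
  define D where "D = 1 + \<bar>R\<bar> + \<bar>\<rho>\<bar>"
  have D: "D \<ge> 0" by (simp add: D_def)
  have Ii: "integrable lborel ?I" using emeasure_lborel_cbox_finite[of a b] by (simp add: integrable_indicator_iff)
  have ki: "integrable lborel (\<lambda>x. ?k (z - x))" "(\<integral>x. ?k (z - x) \<partial>lborel) = inv_norm_mass" for z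
    using integrable_translate(4)[OF integrable_inverse_norm_ball, of z]
      integral_translate(4)[OF integrable_inverse_norm_ball, of z] by (auto simp: inv_norm_mass_def)
  have le: "?I x * log_kernel_bound (z - x) \<le> ?k (z - x) + D * ?I x" if z: "cmod (z - x0) \<le> R" for z x
  proof (cases "x \<in> cbox a b")
    case True
    have "cmod (z - x) \<le> cmod (z - x0) + cmod (x - x0)" using norm_triangle_ineq4[of "z - x0" "x - x0"] by simp
    then have 1: "cmod (z - x) \<le> \<bar>R\<bar> + \<bar>\<rho>\<bar>" using z \<rho>[OF True] by linarith
    have "1 / cmod (z - x) \<le> 1 * ?k (z - x) + 1" by (rule inverse_norm_split) auto
    then show ?thesis using True 1 by (simp add: log_kernel_bound_def D_def)
  qed auto
  have int: "integrable lborel (\<lambda>x. ?I x * log_kernel_bound (z - x))" if z: "cmod (z - x0) \<le> R" for z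
  proof (rule Bochner_Integration.integrable_bound)
    show "integrable lborel (\<lambda>x. ?k (z - x) + D * ?I x)" using ki(1)[of z] Ii by (intro Bochner_Integration.integrable_add integrable_mult_right)
    show "AE x in lborel. norm (?I x * log_kernel_bound (z - x)) \<le> norm (?k (z - x) + D * ?I x)"
    proof (intro AE_I2)
      fix x
      have "norm (?I x * log_kernel_bound (z - x)) = ?I x * log_kernel_bound (z - x)" by (simp add: abs_mult log_kernel_bound_nonneg)
      also have "\<dots> \<le> norm (?k (z - x) + D * ?I x)" using le[OF z, of x] by (rule order_trans) simp
      finally show "norm (?I x * log_kernel_bound (z - x)) \<le> norm (?k (z - x) + D * ?I x)" .
    qed
  qed measurable
  show "(\<lambda>(z, x). m z * (?I x * log_kernel_bound (z - x))) \<in> borel_measurable (lborel \<Otimes>\<^sub>M lborel)" by measurable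
  show "AE z in lborel. integrable lborel (\<lambda>x. case (z, x) of (z, x) \<Rightarrow> m z * (?I x * log_kernel_bound (z - x)))"
  proof (intro AE_I2)
    fix z show "integrable lborel (\<lambda>x. case (z, x) of (z, x) \<Rightarrow> m z * (?I x * log_kernel_bound (z - x)))"
      using int[of z] supp[of z] by (cases "cmod (z - x0) \<le> R") (auto intro: integrable_mult_right)
  qed
  define E where "E = inv_norm_mass + D * (\<integral>x. ?I x \<partial>lborel)"
  have E: "E \<ge> 0" unfolding E_def by (intro add_nonneg_nonneg inv_norm_mass_nonneg mult_nonneg_nonneg D Bochner_Integration.integral_nonneg) auto
  show "integrable lborel (\<lambda>z. \<integral>x. norm (case (z, x) of (z, x) \<Rightarrow> m z * (?I x * log_kernel_bound (z - x))) \<partial>lborel)"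
  proof (rule Bochner_Integration.integrable_bound)
    show "integrable lborel (\<lambda>z. E * \<bar>m z\<bar>)" using m by simp
    show "AE z in lborel. norm (\<integral>x. norm (case (z, x) of (z, x) \<Rightarrow> m z * (?I x * log_kernel_bound (z - x))) \<partial>lborel) \<le> norm (E * \<bar>m z\<bar>)"
    proof (intro AE_I2)
      fix z
      have eq: "(\<integral>x. norm (case (z, x) of (z, x) \<Rightarrow> m z * (?I x * log_kernel_bound (z - x))) \<partial>lborel) = \<bar>m z\<bar> * (\<integral>x. ?I x * log_kernel_bound (z - x) \<partial>lborel)"
        unfolding integral_mult_right_zero[symmetric] by (simp add: abs_mult log_kernel_bound_nonneg)
      show "norm (\<integral>x. norm (case (z, x) of (z, x) \<Rightarrow> m z * (?I x * log_kernel_bound (z - x))) \<partial>lborel) \<le> norm (E * \<bar>m z\<bar>)"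
      proof (cases "cmod (z - x0) \<le> R")
        case True
        have "(\<integral>x. ?I x * log_kernel_bound (z - x) \<partial>lborel) \<le> (\<integral>x. ?k (z - x) + D * ?I x \<partial>lborel)"
          using ki(1)[of z] Ii by (intro integral_mono int True le Bochner_Integration.integrable_add integrable_mult_right) 
        also have "\<dots> = E"
          unfolding E_def by (subst Bochner_Integration.integral_add, rule ki(1), intro integrable_mult_right Ii, simp only: ki(2) integral_mult_right_zero)
        finally have "(\<integral>x. ?I x * log_kernel_bound (z - x) \<partial>lborel) \<le> E" .
        moreover have "0 \<le> (\<integral>x. ?I x * log_kernel_bound (z - x) \<partial>lborel)" by (intro Bochner_Integration.integral_nonneg) (auto simp: log_kernel_bound_nonneg)
        ultimately have "\<bar>m z\<bar> * (\<integral>x. ?I x * log_kernel_bound (z - x) \<partial>lborel) \<le> \<bar>m z\<bar> * E" "0 \<le> \<bar>m z\<bar> * (\<integral>x. ?I x * log_kernel_bound (z - x) \<partial>lborel)"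
          by (auto intro: mult_left_mono)
        then show ?thesis unfolding eq using E by (simp only: real_norm_def abs_mult abs_of_nonneg abs_abs mult.commute)
      qed (use supp[of z] in \<open>simp add: eq\<close>)
    qed
  qed measurable
qed

text \<open>Inserting the localised regularised logarithm into the weak equation gives, for each n
  and almost every x, that the mollification of \<open>\<psi> * ch\<close> equals the regularised
  right-hand side \<open>Sn n x\<close>. The left side converges when integrated over boxes, the
  right side also pointwise, so the two limits have the same integral over every box and agree
  almost everywhere.\<close>

lemma weak_representation:
  fixes \<psi> F :: "complex \<Rightarrow> real" and x0 :: complex
  assumes psi[measurable]: "\<psi> \<in> borel_measurable borel"
    and loc: "\<And>S. compact S \<Longrightarrow> set_integrable lborel S \<psi>"
    and F: "integrable lborel F"
    and weak: "\<And>\<phi>. test_function \<phi> \<Longrightarrow> - (\<integral>x. \<psi> x * laplacian \<phi> x \<partial>lborel) = (\<integral>x. F x * \<phi> x \<partial>lborel)"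
    and r: "r > 0"
  defines "ch \<equiv> cutoff x0 r" and "W \<equiv> laplacian (cutoff x0 r)" and "g \<equiv> grad (cutoff x0 r)"
  shows "AE x in lborel. integrable lborel (\<lambda>z. F z * ch z * ln (cmod (z - x))) \<and>
     kern_mass * (\<psi> x * ch x) = - (\<integral>z. F z * ch z * ln (cmod (z - x)) \<partial>lborel)
       - (\<integral>z. \<psi> z * (W z * ln (cmod (z - x)) + 2 * ((g z \<bullet> (z - x)) / (cmod (z - x))\<^sup>2)) \<partial>lborel)"
proof -
  have [measurable]: "F \<in> borel_measurable borel" using F by auto
  have cont: "continuous_on UNIV ch" "continuous_on UNIV g" "continuous_on UNIV W"
    unfolding ch_def g_def W_def by (intro cutoff_continuous r)+
  then have [measurable]: "ch \<in> borel_measurable borel" "g \<in> borel_measurable borel" "W \<in> borel_measurable borel"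
    by (auto intro: borel_measurable_continuous_onI)
  have out: "ch z = 0" "g z = 0" "W z = 0" if "2 * r < cmod (z - x0)" for z
    using cutoff_bounds(4)[OF r, of z x0] cutoff_locally_const[OF r, of z x0] that by (auto simp: ch_def g_def W_def)
  have chb: "0 \<le> ch z" "ch z \<le> 1" for z unfolding ch_def using cutoff_bounds[OF r] by auto
  let ?C = "cball x0 (2 * r)"
  let ?IC = "\<lambda>z. indicator ?C z :: real"
  have psiC: "integrable lborel (\<lambda>z. ?IC z * \<psi> z)" using loc[of ?C] by (simp add: set_integrable_def)
  have bnd: "\<exists>c. \<forall>z\<in>?C. norm (h z) \<le> c" if "continuous_on UNIV h" for h :: "complex \<Rightarrow> 'b::real_normed_vector"
    using compact_imp_bounded[OF compact_continuous_image[OF continuous_on_subset[OF that] compact_cball]]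
    unfolding bounded_iff by blast
  obtain cg where cg: "\<And>z. z \<in> ?C \<Longrightarrow> norm (g z) \<le> cg" using bnd[OF cont(2)] by blast
  obtain cW where cW: "\<And>z. z \<in> ?C \<Longrightarrow> norm (W z) \<le> cW" using bnd[OF cont(3)] by blast
  \<comment> \<open>Collects all densities standing before a singular kernel, so that
    \<open>m z * log_kernel_bound (z - x)\<close> dominates every integrand below, for all n and in
    the limit.\<close>
  define m where "m z = \<bar>F z\<bar> * ch z + \<bar>\<psi> z\<bar> * \<bar>W z\<bar> + 2 * (\<bar>\<psi> z\<bar> * cmod (g z))" for z
  have m0: "0 \<le> m z" for z unfolding m_def using chb by (intro add_nonneg_nonneg mult_nonneg_nonneg) auto
  have [measurable]: "m \<in> borel_measurable borel" unfolding m_def by measurable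
  have mi: "integrable lborel m"
  proof -
    have 1: "integrable lborel (\<lambda>z. \<bar>F z\<bar> * ch z)"
      by (rule Bochner_Integration.integrable_bound[OF F]) (use chb in \<open>auto simp: abs_mult intro!: mult_left_le\<close>)
    have 2: "integrable lborel (\<lambda>z. \<bar>\<psi> z\<bar> * \<bar>h z\<bar>)" if [measurable]: "h \<in> borel_measurable borel" and "\<And>z. z \<in> ?C \<Longrightarrow> \<bar>h z\<bar> \<le> c" "\<And>z. z \<notin> ?C \<Longrightarrow> h z = 0" for h :: "complex \<Rightarrow> real" and c :: real
    proof (rule Bochner_Integration.integrable_bound)
      show "integrable lborel (\<lambda>z. c * (?IC z * \<psi> z))" using psiC by (rule integrable_mult_right)
      show "AE z in lborel. norm (\<bar>\<psi> z\<bar> * \<bar>h z\<bar>) \<le> norm (c * (?IC z * \<psi> z))"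
      proof (intro AE_I2)
        fix z show "norm (\<bar>\<psi> z\<bar> * \<bar>h z\<bar>) \<le> norm (c * (?IC z * \<psi> z))"
        proof (cases "z \<in> ?C")
          case True
          have "\<bar>\<psi> z\<bar> * \<bar>h z\<bar> \<le> \<bar>\<psi> z\<bar> * \<bar>c\<bar>"
            by (intro mult_left_mono order_trans[OF that(2)[OF True] abs_ge_self]) simp
          then show ?thesis using True by (simp add: abs_mult mult.commute)
        qed (use that(3)[of z] in simp)
      qed
    qed measurable
    have 3: "integrable lborel (\<lambda>z. \<bar>\<psi> z\<bar> * \<bar>W z\<bar>)" by (rule 2[of W cW]) (use cW out in \<open>auto simp: dist_norm norm_minus_commute\<close>)
    have "integrable lborel (\<lambda>z. \<bar>\<psi> z\<bar> * \<bar>cmod (g z)\<bar>)" by (rule 2[of "\<lambda>z. cmod (g z)" cg]) (use cg out in \<open>auto simp: dist_norm norm_minus_commute\<close>)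
    then show ?thesis unfolding m_def using 1 3 by simp
  qed
  have m_out: "m z = 0" if "2 * r < cmod (z - x0)" for z using out[OF that] by (simp add: m_def)
  have f: "integrable lborel (\<lambda>z. \<psi> z * ch z)"
  proof (rule Bochner_Integration.integrable_bound[OF psiC])
    show "AE z in lborel. norm (\<psi> z * ch z) \<le> norm (?IC z * \<psi> z)"
    proof (intro AE_I2)
      fix z show "norm (\<psi> z * ch z) \<le> norm (?IC z * \<psi> z)"
        using chb[of z] out(1)[of z] by (cases "z \<in> ?C") (auto simp: abs_mult dist_norm norm_minus_commute intro!: mult_left_le)
    qed
  qed measurable
  define e where "e n = 1 / real (Suc n)" for n
  have e: "0 < e n" "e n \<le> 1" for n by (auto simp: e_def)
  have elim: "e \<longlonglongrightarrow> 0" unfolding e_def using LIMSEQ_inverse_real_of_nat by (simp add: inverse_eq_divide)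
  define p where "p n x z = F z * (ch z * reg_log (e n) x z)" for n x z
  \<comment> \<open>The two annulus terms of the Laplacian of the test function; \<open>pl\<close>
    and \<open>ql\<close> are the limits of \<open>p n\<close> and \<open>q n\<close>.\<close>
  define q where "q n x z = \<psi> z * (W z * reg_log (e n) x z + 2 * ((g z \<bullet> (z - x)) / ((cmod (z - x))\<^sup>2 + (e n)\<^sup>2)))" for n x z
  define pl where "pl x z = F z * ch z * ln (cmod (z - x))" for x z
  define ql where "ql x z = \<psi> z * (W z * ln (cmod (z - x)) + 2 * ((g z \<bullet> (z - x)) / (cmod (z - x))\<^sup>2))" for x z
  have [measurable]: "(\<lambda>(x, z). p n x z) \<in> borel_measurable (borel \<Otimes>\<^sub>M borel)" "(\<lambda>(x, z). q n x z) \<in> borel_measurable (borel \<Otimes>\<^sub>M borel)"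
     "(\<lambda>(x, z). pl x z) \<in> borel_measurable (borel \<Otimes>\<^sub>M borel)" "(\<lambda>(x, z). ql x z) \<in> borel_measurable (borel \<Otimes>\<^sub>M borel)" for n
    unfolding p_def q_def pl_def ql_def reg_log_def by measurable
  have [measurable]: "p n x \<in> borel_measurable borel" "q n x \<in> borel_measurable borel" "pl x \<in> borel_measurable borel" "ql x \<in> borel_measurable borel" for n x
    unfolding p_def q_def pl_def ql_def reg_log_def by measurable
  have gb: "\<bar>(g z \<bullet> (z - x)) / ((cmod (z - x))\<^sup>2 + s\<^sup>2)\<bar> \<le> cmod (g z) * log_kernel_bound (z - x)" if "z \<noteq> x" for x z and s :: real
  proof -
    have t: "0 < cmod (z - x)" using that by simp
    have "\<bar>g z \<bullet> (z - x)\<bar> / ((cmod (z - x))\<^sup>2 + s\<^sup>2) \<le> (cmod (g z) * cmod (z - x)) / (cmod (z - x))\<^sup>2"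
      using t by (intro frac_le Cauchy_Schwarz_ineq2) auto
    also have "\<dots> = cmod (g z) * (1 / cmod (z - x))" using t by (simp add: power2_eq_square)
    also have "\<dots> \<le> cmod (g z) * log_kernel_bound (z - x)" by (intro mult_left_mono) (auto simp: log_kernel_bound_def)
    finally show ?thesis by (simp add: abs_divide)
  qed
  have comb: "\<bar>F z * (ch z * L)\<bar> \<le> m z * log_kernel_bound (z - x)" "\<bar>\<psi> z * (W z * L + 2 * G)\<bar> \<le> m z * log_kernel_bound (z - x)"
    if L: "\<bar>L\<bar> \<le> log_kernel_bound (z - x)" and G: "\<bar>G\<bar> \<le> cmod (g z) * log_kernel_bound (z - x)" for z x L G
  proof -
    have "\<bar>F z * (ch z * L)\<bar> \<le> \<bar>F z\<bar> * ch z * log_kernel_bound (z - x)" using L chb by (simp add: abs_mult mult.assoc mult_left_mono)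
    also have "\<dots> \<le> m z * log_kernel_bound (z - x)" unfolding m_def by (intro mult_right_mono) (auto simp: log_kernel_bound_nonneg)
    finally show "\<bar>F z * (ch z * L)\<bar> \<le> m z * log_kernel_bound (z - x)" .
    have "\<bar>W z * L + 2 * G\<bar> \<le> \<bar>W z\<bar> * \<bar>L\<bar> + 2 * \<bar>G\<bar>" using abs_triangle_ineq[of "W z * L" "2 * G"] by (simp add: abs_mult)
    also have "\<dots> \<le> \<bar>W z\<bar> * log_kernel_bound (z - x) + 2 * (cmod (g z) * log_kernel_bound (z - x))" using L G by (intro add_mono mult_left_mono) auto
    finally have "\<bar>\<psi> z * (W z * L + 2 * G)\<bar> \<le> \<bar>\<psi> z\<bar> * (\<bar>W z\<bar> * log_kernel_bound (z - x) + 2 * (cmod (g z) * log_kernel_bound (z - x)))" unfolding abs_mult by (intro mult_left_mono) auto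
    also have "\<dots> = (\<bar>\<psi> z\<bar> * \<bar>W z\<bar> + 2 * (\<bar>\<psi> z\<bar> * cmod (g z))) * log_kernel_bound (z - x)" by (simp add: algebra_simps)
    also have "\<dots> \<le> m z * log_kernel_bound (z - x)" unfolding m_def using chb by (intro mult_right_mono) (auto simp: log_kernel_bound_nonneg)
    finally show "\<bar>\<psi> z * (W z * L + 2 * G)\<bar> \<le> m z * log_kernel_bound (z - x)" .
  qed
  have pb: "\<bar>p n x z\<bar> \<le> m z * log_kernel_bound (z - x)" and qb: "\<bar>q n x z\<bar> \<le> m z * log_kernel_bound (z - x)" if "z \<noteq> x" for n x z
    unfolding p_def q_def using comb[OF reg_log_bound[OF e that] gb[OF that]] by auto
  have plb: "\<bar>pl x z\<bar> \<le> m z * log_kernel_bound (z - x)" and qlb: "\<bar>ql x z\<bar> \<le> m z * log_kernel_bound (z - x)" if "z \<noteq> x" for x z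
    unfolding pl_def ql_def mult.assoc using comb[OF ln_cmod_bound gb[OF that, of 0]] by auto
  have nx: "AE z in lborel. z \<noteq> x" for x :: complex using AE_lborel_singleton .
  define S where "S x = - (\<integral>z. pl x z \<partial>lborel) - (\<integral>z. ql x z \<partial>lborel)" for x
  define Sn where "Sn n x = - (\<integral>z. p n x z \<partial>lborel) - (\<integral>z. q n x z \<partial>lborel)" for n x
  have [measurable]: "S \<in> borel_measurable borel" "Sn n \<in> borel_measurable borel" for n unfolding S_def Sn_def by measurable
  define M where "M x = (\<integral>z. m z * log_kernel_bound (z - x) \<partial>lborel)" for x
  have SnI: "Sn n x = (\<integral>z. (\<psi> z * ch z) * kern (e n) (z - x) \<partial>lborel)" if mJ: "integrable lborel (\<lambda>z. m z * log_kernel_bound (z - x))" for n x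
  proof -
    have ip: "integrable lborel (p n x)"
      by (rule Bochner_Integration.integrable_bound[OF mJ]) (use nx[of x] pb[of _ x n] in \<open>auto elim!: eventually_mono intro: order_trans[OF _ abs_ge_self]\<close>)
    have iq: "integrable lborel (q n x)"
      by (rule Bochner_Integration.integrable_bound[OF mJ]) (use nx[of x] qb[of _ x n] in \<open>auto elim!: eventually_mono intro: order_trans[OF _ abs_ge_self]\<close>)
    have ik: "integrable lborel (\<lambda>z. (\<psi> z * ch z) * kern (e n) (z - x))"
    proof (rule Bochner_Integration.integrable_bound)
      show "integrable lborel (\<lambda>z. (2 / (e n)\<^sup>2) * (\<psi> z * ch z))" using f by (rule integrable_mult_right)
      show "AE z in lborel. norm (\<psi> z * ch z * kern (e n) (z - x)) \<le> norm (2 / (e n)\<^sup>2 * (\<psi> z * ch z))"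
      proof (intro AE_I2)
        fix z
        have "kern (e n) (z - x) \<le> 2 / (e n)\<^sup>2"
          using reg_inverse(5)[OF e(1)[of n], of "z - x"] kern_nonneg[of "e n" "z - x"] by (simp add: norm_divide)
        then show "norm (\<psi> z * ch z * kern (e n) (z - x)) \<le> norm (2 / (e n)\<^sup>2 * (\<psi> z * ch z))"
          using mult_left_mono[of "kern (e n) (z - x)" "2 / (e n)\<^sup>2" "\<bar>\<psi> z * ch z\<bar>"] kern_nonneg[of "e n" "z - x"]
          by (simp add: abs_mult mult.commute)
      qed
    qed measurable
    have "(\<integral>z. F z * (ch z * reg_log (e n) x z) \<partial>lborel) = - (\<integral>z. \<psi> z * laplacian (\<lambda>z. ch z * reg_log (e n) x z) z \<partial>lborel)"
      using weak[OF cutoff_reg_log(1)[OF r e(1)], folded ch_def, of x0 n x] unfolding ch_def by simp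
    also have "(\<integral>z. \<psi> z * laplacian (\<lambda>z. ch z * reg_log (e n) x z) z \<partial>lborel) = (\<integral>z. q n x z + (\<psi> z * ch z) * kern (e n) (z - x) \<partial>lborel)"
      unfolding ch_def cutoff_reg_log(2)[OF r e(1)] q_def W_def g_def by (simp add: algebra_simps)
    finally show ?thesis using iq ik by (simp add: Sn_def p_def)
  qed
  have Slim: "(\<lambda>n. Sn n x) \<longlonglongrightarrow> S x" and Sbd: "\<bar>Sn n x\<bar> \<le> 2 * M x" "\<bar>S x\<bar> \<le> 2 * M x" and pli: "integrable lborel (pl x)"
    if mJ: "integrable lborel (\<lambda>z. m z * log_kernel_bound (z - x))" for n x
  proof -
    have nl: "(\<lambda>n. reg_log (e n) x z) \<longlonglongrightarrow> ln (cmod (z - x))" if "z \<noteq> x" for z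
    proof -
      have "(\<lambda>n. (1/2) * ln ((cmod (z - x))\<^sup>2 + (e n)\<^sup>2)) \<longlonglongrightarrow> (1/2) * ln ((cmod (z - x))\<^sup>2 + 0\<^sup>2)"
        using that by (intro tendsto_intros elim) auto
      then show ?thesis using that by (simp add: reg_log_def ln_realpow)
    qed
    have gl: "(\<lambda>n. (g z \<bullet> (z - x)) / ((cmod (z - x))\<^sup>2 + (e n)\<^sup>2)) \<longlonglongrightarrow> (g z \<bullet> (z - x)) / ((cmod (z - x))\<^sup>2 + 0\<^sup>2)" if "z \<noteq> x" for z
      using that by (intro tendsto_intros elim) auto
    have "(\<lambda>n. \<integral>z. p n x z \<partial>lborel) \<longlonglongrightarrow> (\<integral>z. pl x z \<partial>lborel)"
    proof (rule integral_dominated_convergence[OF _ _ mJ])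
      show "AE z in lborel. (\<lambda>n. p n x z) \<longlonglongrightarrow> pl x z"
        using nx[of x] unfolding p_def pl_def mult.assoc by eventually_elim (intro tendsto_intros nl)
      show "AE z in lborel. norm (p n x z) \<le> m z * log_kernel_bound (z - x)" for n
        using nx[of x] by eventually_elim (use pb in auto)
    qed measurable
    moreover have "(\<lambda>n. \<integral>z. q n x z \<partial>lborel) \<longlonglongrightarrow> (\<integral>z. ql x z \<partial>lborel)"
    proof (rule integral_dominated_convergence[OF _ _ mJ])
      show "AE z in lborel. (\<lambda>n. q n x z) \<longlonglongrightarrow> ql x z"
        using nx[of x]
      proof eventually_elim
        fix z assume z: "z \<noteq> x"
        have "(\<lambda>n. q n x z) \<longlonglongrightarrow> \<psi> z * (W z * ln (cmod (z - x)) + 2 * ((g z \<bullet> (z - x)) / ((cmod (z - x))\<^sup>2 + 0\<^sup>2)))"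
          unfolding q_def by (intro tendsto_intros nl gl z)
        then show "(\<lambda>n. q n x z) \<longlonglongrightarrow> ql x z" by (simp add: ql_def)
      qed
      show "AE z in lborel. norm (q n x z) \<le> m z * log_kernel_bound (z - x)" for n
        using nx[of x] by eventually_elim (use qb in auto)
    qed measurable
    ultimately show "(\<lambda>n. Sn n x) \<longlonglongrightarrow> S x" unfolding Sn_def S_def by (intro tendsto_intros)
    have ib: "integrable lborel h" "\<bar>\<integral>z. h z \<partial>lborel\<bar> \<le> M x" if [measurable]: "h \<in> borel_measurable borel" and "\<And>z. z \<noteq> x \<Longrightarrow> \<bar>h z\<bar> \<le> m z * log_kernel_bound (z - x)" for h
    proof -
      have ae: "AE z in lborel. norm (h z) \<le> m z * log_kernel_bound (z - x)" using nx[of x] by eventually_elim (use that in auto)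
      show i: "integrable lborel h"
        by (rule Bochner_Integration.integrable_bound[OF mJ]) (use ae in \<open>auto elim!: eventually_mono intro: order_trans[OF _ abs_ge_self]\<close>)
      have "norm (\<integral>z. h z \<partial>lborel) \<le> (\<integral>z. norm (h z) \<partial>lborel)" by (rule integral_norm_bound)
      also have "\<dots> \<le> M x" unfolding M_def by (rule integral_mono_AE[OF integrable_norm[OF i] mJ ae])
      finally show "\<bar>\<integral>z. h z \<partial>lborel\<bar> \<le> M x" by simp
    qed
    show "\<bar>Sn n x\<bar> \<le> 2 * M x" using ib(2)[of "p n x"] ib(2)[of "q n x"] pb qb by (auto simp: Sn_def)
    show "\<bar>S x\<bar> \<le> 2 * M x" using ib(2)[of "pl x"] ib(2)[of "ql x"] plb qlb by (auto simp: S_def)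
    show "integrable lborel (pl x)" using ib(1)[of "pl x"] plb by auto
  qed
  \<comment> \<open>The identities and limits for \<open>Sn\<close> hold at every x where this
    majorant is integrable, hence at almost every x of a box; \<open>M\<close> makes the convergence
    dominated in x as well.\<close>
  have ae_box: "AE x in lborel. x \<in> cbox a b \<longrightarrow> integrable lborel (\<lambda>z. m z * log_kernel_bound (z - x))"
    and Mi: "integrable lborel (\<lambda>x. indicator (cbox a b) x * M x)" for a b
  proof -
    have i: "integrable (lborel \<Otimes>\<^sub>M lborel) (\<lambda>(z, x). m z * (indicator (cbox a b) x * log_kernel_bound (z - x)))"
      by (rule log_kernel_bound_potential_integrable[OF mi m_out])
    have i': "integrable (lborel \<Otimes>\<^sub>M lborel) (\<lambda>(x, z). m z * (indicator (cbox a b) x * log_kernel_bound (z - x)))"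
      using lborel_pair.integrable_product_swap[OF i] by simp
    have "AE x in lborel. integrable lborel (\<lambda>z. m z * (indicator (cbox a b) x * log_kernel_bound (z - x)))"
      using lborel_pair.AE_integrable_fst'[OF i'] by simp
    then show "AE x in lborel. x \<in> cbox a b \<longrightarrow> integrable lborel (\<lambda>z. m z * log_kernel_bound (z - x))"
      by eventually_elim auto
    have "integrable lborel (\<lambda>x. \<integral>z. m z * (indicator (cbox a b) x * log_kernel_bound (z - x)) \<partial>lborel)"
      using lborel_pair.integrable_fst'[OF i'] by simp
    then show "integrable lborel (\<lambda>x. indicator (cbox a b) x * M x)"
      unfolding M_def integral_mult_right_zero[symmetric] by (simp add: mult.left_commute)
  qed
  have Si: "integrable lborel (\<lambda>x. indicator (cbox a b) x * S x)" for a b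
  proof (rule Bochner_Integration.integrable_bound)
    show "integrable lborel (\<lambda>x. 2 * (indicator (cbox a b) x * M x))" using Mi by simp
    show "AE x in lborel. norm (indicator (cbox a b) x * S x) \<le> norm (2 * (indicator (cbox a b) x * M x))"
      using ae_box[of a b] by eventually_elim (use Sbd in \<open>force simp: indicator_def\<close>)
  qed measurable
  have fi: "integrable lborel (\<lambda>x. indicator (cbox a b) x * (\<psi> x * ch x))" for a b
    by (rule Bochner_Integration.integrable_bound[OF f]) (auto simp: indicator_def)
  have lim2: "(\<lambda>n. \<integral>x. indicator (cbox a b) x * Sn n x \<partial>lborel) \<longlonglongrightarrow> (\<integral>x. indicator (cbox a b) x * S x \<partial>lborel)" for a b
  proof (rule integral_dominated_convergence[where w="\<lambda>x. 2 * (indicator (cbox a b) x * M x)"])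
    show "AE x in lborel. (\<lambda>n. indicator (cbox a b) x * Sn n x) \<longlonglongrightarrow> indicator (cbox a b) x * S x"
      using ae_box[of a b] by eventually_elim (use Slim in \<open>auto simp: indicator_def\<close>)
    show "AE x in lborel. norm (indicator (cbox a b) x * Sn n x) \<le> 2 * (indicator (cbox a b) x * M x)" for n
      using ae_box[of a b] by eventually_elim (use Sbd in \<open>force simp: indicator_def\<close>)
  qed (use Mi in auto)
  have lim1: "(\<lambda>n. \<integral>x. indicator (cbox a b) x * Sn n x \<partial>lborel) \<longlonglongrightarrow> kern_mass * (\<integral>x. indicator (cbox a b) x * (\<psi> x * ch x) \<partial>lborel)" for a b
  proof -
    have "(\<integral>x. indicator (cbox a b) x * Sn n x \<partial>lborel) = (\<integral>x. indicator (cbox a b) x * (\<integral>z. (\<psi> z * ch z) * kern (e n) (z - x) \<partial>lborel) \<partial>lborel)" for n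
    proof (rule integral_cong_AE)
      show "AE x in lborel. indicator (cbox a b) x * Sn n x = indicator (cbox a b) x * (\<integral>z. (\<psi> z * ch z) * kern (e n) (z - x) \<partial>lborel)"
        using ae_box[of a b] by eventually_elim (use SnI in \<open>auto simp: indicator_def\<close>)
    qed measurable
    then show ?thesis using kern_box_limit[OF f, of a b] unfolding e_def by simp
  qed
  have "AE x in lborel. S x - kern_mass * (\<psi> x * ch x) = 0"
  proof (rule AE_zero_if_box_integrals_zero)
    fix a b
    have *: "(\<lambda>x. indicator (cbox a b) x * (S x - kern_mass * (\<psi> x * ch x))) = (\<lambda>x. indicator (cbox a b) x * S x - kern_mass * (indicator (cbox a b) x * (\<psi> x * ch x)))"
      by (auto simp: algebra_simps)
    show "integrable lborel (\<lambda>x. indicator (cbox a b) x * (S x - kern_mass * (\<psi> x * ch x)))"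
      unfolding * using Si fi by (intro Bochner_Integration.integrable_diff integrable_mult_right)
    show "(\<integral>x. indicator (cbox a b) x * (S x - kern_mass * (\<psi> x * ch x)) \<partial>lborel) = 0"
      unfolding * using LIMSEQ_unique[OF lim1[of a b] lim2[of a b]]
      by (subst Bochner_Integration.integral_diff[OF Si integrable_mult_right[OF fi]]) (simp only: integral_mult_right_zero right_minus_eq)
  qed
  moreover have "AE x in lborel. integrable lborel (pl x)"
  proof -
    \<comment> \<open>The squares with half side k exhaust the plane, and countably many null sets
      are allowed.\<close>
    have "AE x in lborel. \<forall>k::nat. x \<in> cbox (- of_nat k * (1 + \<i>)) (of_nat k * (1 + \<i>)) \<longrightarrow> integrable lborel (\<lambda>z. m z * log_kernel_bound (z - x))"
      unfolding AE_all_countable using ae_box by blast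
    then show ?thesis
    proof eventually_elim
      fix x assume a: "\<forall>k::nat. x \<in> cbox (- of_nat k * (1 + \<i>)) (of_nat k * (1 + \<i>)) \<longrightarrow> integrable lborel (\<lambda>z. m z * log_kernel_bound (z - x))"
      obtain k :: nat where "cmod x \<le> real k" using real_arch_simple by blast
      then have "\<bar>Re x\<bar> \<le> real k" "\<bar>Im x\<bar> \<le> real k" using abs_Re_le_cmod[of x] abs_Im_le_cmod[of x] by linarith+
      then have "x \<in> cbox (- of_nat k * (1 + \<i>)) (of_nat k * (1 + \<i>))" by (auto simp: in_cbox_complex_iff)
      then show "integrable lborel (pl x)" using a pli by blast
    qed
  qed
  ultimately show ?thesis
    by eventually_elim (auto simp: S_def pl_def[abs_def] ql_def[abs_def])
qed

section \<open>Harmonicity of the annulus terms\<close>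

lemma Re_divide_inner: "Re (g / y) = (g \<bullet> y) / (cmod y)\<^sup>2"
  by (simp add: Re_divide inner_complex_def cmod_power2)

text \<open>On this disc the principal logarithm of 1 - w is holomorphic. The 5 is 1 + 4: the real
  part is at most 1 in modulus, the imaginary part at most pi < 4.\<close>

lemma cmod_Ln_near_one:
  assumes "cmod w \<le> 1/2"
  shows "cmod (Ln (1 - w)) \<le> 5" "1 - w \<notin> \<real>\<^sub>\<le>\<^sub>0" "Re (Ln (1 - w)) = ln (cmod (1 - w))"
proof -
  have 1: "1/2 \<le> cmod (1 - w)" "cmod (1 - w) \<le> 3/2"
    using norm_triangle_ineq2[of 1 w] norm_triangle_ineq4[of 1 w] assms by auto
  then have nz: "1 - w \<noteq> 0" by auto
  have "Re w \<le> 1/2" using complex_Re_le_cmod[of w] assms by linarith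
  then show "1 - w \<notin> \<real>\<^sub>\<le>\<^sub>0" by (auto simp: complex_nonpos_Reals_iff)
  show re: "Re (Ln (1 - w)) = ln (cmod (1 - w))" using Re_Ln[OF nz] .
  have "ln (1 / cmod (1 - w)) \<le> 1 / cmod (1 - w) - 1" using 1 by (intro ln_le_minus_one) auto
  moreover have "1 / cmod (1 - w) \<le> 2" using frac_le[of 1 1 "1/2" "cmod (1 - w)"] 1 by simp
  moreover have "ln (1 / cmod (1 - w)) = - ln (cmod (1 - w))" using nz by (simp add: ln_div)
  ultimately have "- ln (cmod (1 - w)) \<le> 1" by linarith
  moreover have "ln (cmod (1 - w)) \<le> cmod (1 - w) - 1" using 1 by (intro ln_le_minus_one) linarith
  ultimately have "\<bar>Re (Ln (1 - w))\<bar> \<le> 1" unfolding re using 1 by linarith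
  moreover have "\<bar>Im (Ln (1 - w))\<bar> \<le> pi" using mpi_less_Im_Ln[OF nz] Im_Ln_le_pi[OF nz] by linarith
  ultimately show "cmod (Ln (1 - w)) \<le> 5" using cmod_le[of "Ln (1 - w)"] pi_less_4 by linarith
qed

locale weak_solution =
  fixes \<psi> F :: "complex \<Rightarrow> real"
  assumes psi[measurable]: "\<psi> \<in> borel_measurable borel"
    and loc: "\<And>S. compact S \<Longrightarrow> set_integrable lborel S \<psi>"
    and F: "integrable lborel F"
    and weak: "\<And>\<phi>. test_function \<phi> \<Longrightarrow> - (\<integral>x. \<psi> x * laplacian \<phi> x \<partial>lborel) = (\<integral>x. F x * \<phi> x \<partial>lborel)"
begin

lemma F_measurable[measurable]: "F \<in> borel_measurable borel" using F by auto

text \<open>For z in the annulus and x within r/2 of the centre, \<open>ln |z - x|\<close> is the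
  real part of \<open>Ln (1 - (x - x0)/(z - x0)) + ln |z - x0|\<close>, and the gradient kernel is
  the real part of \<open>g z / (z - x)\<close>. Both are holomorphic in x, so the annulus terms
  integrate to the real part of a holomorphic function.\<close>

lemma local_representation:
  assumes r: "r > 0"
  obtains A where "A holomorphic_on ball x0 (r/2)"
    "AE x in lborel. x \<in> ball x0 (r/2) \<longrightarrow> integrable lborel (\<lambda>z. F z * cutoff x0 r z * ln (cmod (z - x))) \<and>
     kern_mass * \<psi> x = Re (A x) - (\<integral>z. F z * cutoff x0 r z * ln (cmod (z - x)) \<partial>lborel)"
proof -
  define W where "W = laplacian (cutoff x0 r)"
  define g where "g = grad (cutoff x0 r)"
  have cont: "continuous_on UNIV g" "continuous_on UNIV W"
    unfolding g_def W_def by (intro cutoff_continuous r)+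
  then have [measurable]: "g \<in> borel_measurable borel" "W \<in> borel_measurable borel"
    by (auto intro: borel_measurable_continuous_onI)
  let ?C = "cball x0 (2 * r)"
  let ?An = "?C - ball x0 r"
  have out: "g z = 0" "W z = 0" if "z \<notin> ?An" for z
    using cutoff_locally_const[OF r, of z x0] that by (auto simp: g_def W_def dist_norm norm_minus_commute)
  have bnd: "\<exists>c. \<forall>z\<in>?C. norm (h z) \<le> c" if "continuous_on UNIV h" for h :: "complex \<Rightarrow> 'b::real_normed_vector"
    using compact_imp_bounded[OF compact_continuous_image[OF continuous_on_subset[OF that] compact_cball]]
    unfolding bounded_iff by blast
  obtain cg where cg: "\<And>z. z \<in> ?C \<Longrightarrow> norm (g z) \<le> cg" using bnd[OF cont(1)] by blast
  obtain cW where cW: "\<And>z. z \<in> ?C \<Longrightarrow> norm (W z) \<le> cW" using bnd[OF cont(2)] by blast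
  have x0C: "x0 \<in> ?C" using r by simp
  have c0: "0 \<le> cg" "0 \<le> cW" using cg[OF x0C] cW[OF x0C] by (auto intro: order_trans[OF norm_ge_zero] order_trans[OF abs_ge_zero])
  \<comment> \<open>Factoring out \<open>z - x0\<close> keeps the argument of \<open>Ln\<close>
    within 1/2 of 1, away from the branch cut; the indicator restricts to the z for which this is
    true.\<close>
  define L where "L x z = indicator ?An z * Ln (1 - (x - x0) / (z - x0))" for x z
  define \<Phi> where "\<Phi> x z = of_real (\<psi> z) * (of_real (W z) * (L x z + of_real (ln (cmod (z - x0)))) + 2 * (g z / (z - x)))" for x z
  define A where "A x = - (\<integral>z. \<Phi> x z \<partial>lborel)" for x
  have An: "cmod ((x - x0) / (z - x0)) \<le> 1/2" "r / 2 \<le> cmod (z - x)" "z \<noteq> x0" "cmod (1 - (x - x0) / (z - x0)) = cmod (z - x) / cmod (z - x0)"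
    "r \<le> cmod (z - x0)" "cmod (z - x0) \<le> 2 * r"
    if x: "x \<in> ball x0 (r/2)" and z: "z \<in> ?An" for x z
  proof -
    have a: "cmod (x - x0) < r / 2" "r \<le> cmod (z - x0)" "cmod (z - x0) \<le> 2 * r" using x z by (auto simp: dist_norm norm_minus_commute)
    then show "r \<le> cmod (z - x0)" "cmod (z - x0) \<le> 2 * r" by auto
    show nz: "z \<noteq> x0" using a r by auto
    show "cmod ((x - x0) / (z - x0)) \<le> 1/2" 
      using frac_le[of "r/2" "cmod (x - x0)" r "cmod (z - x0)"] a r by (simp add: norm_divide)
    have "cmod (z - x0) \<le> cmod (z - x) + cmod (x - x0)" using norm_triangle_ineq[of "z - x" "x - x0"] by simp
    then show "r / 2 \<le> cmod (z - x)" using a by linarith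
    have "1 - (x - x0) / (z - x0) = (z - x) / (z - x0)" using nz by (simp add: field_simps)
    then show "cmod (1 - (x - x0) / (z - x0)) = cmod (z - x) / cmod (z - x0)" by (simp add: norm_divide)
  qed
  have [measurable]: "L x \<in> borel_measurable borel" for x
    unfolding L_def
  proof (intro borel_measurable_times borel_measurable_indicator measurable_compose[OF _ Ln_measurable])
    show "?An \<in> sets borel" by (intro sets.Diff borel_closed borel_open) auto
    show "(\<lambda>z. 1 - (x - x0) / (z - x0)) \<in> borel_measurable borel"
      by (intro borel_measurable_diff borel_measurable_divide borel_measurable_const measurable_ident[unfolded id_def])
  qed
  \<comment> \<open>On the annulus \<open>|z - x0|\<close> lies between r and 2r and
    \<open>|z - x|\<close> is at least r/2.\<close>
  define D where "D = cW * (5 + (\<bar>ln r\<bar> + \<bar>ln (2 * r)\<bar>)) + 2 * (cg / (r / 2))"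
  have D0: "0 \<le> D" unfolding D_def using c0 r by (intro add_nonneg_nonneg mult_nonneg_nonneg divide_nonneg_nonneg) auto
  have bound: "cmod (\<Phi> x z) \<le> D * \<bar>indicator ?C z * \<psi> z\<bar>" if x: "x \<in> ball x0 (r/2)" for x z
  proof (cases "z \<in> ?An")
    case True
    note An' = An[OF x True]
    have zC: "z \<in> ?C" using True by auto
    have l: "\<bar>ln (cmod (z - x0))\<bar> \<le> \<bar>ln r\<bar> + \<bar>ln (2 * r)\<bar>"
    proof -
      have "ln r \<le> ln (cmod (z - x0))" using An'(5,6) r by (subst ln_le_cancel_iff) linarith+
      moreover have "ln (cmod (z - x0)) \<le> ln (2 * r)" using An'(5,6) r by (subst ln_le_cancel_iff) linarith+
      ultimately show ?thesis by linarith
    qed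
    have 1: "cmod (L x z + of_real (ln (cmod (z - x0)))) \<le> 5 + (\<bar>ln r\<bar> + \<bar>ln (2 * r)\<bar>)"
    proof -
      have "cmod (L x z + of_real (ln (cmod (z - x0)))) \<le> cmod (L x z) + cmod (of_real (ln (cmod (z - x0))))" by (rule norm_triangle_ineq)
      also have "\<dots> \<le> 5 + (\<bar>ln r\<bar> + \<bar>ln (2 * r)\<bar>)"
        using cmod_Ln_near_one(1)[OF An'(1)] l True by (intro add_mono) (auto simp: L_def)
      finally show ?thesis .
    qed
    have 2: "cmod (g z / (z - x)) \<le> cg / (r / 2)" unfolding norm_divide using cg[OF zC] An'(2) r c0 by (intro frac_le) auto
    have 3: "cmod (of_real (W z) * (L x z + of_real (ln (cmod (z - x0))))) \<le> cW * (5 + (\<bar>ln r\<bar> + \<bar>ln (2 * r)\<bar>))"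
      unfolding norm_mult using cW[OF zC] 1 c0 by (intro mult_mono) auto
    have "cmod (of_real (W z) * (L x z + of_real (ln (cmod (z - x0)))) + 2 * (g z / (z - x))) \<le> D"
    proof -
      have "cmod (2 * (g z / (z - x))) = 2 * cmod (g z / (z - x))" by (rule trans[OF norm_mult]) simp
      also have "\<dots> \<le> 2 * (cg / (r / 2))" using 2 by (rule mult_left_mono) simp
      finally show ?thesis unfolding D_def by (rule order_trans[OF norm_triangle_ineq add_mono[OF 3]])
    qed
    then have "cmod (\<Phi> x z) \<le> \<bar>\<psi> z\<bar> * D" unfolding \<Phi>_def norm_mult norm_of_real by (intro mult_left_mono) auto
    then show ?thesis using zC by (simp add: mult.commute)
  qed (use out[of z] D0 in \<open>auto simp: \<Phi>_def\<close>)
  have psiC: "integrable lborel (\<lambda>z. D * \<bar>indicator ?C z * \<psi> z\<bar>)"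
    using loc[of ?C] by (simp add: set_integrable_def)
  have meas: "\<Phi> x \<in> borel_measurable lborel" if x: "x \<in> ball x0 (r/2)" for x
    unfolding \<Phi>_def using that by measurable
  have hol: "(\<lambda>x. \<Phi> x z) holomorphic_on ball x0 (r/2)" for z
  proof (cases "z \<in> ?An")
    case True
    then have "\<Phi> x z = of_real (\<psi> z) * (of_real (W z) * (Ln (1 - (x - x0) / (z - x0)) + of_real (ln (cmod (z - x0)))) + 2 * (g z / (z - x)))" for x
      by (simp add: \<Phi>_def L_def)
    moreover have "(\<lambda>x. of_real (\<psi> z) * (of_real (W z) * (Ln (1 - (x - x0) / (z - x0)) + of_real (ln (cmod (z - x0)))) + 2 * (g z / (z - x)))) holomorphic_on ball x0 (r/2)"
    proof (intro holomorphic_intros)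
      fix x assume x: "x \<in> ball x0 (r/2)"
      show "z - x0 \<noteq> 0" using An(3)[OF x True] by simp
      show "z - x \<noteq> 0" using An(2)[OF x True] r by auto
      show "1 - (x - x0) / (z - x0) \<notin> \<real>\<^sub>\<le>\<^sub>0" using cmod_Ln_near_one(2)[OF An(1)[OF x True]] .
    qed
    ultimately show ?thesis by simp
  qed (use out[of z] in \<open>auto simp: \<Phi>_def\<close>)
  have Ahol: "A holomorphic_on ball x0 (r/2)"
    unfolding A_def by (intro holomorphic_intros holomorphic_on_integral[OF _ meas hol bound psiC]) auto
  have ReA: "Re (A x) = - (\<integral>z. \<psi> z * (W z * ln (cmod (z - x)) + 2 * ((g z \<bullet> (z - x)) / (cmod (z - x))\<^sup>2)) \<partial>lborel)"
    if x: "x \<in> ball x0 (r/2)" for x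
  proof -
    have i: "integrable lborel (\<Phi> x)"
      by (rule Bochner_Integration.integrable_bound[OF psiC meas[OF x]]) (use bound[OF x] in \<open>auto intro: order_trans[OF _ abs_ge_self]\<close>)
    have "Re (\<Phi> x z) = \<psi> z * (W z * ln (cmod (z - x)) + 2 * ((g z \<bullet> (z - x)) / (cmod (z - x))\<^sup>2))" for z
    proof (cases "z \<in> ?An")
      case True
      note An' = An[OF x True]
      have "Re (L x z) = ln (cmod (z - x)) - ln (cmod (z - x0))"
      proof -
        have "z \<noteq> x" using An'(2) r by auto
        then show ?thesis using True cmod_Ln_near_one(3)[OF An'(1)] An'(3,4) by (simp add: L_def ln_div)
      qed
      then have "Re (L x z + of_real (ln (cmod (z - x0)))) = ln (cmod (z - x))" by simp
      moreover have "Re (2 * (g z / (z - x))) = 2 * ((g z \<bullet> (z - x)) / (cmod (z - x))\<^sup>2)"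
        unfolding Re_divide_inner[symmetric] by (simp del: times_divide_eq_right)
      ultimately show ?thesis unfolding \<Phi>_def by (simp only: Re_complex_of_real Im_complex_of_real times_complex.sel plus_complex.sel mult_zero_left diff_zero)
    qed (use out[of z] in \<open>auto simp: \<Phi>_def\<close>)
    then show ?thesis using integral_Re[OF i] by (simp add: A_def)
  qed
  have "AE x in lborel. x \<in> ball x0 (r/2) \<longrightarrow> integrable lborel (\<lambda>z. F z * cutoff x0 r z * ln (cmod (z - x))) \<and>
     kern_mass * \<psi> x = Re (A x) - (\<integral>z. F z * cutoff x0 r z * ln (cmod (z - x)) \<partial>lborel)"
  proof (rule eventually_mono[OF weak_representation[OF psi loc F weak r, of x0]])
    fix x
    assume a: "integrable lborel (\<lambda>z. F z * cutoff x0 r z * ln (cmod (z - x))) \<and>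
         kern_mass * (\<psi> x * cutoff x0 r x) = - (\<integral>z. F z * cutoff x0 r z * ln (cmod (z - x)) \<partial>lborel) -
         (\<integral>z. \<psi> z * (laplacian (cutoff x0 r) z * ln (cmod (z - x)) + 2 * (grad (cutoff x0 r) z \<bullet> (z - x) / (cmod (z - x))\<^sup>2)) \<partial>lborel)"
    show "x \<in> ball x0 (r/2) \<longrightarrow> integrable lborel (\<lambda>z. F z * cutoff x0 r z * ln (cmod (z - x))) \<and>
     kern_mass * \<psi> x = Re (A x) - (\<integral>z. F z * cutoff x0 r z * ln (cmod (z - x)) \<partial>lborel)"
    proof
      assume x: "x \<in> ball x0 (r/2)"
      then have "cutoff x0 r x = 1" using r by (intro cutoff_bounds(3)) (auto simp: dist_norm norm_minus_commute)
      then show "integrable lborel (\<lambda>z. F z * cutoff x0 r z * ln (cmod (z - x))) \<and>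
         kern_mass * \<psi> x = Re (A x) - (\<integral>z. F z * cutoff x0 r z * ln (cmod (z - x)) \<partial>lborel)"
        using a ReA[OF x] by (simp add: W_def g_def)
    qed
  qed
  with Ahol show ?thesis using that by blast
qed

end

section \<open>A bound for holomorphic functions by area integrals\<close>

lemma cutoff_translate: "cutoff x0 r z = cutoff 0 r (z - x0)" by (simp add: cutoff_def)

lemma cutoff_has_derivative:
  assumes "r > 0"
  shows "(cutoff x0 r has_derivative (\<lambda>v. v \<bullet> grad (cutoff x0 r) z)) (at z)"
proof -
  have d: "(cutoff x0 r has_derivative frechet_derivative (cutoff x0 r) (at z)) (at z)"
    using Ck_SucE[OF Ck_cutoff[OF assms, where k="Suc 0"]] by blast
  interpret bounded_linear "frechet_derivative (cutoff x0 r) (at z)" using d has_derivative_bounded_linear by blast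
  have "frechet_derivative (cutoff x0 r) (at z) v = v \<bullet> grad (cutoff x0 r) z" for v
  proof -
    have "v = Re v *\<^sub>R 1 + Im v *\<^sub>R \<i>" by (simp add: complex_eq_iff)
    then have "frechet_derivative (cutoff x0 r) (at z) v = Re v * frechet_derivative (cutoff x0 r) (at z) 1 + Im v * frechet_derivative (cutoff x0 r) (at z) \<i>"
      by (metis add scaleR real_scaleR_def)
    then show ?thesis by (simp add: grad_def inner_complex_def)
  qed
  then have "frechet_derivative (cutoff x0 r) (at z) = (\<lambda>v. v \<bullet> grad (cutoff x0 r) z)" by auto
  with d show ?thesis by simp
qed

text \<open>Makes the gradient bound for the cut-off the same for all centres, hence the later
  estimates uniform over the plane.\<close>

lemma grad_cutoff_translate:
  assumes "r > 0" shows "grad (cutoff x0 r) z = grad (cutoff 0 r) (z - x0)"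
proof -
  have "((\<lambda>z. cutoff 0 r (z - x0)) has_derivative (\<lambda>v. v \<bullet> grad (cutoff 0 r) (z - x0))) (at z)"
    by (rule has_derivative_compose[where f="\<lambda>z. z - x0" and g="cutoff 0 r", OF _ cutoff_has_derivative[OF assms]])
       (auto intro!: derivative_eq_intros)
  then have "(cutoff x0 r has_derivative (\<lambda>v. v \<bullet> grad (cutoff 0 r) (z - x0))) (at z)"
    by (simp add: cutoff_translate[of x0 r, abs_def])
  from has_derivative_unique[OF this cutoff_has_derivative[OF assms]]
  have "v \<bullet> grad (cutoff 0 r) (z - x0) = v \<bullet> grad (cutoff x0 r) z" for v by metis
  then show ?thesis by (metis inner_commute vector_eq_ldot)
qed

lemma wirtinger_cutoff:
  assumes "r > 0"
  shows "wirtinger (\<lambda>z. of_real (cutoff x0 r z)) (cnj (grad (cutoff x0 r) z) / 2) (grad (cutoff x0 r) z / 2) z"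
proof -
  have "((\<lambda>z. complex_of_real (cutoff x0 r z)) has_derivative (\<lambda>v. of_real (v \<bullet> grad (cutoff x0 r) z))) (at z)"
    by (rule bounded_linear.has_derivative[OF bounded_linear_of_real cutoff_has_derivative[OF assms]])
  moreover have "complex_of_real (v \<bullet> g) = v * (cnj g / 2) + cnj v * (g / 2)" for v g
    by (simp add: complex_eq_iff inner_complex_def add_divide_distrib diff_divide_distrib)
  ultimately show ?thesis by (simp add: wirtinger_def)
qed

text \<open>The function lives on the ball of radius 3\<rho> and vanishes beyond 2\<rho>; the open
  overlap between the two radii lets the extension by zero be glued.\<close>

lemma continuous_on_extend_zero:
  fixes h :: "complex \<Rightarrow> complex"
  assumes c: "continuous_on (ball x0 (3 * \<rho>)) h" and z: "\<And>z. 2 * \<rho> < cmod (z - x0) \<Longrightarrow> h z = 0" and \<rho>: "\<rho> > 0"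
  shows "continuous_on UNIV (\<lambda>z. if z \<in> ball x0 (3 * \<rho>) then h z else 0)" (is "continuous_on UNIV ?h")
    "integrable lborel (\<lambda>z. if z \<in> ball x0 (3 * \<rho>) then h z else 0)"
    "\<exists>c. \<forall>z. cmod (if z \<in> ball x0 (3 * \<rho>) then h z else 0) \<le> c"
proof -
  have 1: "continuous_on (ball x0 (3 * \<rho>)) ?h" by (rule continuous_on_eq[OF c]) simp
  have 2: "continuous_on (- cball x0 (2 * \<rho>)) ?h"
    by (rule continuous_on_eq[of _ "\<lambda>_. 0"]) (use z in \<open>auto simp: dist_norm norm_minus_commute\<close>)
  have "ball x0 (3 * \<rho>) \<union> - cball x0 (2 * \<rho>) = UNIV" using \<rho> by auto
  then show c: "continuous_on UNIV ?h"
    using continuous_on_open_Un[OF open_ball open_Compl[OF closed_cball] 1 2] by simp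
  let ?C = "cball x0 (2 * \<rho>)"
  have eq: "indicator ?C z *\<^sub>R ?h z = ?h z" for z
    using z[of z] by (auto simp: indicator_def dist_norm norm_minus_commute)
  have "integrable lborel (\<lambda>z. indicator ?C z *\<^sub>R ?h z)"
    by (rule borel_integrable_compact) (use continuous_on_subset[OF c] in auto)
  then show "integrable lborel ?h" unfolding eq .
  obtain b where b: "\<And>z. z \<in> ?C \<Longrightarrow> cmod (?h z) \<le> b"
    using compact_imp_bounded[OF compact_continuous_image[OF continuous_on_subset[OF c subset_UNIV] compact_cball]]
    unfolding bounded_iff by blast
  have "cmod (?h z) \<le> \<bar>b\<bar>" for z
    using b[of z] eq[of z] by (cases "z \<in> ?C") auto
  then show "\<exists>c. \<forall>z. cmod (?h z) \<le> c" by blast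
qed

text \<open>Cauchy--Pompeiu for \<open>f\<close> times a cut-off, evaluated at the centre: the
  derivative with respect to \<open>cnj z\<close> is \<open>f\<close> times half the gradient of the
  cut-off and vanishes within distance \<rho> of the centre, so the Cauchy kernel is at most
  \<open>1/\<rho>\<close> there. The constant serves all \<open>x0\<close>, \<open>f\<close> and
  \<open>g\<close>.\<close>

lemma holomorphic_bound_by_integral:
  assumes \<rho>: "\<rho> > 0"
  shows "\<exists>C>0. \<forall>x0 f g. f holomorphic_on ball x0 (3 * \<rho>) \<longrightarrow> integrable lborel g \<longrightarrow> (\<forall>z. 0 \<le> g z) \<longrightarrow>
    (AE z in lborel. z \<in> ball x0 (3 * \<rho>) \<longrightarrow> cmod (f z) \<le> g z) \<longrightarrow> cmod (f x0) \<le> C * (\<integral>z. g z \<partial>lborel)"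
proof -
  have cg: "continuous_on UNIV (grad (cutoff 0 \<rho>))" by (rule cutoff_continuous[OF \<rho>])
  obtain G where G: "\<And>z. z \<in> cball 0 (2 * \<rho>) \<Longrightarrow> cmod (grad (cutoff 0 \<rho>) z) \<le> G"
    using compact_imp_bounded[OF compact_continuous_image[OF continuous_on_subset[OF cg subset_UNIV] compact_cball]]
    unfolding bounded_iff by blast
  define M where "M = \<bar>G\<bar> + 1"
  have gM: "cmod (grad (cutoff x0 \<rho>) z) \<le> M" for x0 z
  proof -
    have "cmod (grad (cutoff 0 \<rho>) (z - x0)) \<le> M"
      using G[of "z - x0"] cutoff_locally_const(1)[OF \<rho>, of "z - x0" 0] by (cases "z - x0 \<in> cball 0 (2 * \<rho>)") (auto simp: M_def)
    then show ?thesis using grad_cutoff_translate[OF \<rho>] by simp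
  qed
  \<comment> \<open>The first factor inverts the constant of the Cauchy--Pompeiu formula, the second
    bounds half the gradient times the Cauchy kernel.\<close>
  define C where "C = (2 / kern_mass) * (M / (2 * \<rho>))"
  have C: "C > 0" unfolding C_def M_def using kern_mass_pos \<rho> by (intro mult_pos_pos divide_pos_pos) auto
  have main: "cmod (f x0) \<le> C * (\<integral>z. g z \<partial>lborel)"
    if f: "f holomorphic_on ball x0 (3 * \<rho>)" and g: "integrable lborel g" "\<And>z. 0 \<le> g z"
    and fg: "AE z in lborel. z \<in> ball x0 (3 * \<rho>) \<longrightarrow> cmod (f z) \<le> g z" for x0 f g
  proof -
    let ?U = "ball x0 (3 * \<rho>)"
    let ?g = "grad (cutoff x0 \<rho>)"
    define h where "h z = f z * of_real (cutoff x0 \<rho> z)" for z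
    define a where "a z = deriv f z * of_real (cutoff x0 \<rho> z) + f z * (cnj (?g z) / 2)" for z
    define b where "b z = f z * (?g z / 2)" for z
    have cc: "continuous_on S (cutoff x0 \<rho>)" "continuous_on S ?g" for S using cutoff_continuous[OF \<rho>] by auto
    have cf: "continuous_on ?U f" "continuous_on ?U (deriv f)"
      using f by (auto intro!: holomorphic_on_imp_continuous_on holomorphic_deriv)
    have ch: "continuous_on ?U h" and ca: "continuous_on ?U a" and cb: "continuous_on ?U b"
      unfolding h_def a_def b_def by (intro continuous_intros cf cc; simp)+
    have zero: "h z = 0" "a z = 0" "b z = 0" if "2 * \<rho> < cmod (z - x0)" for z
      using cutoff_bounds(4)[OF \<rho>, of z x0] cutoff_locally_const(1)[OF \<rho>, of z x0] that by (auto simp: h_def a_def b_def)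
    let ?e = "\<lambda>k z. if z \<in> ?U then k z else (0::complex)"
    note eh = continuous_on_extend_zero[OF ch zero(1) \<rho>]
    note ea = continuous_on_extend_zero[OF ca zero(2) \<rho>]
    note eb = continuous_on_extend_zero[OF cb zero(3) \<rho>]
    obtain c1 where c1: "\<And>z. cmod (?e h z) \<le> c1" using eh(3) by blast
    obtain c2 where c2: "\<And>z. cmod (?e b z) \<le> c2" using eb(3) by blast
    have w: "wirtinger (?e h) (?e a z) (?e b z) z" for z
    proof (cases "z \<in> ?U")
      case True
      have "wirtinger f (deriv f z) 0 z"
        unfolding wirtinger_field_derivative using f True holomorphic_derivI open_ball by blast
      from wirtinger_mult[OF this wirtinger_cutoff[OF \<rho>]]
      have "wirtinger h (a z) (b z) z" by (simp add: h_def[abs_def] a_def b_def)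
      then have "wirtinger (?e h) (a z) (b z) z"
        unfolding wirtinger_def by (rule has_derivative_transform_within_open[of _ _ _ _ ?U]) (use True in auto)
      then show ?thesis using True by simp
    next
      case False
      then have o: "2 * \<rho> < cmod (z - x0)" using \<rho> by (auto simp: dist_norm norm_minus_commute)
      have "((\<lambda>z. 0) has_derivative (\<lambda>v. 0)) (at z)" by simp
      then have "(?e h has_derivative (\<lambda>v. 0)) (at z)"
        by (rule has_derivative_transform_within_open[of _ _ _ _ "- cball x0 (2 * \<rho>)"])
           (use o zero(1) in \<open>auto simp: dist_norm norm_minus_commute\<close>)
      then show ?thesis using False by (simp add: wirtinger_def)
    qed
    have cp: "cauchy_transform (?e b) x0 = of_real (kern_mass / 2) * ?e h x0"
      by (rule cauchy_pompeiu[OF w ea(1) eb(1) eh(2) ea(2) eb(2) order_trans[OF c1 max.cobounded1] order_trans[OF c2 max.cobounded2]])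
    have hx: "?e h x0 = f x0" using \<rho> cutoff_bounds(3)[OF \<rho>, of x0 x0] by (simp add: h_def)
    have "cmod (cauchy_transform (?e b) x0) \<le> (\<integral>z. (M / (2 * \<rho>)) * g z \<partial>lborel)"
    proof -
      have "cmod (cauchy_transform (?e b) x0) \<le> (\<integral>z. norm (?e b z / (x0 - z)) \<partial>lborel)" unfolding cauchy_transform_def by (rule integral_norm_bound)
      also have "\<dots> \<le> (\<integral>z. (M / (2 * \<rho>)) * g z \<partial>lborel)"
      proof (rule integral_mono_AE)
        show "integrable lborel (\<lambda>z. norm (?e b z / (x0 - z)))"
          using cauchy_transform_integrable(1)[OF eb(2) c2, of x0] by (simp add: norm_divide)
        show "integrable lborel (\<lambda>z. (M / (2 * \<rho>)) * g z)" using g by simp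
        show "AE z in lborel. norm (?e b z / (x0 - z)) \<le> (M / (2 * \<rho>)) * g z"
          using fg
        proof eventually_elim
          fix z assume z: "z \<in> ?U \<longrightarrow> cmod (f z) \<le> g z"
          have M0: "0 \<le> M / (2 * \<rho>)" using \<rho> by (simp add: M_def)
          show "norm (?e b z / (x0 - z)) \<le> (M / (2 * \<rho>)) * g z"
          proof (cases "z \<in> ?U \<and> \<rho> \<le> cmod (z - x0)")
            case True
            have "norm (b z / (x0 - z)) = cmod (f z) * (cmod (?g z) / (2 * cmod (z - x0)))"
              unfolding b_def norm_divide norm_mult by (simp add: norm_minus_commute)
            also have "\<dots> \<le> g z * (M / (2 * \<rho>))"
              using True z gM[of x0 z] order_trans[OF norm_ge_zero gM] \<rho> g(2)[of z] by (intro mult_mono frac_le) auto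
            finally show ?thesis using True by (simp add: mult.commute)
          next
            case False
            then have "?e b z = 0" using cutoff_locally_const(1)[OF \<rho>, of z x0] by (auto simp: b_def)
            then show ?thesis using mult_nonneg_nonneg[OF M0 g(2)[of z]] by simp
          qed
        qed
      qed
      finally show ?thesis .
    qed
    then have "(kern_mass / 2) * cmod (f x0) \<le> (M / (2 * \<rho>)) * (\<integral>z. g z \<partial>lborel)"
      unfolding cp hx using kern_mass_pos by (simp add: norm_mult)
    then have "(2 / kern_mass) * ((kern_mass / 2) * cmod (f x0)) \<le> (2 / kern_mass) * ((M / (2 * \<rho>)) * (\<integral>z. g z \<partial>lborel))"
      using kern_mass_pos by (intro mult_left_mono) auto
    then show ?thesis unfolding C_def using kern_mass_pos by (simp add: mult.assoc)
  qed
  show ?thesis using C main by blast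
qed

section \<open>Global boundedness of the right-hand side\<close>

text \<open>Since \<open>ln t = 2 ln (sqrt t)\<close>, the elementary bound for the logarithm can be
  squared; with t a distance in the plane, \<open>4 / t\<close> is locally integrable.\<close>

lemma ln_square_bound:
  assumes "0 < t" "t \<le> (1::real)" shows "(ln t)\<^sup>2 \<le> 4 / t"
proof -
  have "ln (1 / sqrt t) \<le> 1 / sqrt t - 1" using assms by (intro ln_le_minus_one) auto
  then have "- ln t / 2 \<le> 1 / sqrt t" using assms by (simp add: ln_div ln_sqrt)
  moreover have "0 \<le> - ln t / 2" using assms by simp
  ultimately have "(- ln t / 2)\<^sup>2 \<le> (1 / sqrt t)\<^sup>2" by (intro power_mono) auto
  then show ?thesis using assms by (simp add: power_divide field_simps)
qed

lemma neg_ln_bound: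
  assumes "0 < t" shows "- ln t \<le> (1::real) / t"
  using ln_le_minus_one[of "1/t"] assms by (simp add: ln_div)

abbreviation inv_norm_ball :: "complex \<Rightarrow> real" where "inv_norm_ball z \<equiv> indicator (ball 0 1) z * (1 / cmod z)"

lemma inv_norm_ball_translate:
  "integrable lborel (\<lambda>x. inv_norm_ball (z - x))" "(\<integral>x. inv_norm_ball (z - x) \<partial>lborel) = inv_norm_mass"
  using integrable_translate(4)[OF integrable_inverse_norm_ball, of z]
    integral_translate(4)[OF integrable_inverse_norm_ball, of z] by (auto simp: inv_norm_mass_def)

lemma inv_norm_ball_measurable[measurable]: "inv_norm_ball \<in> borel_measurable borel"
  using integrable_inverse_norm_ball by (auto dest: borel_measurable_integrable simp del: mult_indicator_cong)

lemma inv_norm_ball_convolution: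
  assumes m: "integrable lborel m" and m0: "\<And>z. 0 \<le> m z"
  shows "integrable lborel (\<lambda>x. \<integral>z. m z * inv_norm_ball (z - x) \<partial>lborel)"
    "(\<integral>x. (\<integral>z. m z * inv_norm_ball (z - x) \<partial>lborel) \<partial>lborel) = inv_norm_mass * (\<integral>z. m z \<partial>lborel)"
    "AE x in lborel. integrable lborel (\<lambda>z. m z * inv_norm_ball (z - x))"
proof -
  have [measurable]: "m \<in> borel_measurable borel" using m by auto
  have eq: "(\<integral>x. m z * inv_norm_ball (z - x) \<partial>lborel) = m z * inv_norm_mass" for z
    by (simp only: integral_mult_right_zero inv_norm_ball_translate)
  have i: "integrable (lborel \<Otimes>\<^sub>M lborel) (\<lambda>(z, x). m z * inv_norm_ball (z - x))"
  proof (rule lborel_pair.Fubini_integrable)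
    show "(\<lambda>(z, x). m z * inv_norm_ball (z - x)) \<in> borel_measurable (lborel \<Otimes>\<^sub>M lborel)" by measurable
    show "AE z in lborel. integrable lborel (\<lambda>x. case (z, x) of (z, x) \<Rightarrow> m z * inv_norm_ball (z - x))"
      unfolding prod.case by (intro AE_I2 integrable_mult_right inv_norm_ball_translate)
    have "norm (m z * inv_norm_ball (z - x)) = m z * inv_norm_ball (z - x)" for z x using m0[of z] by (simp add: abs_mult)
    then have "(\<integral>x. norm (case (z, x) of (z, x) \<Rightarrow> m z * inv_norm_ball (z - x)) \<partial>lborel) = m z * inv_norm_mass" for z
      unfolding prod.case by (simp only: eq)
    then show "integrable lborel (\<lambda>z. \<integral>x. norm (case (z, x) of (z, x) \<Rightarrow> m z * inv_norm_ball (z - x)) \<partial>lborel)"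
      using m by simp
  qed
  have i': "integrable (lborel \<Otimes>\<^sub>M lborel) (\<lambda>(x, z). m z * inv_norm_ball (z - x))"
    using lborel_pair.integrable_product_swap[OF i] by simp
  show "integrable lborel (\<lambda>x. \<integral>z. m z * inv_norm_ball (z - x) \<partial>lborel)"
    using lborel_pair.integrable_fst'[OF i'] by simp
  show "AE x in lborel. integrable lborel (\<lambda>z. m z * inv_norm_ball (z - x))"
    using lborel_pair.AE_integrable_fst'[OF i'] by simp
  have "(\<integral>x. (\<integral>z. m z * inv_norm_ball (z - x) \<partial>lborel) \<partial>lborel) = (\<integral>z. (\<integral>x. m z * inv_norm_ball (z - x) \<partial>lborel) \<partial>lborel)"
    using lborel_pair.Fubini_integral[OF i] by simp
  also have "\<dots> = inv_norm_mass * (\<integral>z. m z \<partial>lborel)" unfolding eq by simp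
  finally show "(\<integral>x. (\<integral>z. m z * inv_norm_ball (z - x) \<partial>lborel) \<partial>lborel) = inv_norm_mass * (\<integral>z. m z \<partial>lborel)" .
qed

text \<open>Jensen's inequality for a density \<open>w\<close> of total mass at most 1; the missing mass accounts for the
  summand 1.\<close>

lemma exp_integral_le:
  fixes w t :: "'a \<Rightarrow> real"
  assumes w: "integrable M w" and w0: "\<And>z. 0 \<le> w z" and w1: "(\<integral>z. w z \<partial>M) \<le> 1"
    and wt: "integrable M (\<lambda>z. w z * t z)" and we: "integrable M h"
    and h: "AE z in M. w z * exp (t z) \<le> h z"
  shows "exp (\<integral>z. w z * t z \<partial>M) \<le> 1 + (\<integral>z. h z \<partial>M)"
proof -
  define m where "m = (\<integral>z. w z * t z \<partial>M)"
  define \<nu> where "\<nu> = (\<integral>z. w z \<partial>M)"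
  have eq: "(\<integral>z. exp m * ((1 - m) * w z + w z * t z) \<partial>M) = exp m * ((1 - m) * \<nu> + m)"
    using w wt by (simp add: m_def \<nu>_def)
  have "exp m * ((1 - m) * \<nu> + m) \<le> (\<integral>z. h z \<partial>M)"
    unfolding eq[symmetric]
  proof (rule integral_mono_AE)
    show "integrable M (\<lambda>z. exp m * ((1 - m) * w z + w z * t z))" using w wt by simp
    show "integrable M h" by (rule we)
    show "AE z in M. exp m * ((1 - m) * w z + w z * t z) \<le> h z"
      using h
    proof eventually_elim
      fix z assume hz: "w z * exp (t z) \<le> h z"
      \<comment> \<open>The tangent of the exponential at m, the integral that appears in the
        conclusion.\<close>
      have "1 + (t z - m) \<le> exp (t z - m)" by (rule exp_ge_add_one_self)
      then have "exp m * (1 + (t z - m)) \<le> exp m * exp (t z - m)" by simp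
      also have "\<dots> = exp (t z)" by (simp flip: exp_add)
      finally have "w z * (exp m * (1 + (t z - m))) \<le> w z * exp (t z)" using w0 by (intro mult_left_mono) auto
      then show "exp m * ((1 - m) * w z + w z * t z) \<le> h z" using hz by (simp add: algebra_simps)
    qed
  qed
  \<comment> \<open>The missing mass \<open>1 - \<nu>\<close> costs
    \<open>exp m * (1 - m) * (1 - \<nu>)\<close>, and \<open>exp m * (1 - m) \<le> 1\<close> for
    every m.\<close>
  moreover have "exp m \<le> exp m * ((1 - m) * \<nu> + m) + 1"
  proof -
    have n: "0 \<le> \<nu>" "\<nu> \<le> 1" unfolding \<nu>_def using w1 by (auto intro!: Bochner_Integration.integral_nonneg w0)
    have "1 - m \<le> exp (- m)" using exp_ge_add_one_self[of "- m"] by simp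
    then have "exp m * (1 - m) \<le> exp m * exp (- m)" by simp
    then have "exp m * (1 - m) \<le> 1" by (simp add: exp_minus)
    then have "(exp m * (1 - m)) * (1 - \<nu>) \<le> 1 * (1 - \<nu>)" using n by (intro mult_right_mono) auto
    then show ?thesis using n by (simp add: algebra_simps)
  qed
  ultimately show ?thesis by (simp add: m_def)
qed

text \<open>Splits a density into a part bounded by N and an excess of arbitrarily small mass; only
  the excess has to be treated by the exponential estimate.\<close>

lemma small_tail:
  fixes F :: "'a \<Rightarrow> real"
  assumes F: "integrable M F" and e: "e > 0"
  obtains N :: real where "N \<ge> 0" "(\<integral>z. max 0 (F z - N) \<partial>M) \<le> e"
proof -
  have "(\<lambda>n. \<integral>z. max 0 (F z - real n) \<partial>M) \<longlonglongrightarrow> (\<integral>z. 0 \<partial>M)"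
  proof (rule integral_dominated_convergence[where w="\<lambda>z. \<bar>F z\<bar>"])
    show "AE z in M. (\<lambda>n. max 0 (F z - real n)) \<longlonglongrightarrow> 0"
    proof (intro AE_I2 tendsto_eventually)
      fix z
      obtain k :: nat where "F z \<le> real k" using real_arch_simple by blast
      then show "\<forall>\<^sub>F n in sequentially. max 0 (F z - real n) = 0"
        by (intro eventually_sequentiallyI[of k]) auto
    qed
  qed (use F in auto)
  then have "(\<lambda>n. \<integral>z. max 0 (F z - real n) \<partial>M) \<longlonglongrightarrow> 0" by simp
  from order_tendstoD(2)[OF this e] obtain n where "(\<integral>z. max 0 (F z - real n) \<partial>M) < e"
    by (auto simp: eventually_sequentially)
  then show ?thesis using that[of "real n"] by auto
qed

locale liouville_solution = weak_solution \<psi> "\<lambda>z. K * cmod (z - z0) ^ (2 * n) * exp (\<psi> z)"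
  for \<psi> :: "complex \<Rightarrow> real" and K :: real and z0 :: complex and n :: nat +
  assumes K: "K > 0"
begin

abbreviation F where "F \<equiv> \<lambda>z. K * cmod (z - z0) ^ (2 * n) * exp (\<psi> z)"

lemma F_nonneg: "0 \<le> F z" using K by simp

text \<open>On small balls \<open>F = |f| e^p\<close> with f holomorphic and
  \<open>p \<ge> 0\<close> a potential of \<open>F\<close>. Hence \<open>|f| \<le> F\<close>, and
  the area estimate bounds f by the mass. Jensen's inequality then bounds the integral of
  \<open>F^2\<close>, and with this p is bounded. No constant depends on the centre
  \<open>x0\<close>, so the local bounds combine into one.\<close>

lemma AE_bounded:
  obtains C where "AE z in lborel. F z \<le> C"
proof -
  \<comment> \<open>For x within r/2 of the centre and z in the support of the cut-off,
    \<open>|z - x| < 2r + r/2 = 5/8 < 1\<close>, so all logarithms in the potential are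
    nonpositive.\<close>
  define r :: real where "r = 1/4"
  have r: "r > 0" by (simp add: r_def)
  have kp: "kern_mass > 0" by (rule kern_mass_pos)
  \<comment> \<open>The threshold at which \<open>2 / kern_mass\<close> times the excess has mass at
    most 1. The 2 is there because \<open>exp (2 p)\<close> is to be integrated, and then Jensen's
    inequality leads to the integrable kernel \<open>1/|z - x|\<close>.\<close>
  obtain N where N: "N \<ge> 0" "(\<integral>z. max 0 (F z - N) \<partial>lborel) \<le> kern_mass / 2"
    using small_tail[OF F, of "kern_mass / 2"] kp by auto
  \<comment> \<open>Three times this radius is r/4: around a point of \<open>ball x0 (r/4)\<close>
    such a ball stays in \<open>ball x0 (r/2)\<close>.\<close>
  have "0 < r / 12" using r by simp
  from holomorphic_bound_by_integral[OF this]
  obtain C1 where C1: "C1 > 0" "\<forall>x0 f g. f holomorphic_on ball x0 (3 * (r / 12)) \<longrightarrow> integrable lborel g \<longrightarrow> (\<forall>z. 0 \<le> g z) \<longrightarrow>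
    (AE z in lborel. z \<in> ball x0 (3 * (r / 12)) \<longrightarrow> cmod (f z) \<le> g z) \<longrightarrow> cmod (f x0) \<le> C1 * (\<integral>z. g z \<partial>lborel)"
    by blast
  define mass where "mass = (\<integral>z. F z \<partial>lborel)"
  have mass: "mass \<ge> 0" unfolding mass_def by (intro Bochner_Integration.integral_nonneg F_nonneg)
  define B where "B = C1 * mass"
  have B: "B \<ge> 0" unfolding B_def using C1 mass by simp
  define B1 where "B1 = B * exp (N * inv_norm_mass / kern_mass)"
  \<comment> \<open>One \<open>inv_norm_mass\<close> bounds the integral of \<open>Q\<close>, the
    other stands for the constant 1, which is at most \<open>1/|x0 - z|\<close> on the ball.\<close>
  define Q2 where "Q2 = B1\<^sup>2 * (2 * inv_norm_mass)"
  define C where "C = B * exp ((1 / kern_mass) * (Q2 + 4 * inv_norm_mass + (8 / r) * mass))"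
  have local: "AE x in lborel. x \<in> ball x0 (r / 8) \<longrightarrow> F x \<le> C" for x0
  proof -
    define ch where "ch = cutoff x0 r"
    have ch: "0 \<le> ch z" "ch z \<le> 1" "2 * r \<le> cmod (z - x0) \<Longrightarrow> ch z = 0" for z
      unfolding ch_def using cutoff_bounds[OF r] by auto
    have "continuous_on UNIV ch" unfolding ch_def by (rule cutoff_continuous[OF r])
    then have [measurable]: "ch \<in> borel_measurable borel" by (rule borel_measurable_continuous_onI)
    obtain A where A: "A holomorphic_on ball x0 (r/2)"
      and rep: "AE x in lborel. x \<in> ball x0 (r/2) \<longrightarrow> integrable lborel (\<lambda>z. F z * ch z * ln (cmod (z - x))) \<and>
         kern_mass * \<psi> x = Re (A x) - (\<integral>z. F z * ch z * ln (cmod (z - x)) \<partial>lborel)"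
      using local_representation[OF r, of x0] unfolding ch_def by blast
    define p where "p x = - (1 / kern_mass) * (\<integral>z. F z * ch z * ln (cmod (z - x)) \<partial>lborel)" for x
    \<comment> \<open>The weight is the modulus of a power, so it joins the harmonic part of the
      solution in one holomorphic function; the zero at \<open>z0\<close> does no harm.\<close>
    define f where "f x = of_real K * (x - z0) ^ (2 * n) * exp (A x / of_real kern_mass)" for x
    have f: "f holomorphic_on ball x0 (r/2)" unfolding f_def using A kp by (intro holomorphic_intros) auto
    have near: "cmod (z - x) < 1" if "x \<in> ball x0 (r/2)" "ch z \<noteq> 0" for x z
    proof -
      have "cmod (z - x0) < 2 * r" using ch(3)[of z] that(2) by force
      moreover have "cmod (z - x) \<le> cmod (z - x0) + cmod (x - x0)" using norm_triangle_ineq4[of "z - x0" "x - x0"] by simp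
      ultimately show ?thesis using that(1) by (simp add: r_def dist_norm norm_minus_commute)
    qed
    have rep': "AE x in lborel. x \<in> ball x0 (r/2) \<longrightarrow> integrable lborel (\<lambda>z. F z * ch z * ln (cmod (z - x))) \<and> F x = cmod (f x) * exp (p x) \<and> 0 \<le> p x"
      using rep
    proof eventually_elim
      fix x
      assume a: "x \<in> ball x0 (r/2) \<longrightarrow> integrable lborel (\<lambda>z. F z * ch z * ln (cmod (z - x))) \<and>
         kern_mass * \<psi> x = Re (A x) - (\<integral>z. F z * ch z * ln (cmod (z - x)) \<partial>lborel)"
      show "x \<in> ball x0 (r/2) \<longrightarrow> integrable lborel (\<lambda>z. F z * ch z * ln (cmod (z - x))) \<and> F x = cmod (f x) * exp (p x) \<and> 0 \<le> p x"
      proof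
        assume x: "x \<in> ball x0 (r/2)"
        have "\<psi> x = Re (A x) / kern_mass + p x" using a x kp by (simp add: p_def field_simps)
        then have "exp (\<psi> x) = exp (Re (A x / of_real kern_mass)) * exp (p x)" by (simp add: exp_add)
        then have 1: "F x = cmod (f x) * exp (p x)"
          using K by (simp add: f_def norm_mult norm_power norm_exp_eq_Re)
        have "F z * ch z * ln (cmod (z - x)) \<le> 0" for z
        proof (cases "ch z = 0")
          case False
          then have "ln (cmod (z - x)) \<le> 0" using near[OF x False] by (cases "z = x") auto
          then show ?thesis by (intro mult_nonneg_nonpos[OF mult_nonneg_nonneg[OF F_nonneg ch(1)]])
        qed simp
        then have "(\<integral>z. F z * ch z * ln (cmod (z - x)) \<partial>lborel) \<le> integral\<^sup>L lborel (\<lambda>z::complex. 0::real)"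
          using a x by (intro integral_mono) auto
        then have "0 \<le> p x" unfolding p_def using kp by (simp add: divide_nonpos_pos)
        with 1 a x show "integrable lborel (\<lambda>z. F z * ch z * ln (cmod (z - x))) \<and> F x = cmod (f x) * exp (p x) \<and> 0 \<le> p x" by blast
      qed
    qed
    have fB: "cmod (f y) \<le> B" if y: "y \<in> ball x0 (r / 4)" for y
    proof -
      have sub: "ball y (3 * (r / 12)) \<subseteq> ball x0 (r / 2)"
        using y r by (intro ball_subset_ball_iff[THEN iffD2]) (auto simp: dist_commute)
      then have h1: "f holomorphic_on ball y (3 * (r / 12))" using f holomorphic_on_subset by blast
      have h2: "AE z in lborel. z \<in> ball y (3 * (r / 12)) \<longrightarrow> cmod (f z) \<le> F z"
        using rep'
      proof eventually_elim
        fix z assume a: "z \<in> ball x0 (r/2) \<longrightarrow> integrable lborel (\<lambda>w. F w * ch w * ln (cmod (w - z))) \<and> F z = cmod (f z) * exp (p z) \<and> 0 \<le> p z"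
        show "z \<in> ball y (3 * (r / 12)) \<longrightarrow> cmod (f z) \<le> F z"
        proof
          assume "z \<in> ball y (3 * (r / 12))"
          then have "F z = cmod (f z) * exp (p z)" "0 \<le> p z" using a sub by auto
          then show "cmod (f z) \<le> F z" using mult_left_mono[of 1 "exp (p z)" "cmod (f z)"] by simp
        qed
      qed
      show ?thesis unfolding B_def mass_def
        using C1(2)[THEN spec, of y, THEN spec, of f, THEN spec, of F] h1 h2 F F_nonneg by blast
    qed
    define F2 where "F2 z = max 0 (F z - N)" for z
    have [measurable]: "F2 \<in> borel_measurable borel" unfolding F2_def by measurable
    have F2: "0 \<le> F2 z" "F2 z \<le> F z" "F z - F2 z \<le> N" for z unfolding F2_def using F_nonneg[of z] N(1) by auto
    define w where "w z = (2 / kern_mass) * (F2 z * ch z)" for z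
    have w0: "0 \<le> w z" for z unfolding w_def using kp F2(1) ch(1) by simp
    have F2i: "integrable lborel F2" by (rule Bochner_Integration.integrable_bound[OF F]) (use F2 F_nonneg in auto)
    have F2c: "integrable lborel (\<lambda>z. F2 z * ch z)"
      by (rule Bochner_Integration.integrable_bound[OF F2i]) (use F2 ch in \<open>auto simp: abs_mult intro!: mult_left_le\<close>)
    have wi: "integrable lborel w" unfolding w_def using F2c by simp
    have w1: "(\<integral>z. w z \<partial>lborel) \<le> 1"
    proof -
      have "(\<integral>z. F2 z * ch z \<partial>lborel) \<le> (\<integral>z. F2 z \<partial>lborel)"
        by (rule integral_mono[OF F2c F2i]) (use F2 ch in \<open>auto intro!: mult_left_le\<close>)
      also have "\<dots> \<le> kern_mass / 2" using N(2) unfolding F2_def .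
      finally have "(2 / kern_mass) * (\<integral>z. F2 z * ch z \<partial>lborel) \<le> (2 / kern_mass) * (kern_mass / 2)" using kp by (intro mult_left_mono) auto
      then show ?thesis unfolding w_def integral_mult_right_zero using kp by simp
    qed
    define Q where "Q x = (\<integral>z. w z * inv_norm_ball (z - x) \<partial>lborel)" for x
    note conv = inv_norm_ball_convolution[OF wi w0]
    have Qi: "integrable lborel Q" "(\<integral>x. Q x \<partial>lborel) \<le> inv_norm_mass"
    proof -
      show "integrable lborel Q" unfolding Q_def by (rule conv)
      have "(\<integral>x. Q x \<partial>lborel) = inv_norm_mass * (\<integral>z. w z \<partial>lborel)" unfolding Q_def by (rule conv)
      also have "\<dots> \<le> inv_norm_mass" using mult_left_mono[OF w1 inv_norm_mass_nonneg] by simp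
      finally show "(\<integral>x. Q x \<partial>lborel) \<le> inv_norm_mass" .
    qed
    have Q0: "0 \<le> Q x" for x unfolding Q_def by (intro Bochner_Integration.integral_nonneg mult_nonneg_nonneg w0) auto
    have first: "AE x in lborel. x \<in> ball x0 (r/4) \<longrightarrow> (F x)\<^sup>2 \<le> B1\<^sup>2 * (1 + Q x)"
      using rep' conv(3)
    proof eventually_elim
      fix x
      assume a: "x \<in> ball x0 (r/2) \<longrightarrow> integrable lborel (\<lambda>z. F z * ch z * ln (cmod (z - x))) \<and> F x = cmod (f x) * exp (p x) \<and> 0 \<le> p x"
        and wint: "integrable lborel (\<lambda>z. w z * inv_norm_ball (z - x))"
      show "x \<in> ball x0 (r/4) \<longrightarrow> (F x)\<^sup>2 \<le> B1\<^sup>2 * (1 + Q x)"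
      proof
        assume x4: "x \<in> ball x0 (r/4)"
        then have x: "x \<in> ball x0 (r/2)" using r by auto
        have i: "integrable lborel (\<lambda>z. F z * ch z * ln (cmod (z - x)))" using a x by blast
        have i2: "integrable lborel (\<lambda>z. w z * (- ln (cmod (z - x))))"
        proof (rule Bochner_Integration.integrable_bound)
          show "integrable lborel (\<lambda>z. (2 / kern_mass) * (F z * ch z * ln (cmod (z - x))))" using i by (rule integrable_mult_right)
          show "AE z in lborel. norm (w z * (- ln (cmod (z - x)))) \<le> norm ((2 / kern_mass) * (F z * ch z * ln (cmod (z - x))))"
          proof (intro AE_I2)
            fix z
            have "F2 z * (ch z * \<bar>ln (cmod (z - x))\<bar>) \<le> F z * (ch z * \<bar>ln (cmod (z - x))\<bar>)"
              using F2(2) ch(1) by (intro mult_right_mono) auto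
            then have "(2 / kern_mass) * (F2 z * (ch z * \<bar>ln (cmod (z - x))\<bar>)) \<le> (2 / kern_mass) * (F z * (ch z * \<bar>ln (cmod (z - x))\<bar>))"
              using kp by (intro mult_left_mono) auto
            moreover have "norm (w z * (- ln (cmod (z - x)))) = (2 / kern_mass) * (F2 z * (ch z * \<bar>ln (cmod (z - x))\<bar>))"
              using kp F2(1)[of z] ch(1)[of z] by (simp add: w_def abs_mult)
            moreover have "norm ((2 / kern_mass) * (F z * ch z * ln (cmod (z - x)))) = (2 / kern_mass) * (F z * (ch z * \<bar>ln (cmod (z - x))\<bar>))"
              using kp K ch(1)[of z] by (simp add: abs_mult)
            ultimately show "norm (w z * (- ln (cmod (z - x)))) \<le> norm ((2 / kern_mass) * (F z * ch z * ln (cmod (z - x))))" by simp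
          qed
        qed (unfold w_def, measurable)
        have nx: "AE z in lborel. z \<noteq> x" by (rule AE_lborel_singleton)
        have J: "exp (\<integral>z. w z * (- ln (cmod (z - x))) \<partial>lborel) \<le> 1 + (\<integral>z. w z * inv_norm_ball (z - x) \<partial>lborel)"
        proof (rule exp_integral_le[OF wi w0 w1 i2 wint])
          show "AE z in lborel. w z * exp (- ln (cmod (z - x))) \<le> w z * inv_norm_ball (z - x)"
            using nx
          proof eventually_elim
            fix z assume z: "z \<noteq> x"
            show "w z * exp (- ln (cmod (z - x))) \<le> w z * inv_norm_ball (z - x)"
            proof (cases "ch z = 0")
              case False
              then show ?thesis using near[OF x False] z by (simp add: exp_minus inverse_eq_divide)
            qed (simp add: w_def)
          qed
        qed
        \<comment> \<open>The part of \<open>F\<close> below N is handled by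
          \<open>- ln t \<le> 1 / t\<close>; the excess is the integral to which Jensen's inequality
          is applied.\<close>
        have split: "2 * p x \<le> 2 * (N * inv_norm_mass / kern_mass) + (\<integral>z. w z * (- ln (cmod (z - x))) \<partial>lborel)"
        proof -
          have "2 * p x = (\<integral>z. (2 / kern_mass) * - (F z * ch z * ln (cmod (z - x))) \<partial>lborel)"
            unfolding p_def by (simp only: integral_mult_right_zero Bochner_Integration.integral_minus)
          also have "\<dots> \<le> (\<integral>z. (2 / kern_mass * N) * inv_norm_ball (x - z) + w z * (- ln (cmod (z - x))) \<partial>lborel)"
          proof (rule integral_mono)
            show "integrable lborel (\<lambda>z. (2 / kern_mass) * - (F z * ch z * ln (cmod (z - x))))" using i by simp
            show "integrable lborel (\<lambda>z. (2 / kern_mass * N) * inv_norm_ball (x - z) + w z * (- ln (cmod (z - x))))"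
              by (intro Bochner_Integration.integrable_add integrable_mult_right inv_norm_ball_translate i2)
            fix z
            have "(F z - F2 z) * ch z * (- ln (cmod (z - x))) \<le> N * inv_norm_ball (x - z)"
            proof (cases "ch z = 0 \<or> z = x")
              case False
              then have l: "cmod (z - x) < 1" "0 < cmod (z - x)" using near[OF x] by auto
              have "(F z - F2 z) * ch z * (- ln (cmod (z - x))) \<le> N * 1 * (1 / cmod (z - x))"
                using F2 ch[of z] N(1) l neg_ln_bound[OF l(2)] by (intro mult_mono) auto
              then show ?thesis using l by (simp add: norm_minus_commute)
            qed (use N(1) in auto)
            then have "(2 / kern_mass) * ((F z - F2 z) * ch z * (- ln (cmod (z - x)))) \<le> (2 / kern_mass) * (N * inv_norm_ball (x - z))"
              using kp by (intro mult_left_mono) auto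
            then show "(2 / kern_mass) * - (F z * ch z * ln (cmod (z - x))) \<le> (2 / kern_mass * N) * inv_norm_ball (x - z) + w z * (- ln (cmod (z - x)))"
              unfolding w_def by (simp only: left_diff_distrib right_diff_distrib mult_minus_right mult.assoc)
          qed
          also have "\<dots> = (2 / kern_mass * N) * inv_norm_mass + (\<integral>z. w z * (- ln (cmod (z - x))) \<partial>lborel)"
            by (subst Bochner_Integration.integral_add, intro integrable_mult_right inv_norm_ball_translate, rule i2, simp only: integral_mult_right_zero inv_norm_ball_translate)
          finally show ?thesis by (simp add: field_simps)
        qed
        have "exp (2 * p x) \<le> exp (2 * (N * inv_norm_mass / kern_mass) + (\<integral>z. w z * (- ln (cmod (z - x))) \<partial>lborel))" using split by simp
        also have "\<dots> = (exp (N * inv_norm_mass / kern_mass))\<^sup>2 * exp (\<integral>z. w z * (- ln (cmod (z - x))) \<partial>lborel)"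
          by (simp only: exp_add exp_double)
        also have "\<dots> \<le> (exp (N * inv_norm_mass / kern_mass))\<^sup>2 * (1 + Q x)" using J unfolding Q_def by (intro mult_left_mono) auto
        finally have e: "(exp (p x))\<^sup>2 \<le> (exp (N * inv_norm_mass / kern_mass))\<^sup>2 * (1 + Q x)" unfolding exp_double .
        have "(F x)\<^sup>2 = (cmod (f x))\<^sup>2 * (exp (p x))\<^sup>2" using a x by (simp add: power_mult_distrib)
        also have "\<dots> \<le> B\<^sup>2 * ((exp (N * inv_norm_mass / kern_mass))\<^sup>2 * (1 + Q x))" using fB[OF x4] e by (intro mult_mono power_mono) auto
        also have "\<dots> = B1\<^sup>2 * (1 + Q x)" by (simp add: B1_def power_mult_distrib)
        finally show "(F x)\<^sup>2 \<le> B1\<^sup>2 * (1 + Q x)" .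
      qed
    qed
    let ?I = "\<lambda>z. indicator (ball x0 (r/4)) z :: real"
    have nx0: "AE z in lborel. z \<noteq> x0" by (rule AE_lborel_singleton)
    have sq_le: "AE z in lborel. ?I z * (F z)\<^sup>2 \<le> B1\<^sup>2 * (inv_norm_ball (x0 - z) + Q z)"
      using first nx0
    proof eventually_elim
      fix z assume a: "z \<in> ball x0 (r/4) \<longrightarrow> (F z)\<^sup>2 \<le> B1\<^sup>2 * (1 + Q z)" and z: "z \<noteq> x0"
      show "?I z * (F z)\<^sup>2 \<le> B1\<^sup>2 * (inv_norm_ball (x0 - z) + Q z)"
      proof (cases "z \<in> ball x0 (r/4)")
        case True
        then have "cmod (x0 - z) < 1" by (simp add: r_def dist_norm)
        then have "1 \<le> inv_norm_ball (x0 - z)" using z by (simp add: field_simps)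
        then have "B1\<^sup>2 * (1 + Q z) \<le> B1\<^sup>2 * (inv_norm_ball (x0 - z) + Q z)" by (intro mult_left_mono add_right_mono) auto
        moreover have "?I z * (F z)\<^sup>2 = (F z)\<^sup>2" using True by simp
        ultimately show ?thesis using a True by linarith
      next
        case False
        have "0 \<le> B1\<^sup>2 * (inv_norm_ball (x0 - z) + Q z)" using Q0 by (intro mult_nonneg_nonneg add_nonneg_nonneg) auto
        then show ?thesis using False by simp
      qed
    qed
    have bi: "integrable lborel (\<lambda>z. B1\<^sup>2 * (inv_norm_ball (x0 - z) + Q z))"
      by (intro integrable_mult_right Bochner_Integration.integrable_add inv_norm_ball_translate Qi)
    have sqi: "integrable lborel (\<lambda>z. ?I z * (F z)\<^sup>2)"
    proof (rule Bochner_Integration.integrable_bound[OF bi])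
      show "AE z in lborel. norm (?I z * (F z)\<^sup>2) \<le> norm (B1\<^sup>2 * (inv_norm_ball (x0 - z) + Q z))"
        using sq_le
      proof eventually_elim
        fix z assume a: "?I z * (F z)\<^sup>2 \<le> B1\<^sup>2 * (inv_norm_ball (x0 - z) + Q z)"
        have "norm (?I z * (F z)\<^sup>2) = ?I z * (F z)\<^sup>2" by simp
        also note a
        also have "B1\<^sup>2 * (inv_norm_ball (x0 - z) + Q z) \<le> norm (B1\<^sup>2 * (inv_norm_ball (x0 - z) + Q z))" by (simp only: real_norm_def abs_ge_self)
        finally show "norm (?I z * (F z)\<^sup>2) \<le> norm (B1\<^sup>2 * (inv_norm_ball (x0 - z) + Q z))" .
      qed
      have "F \<in> borel_measurable lborel" using F by (rule borel_measurable_integrable)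
      then show "(\<lambda>z. ?I z * (F z)\<^sup>2) \<in> borel_measurable lborel"
        by (intro borel_measurable_times borel_measurable_indicator borel_measurable_power) auto
    qed
    have sq: "(\<integral>z. ?I z * (F z)\<^sup>2 \<partial>lborel) \<le> Q2"
    proof -
      have "(\<integral>z. ?I z * (F z)\<^sup>2 \<partial>lborel) \<le> (\<integral>z. B1\<^sup>2 * (inv_norm_ball (x0 - z) + Q z) \<partial>lborel)"
        by (rule integral_mono_AE[OF sqi bi sq_le])
      also have "\<dots> = B1\<^sup>2 * (inv_norm_mass + (\<integral>z. Q z \<partial>lborel))"
        by (simp only: integral_mult_right_zero Bochner_Integration.integral_add[OF inv_norm_ball_translate(1) Qi(1)] inv_norm_ball_translate(2))
      also have "\<dots> \<le> Q2" unfolding Q2_def using Qi(2) by (intro mult_left_mono) auto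
      finally show ?thesis .
    qed
    show ?thesis
      using rep'
    proof eventually_elim
      fix x
      assume a: "x \<in> ball x0 (r/2) \<longrightarrow> integrable lborel (\<lambda>z. F z * ch z * ln (cmod (z - x))) \<and> F x = cmod (f x) * exp (p x) \<and> 0 \<le> p x"
      show "x \<in> ball x0 (r/8) \<longrightarrow> F x \<le> C"
      proof
        assume x8: "x \<in> ball x0 (r/8)"
        then have x: "x \<in> ball x0 (r/2)" and x4: "x \<in> ball x0 (r/4)" using r by auto
        have i: "integrable lborel (\<lambda>z. F z * ch z * ln (cmod (z - x)))" using a x by blast
        have bi2: "integrable lborel (\<lambda>z. ?I z * (F z)\<^sup>2 + (4 * inv_norm_ball (x - z) + (8 / r) * F z))"
          by (intro Bochner_Integration.integrable_add integrable_mult_right sqi inv_norm_ball_translate F)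
        have "(\<integral>z. - (F z * ch z * ln (cmod (z - x))) \<partial>lborel) \<le> (\<integral>z. ?I z * (F z)\<^sup>2 + (4 * inv_norm_ball (x - z) + (8 / r) * F z) \<partial>lborel)"
        proof (rule integral_mono[OF integrable_minus[OF i] bi2])
          fix z
          define t where "t = cmod (z - x)"
          have nn: "0 \<le> ?I z * (F z)\<^sup>2" "0 \<le> 4 * inv_norm_ball (x - z)" "0 \<le> (8 / r) * F z" using F_nonneg[of z] r by auto
          show "- (F z * ch z * ln (cmod (z - x))) \<le> ?I z * (F z)\<^sup>2 + (4 * inv_norm_ball (x - z) + (8 / r) * F z)"
          proof (cases "z = x")
            case False
            then have t: "t > 0" by (simp add: t_def)
            \<comment> \<open>Near x the point z lies in the ball where \<open>F^2\<close> is
              integrable, and \<open>F (- ln t) \<le> F^2 + (ln t)^2\<close>. Farther away the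
              logarithm is at most 8/r and the total mass of \<open>F\<close> suffices.\<close>
            show ?thesis
            proof (cases "t < r / 8")
              case True
              have "dist x0 z \<le> dist x0 x + dist x z" by (rule dist_triangle)
              then have zb: "z \<in> ball x0 (r/4)" using x8 True by (simp add: t_def dist_norm norm_minus_commute)
              have t1: "t \<le> 1" "t < 1" using True by (auto simp: r_def)
              have ln0: "0 \<le> - ln t" using t t1 by simp
              have "F z * ch z * (- ln t) \<le> F z * 1 * (- ln t)" using ch(2)[of z] F_nonneg[of z] ln0 by (intro mult_right_mono mult_left_mono) auto
              also have "\<dots> \<le> (F z)\<^sup>2 + (ln t)\<^sup>2"
              proof -
                have "a * b \<le> a\<^sup>2 + b\<^sup>2" if "0 \<le> a * b" for a b :: real
                  using that zero_le_power2[of "a - b"] unfolding power2_diff by linarith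
                from this[OF mult_nonneg_nonneg[OF F_nonneg[of z] ln0]] show ?thesis by (simp only: mult_1_right power2_minus)
              qed
              also have "\<dots> \<le> (F z)\<^sup>2 + 4 / t" using ln_square_bound[OF t t1(1)] by simp
              also have "\<dots> = ?I z * (F z)\<^sup>2 + 4 * inv_norm_ball (x - z)" using zb t1 by (simp add: t_def norm_minus_commute)
              finally have "F z * ch z * (- ln t) \<le> ?I z * (F z)\<^sup>2 + 4 * inv_norm_ball (x - z)" .
              moreover have "- (F z * ch z * ln (cmod (z - x))) = F z * ch z * (- ln t)" by (simp add: t_def)
              ultimately show ?thesis using nn(3) by linarith
            next
              case False
              have "- ln t \<le> 1 / t" by (rule neg_ln_bound[OF t])
              also have "\<dots> \<le> 8 / r" using False r t by (simp add: field_simps)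
              finally have l: "- ln t \<le> 8 / r" .
              have "F z * ch z * (- ln t) \<le> F z * ch z * (8 / r)" using l F_nonneg[of z] ch(1)[of z] by (intro mult_left_mono) auto
              also have "\<dots> \<le> F z * 1 * (8 / r)" using r F_nonneg[of z] ch(2)[of z] by (intro mult_right_mono mult_left_mono) auto
              finally have "F z * ch z * (- ln t) \<le> F z * 1 * (8 / r)" .
              moreover have "F z * 1 * (8 / r) = (8 / r) * F z" by simp
              moreover have "- (F z * ch z * ln (cmod (z - x))) = F z * ch z * (- ln t)" by (simp add: t_def)
              ultimately show ?thesis using nn(1,2) by linarith
            qed
          qed (use nn in simp)
        qed
        also have "\<dots> = (\<integral>z. ?I z * (F z)\<^sup>2 \<partial>lborel) + (4 * inv_norm_mass + (8 / r) * mass)"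
        proof -
          have 1: "integrable lborel (\<lambda>z. 4 * inv_norm_ball (x - z))" by (intro integrable_mult_right inv_norm_ball_translate)
          have 2: "integrable lborel (\<lambda>z. (8 / r) * F z)" by (intro integrable_mult_right F)
          show ?thesis
            by (simp only: Bochner_Integration.integral_add[OF sqi Bochner_Integration.integrable_add[OF 1 2]] Bochner_Integration.integral_add[OF 1 2]
                integral_mult_right_zero inv_norm_ball_translate(2) mass_def)
        qed
        also have "\<dots> \<le> Q2 + 4 * inv_norm_mass + (8 / r) * mass" using sq by simp
        finally have "(1 / kern_mass) * (\<integral>z. - (F z * ch z * ln (cmod (z - x))) \<partial>lborel) \<le> (1 / kern_mass) * (Q2 + 4 * inv_norm_mass + (8 / r) * mass)"
          by (rule mult_left_mono) (use kp in simp)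
        moreover have "p x = (1 / kern_mass) * (\<integral>z. - (F z * ch z * ln (cmod (z - x))) \<partial>lborel)"
          unfolding p_def Bochner_Integration.integral_minus by simp
        ultimately have "p x \<le> (1 / kern_mass) * (Q2 + 4 * inv_norm_mass + (8 / r) * mass)" by simp
        then have "F x \<le> B * exp ((1 / kern_mass) * (Q2 + 4 * inv_norm_mass + (8 / r) * mass))"
          using a x fB[OF x4] B by (auto intro!: mult_mono)
        then show "F x \<le> C" by (simp add: C_def)
      qed
    qed
  qed
  \<comment> \<open>Each ball has its own exceptional null set; countably many centres cover the
    plane.\<close>
  obtain D :: "complex set" where D: "countable D" "\<And>X. open X \<Longrightarrow> X \<noteq> {} \<Longrightarrow> \<exists>d\<in>D. d \<in> X"
    using countable_dense_setE by blast
  have "AE x in lborel. \<forall>d\<in>D. x \<in> ball d (r / 8) \<longrightarrow> F x \<le> C"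
    unfolding AE_ball_countable[OF D(1)] using local by blast
  then have "AE x in lborel. F x \<le> C"
  proof eventually_elim
    fix x assume a: "\<forall>d\<in>D. x \<in> ball d (r / 8) \<longrightarrow> F x \<le> C"
    obtain d where "d \<in> D" "d \<in> ball x (r / 8)" using D(2)[of "ball x (r/8)"] r by auto
    then show "F x \<le> C" using a by (auto simp: dist_commute)
  qed
  then show ?thesis using that by blast
qed

end

section \<open>Reduction to an integral equation\<close>

lemma AE_zero_imp_zero_on_open:
  fixes h :: "complex \<Rightarrow> real"
  assumes S: "open S" and c: "continuous_on S h" and ae: "AE x in lborel. x \<in> S \<longrightarrow> h x = 0" and x: "x \<in> S"
  shows "h x = 0"
proof (rule ccontr)
  assume nz: "h x \<noteq> 0"
  let ?U = "S \<inter> h -` (- {0})"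
  have o: "open ?U" by (rule continuous_open_preimage[OF c S]) auto
  have "AE x in lebesgue. x \<notin> ?U" using ae by (auto simp: AE_completion_iff elim!: eventually_mono)
  moreover have "?U \<in> sets lebesgue" using o by auto
  ultimately have "?U \<in> null_sets lebesgue" using AE_iff_null_sets by blast
  then have "negligible ?U" by (simp add: negligible_iff_null_sets)
  then have "?U = {}" using o open_not_negligible by blast
  then show False using x nz by auto
qed

lemma AE_le_imp_le:
  fixes f g :: "complex \<Rightarrow> real"
  assumes f: "continuous_on UNIV f" and g: "continuous_on UNIV g" and ae: "AE x in lborel. f x \<le> g x"
  shows "f x \<le> g x"
proof -
  have "max 0 (f x - g x) = 0"
    by (rule AE_zero_imp_zero_on_open[of UNIV "\<lambda>x. max 0 (f x - g x)"])
       (use ae in \<open>auto intro!: continuous_intros f g elim!: eventually_mono\<close>)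
  then show ?thesis by (simp add: max_def split: if_splits)
qed

lemma holomorphic_Re_zero_imp_constant:
  assumes f: "f holomorphic_on ball a r" and re: "\<And>x. x \<in> ball a r \<Longrightarrow> Re (f x) = 0" and x: "x \<in> ball a r"
  shows "f x = f a"
proof -
  have "(f has_field_derivative 0) (at z within ball a r)" if z: "z \<in> ball a r" for z
  proof -
    have d: "(f has_field_derivative deriv f z) (at z)" using f z holomorphic_derivI open_ball by blast
    then have "((\<lambda>x. Re (f x)) has_derivative (\<lambda>h. Re (deriv f z * h))) (at z)"
      unfolding has_field_derivative_def by (rule bounded_linear.has_derivative[OF bounded_linear_Re])
    moreover have "((\<lambda>x. Re (f x)) has_derivative (\<lambda>h. 0)) (at z)"
    proof -
      have "((\<lambda>x. 0) has_derivative (\<lambda>h. 0)) (at z)" by simp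
      then show ?thesis by (rule has_derivative_transform_within_open[OF _ open_ball z]) (simp add: re)
    qed
    ultimately have "(\<lambda>h. Re (deriv f z * h)) = (\<lambda>h. 0)" by (rule has_derivative_unique)
    from fun_cong[OF this, of "cnj (deriv f z)"] have "deriv f z = 0"
      by (simp add: complex_eq_iff sum_squares_eq_zero_iff)
    with d show ?thesis using has_field_derivative_at_within by metis
  qed
  then have "\<exists>c. \<forall>z\<in>ball a r. f z = c"
    by (intro has_field_derivative_zero_constant) auto
  moreover have "a \<in> ball a r" using x by (auto intro: le_less_trans[OF zero_le_dist])
  ultimately show ?thesis using x by metis
qed

text \<open>A holomorphic function on a ball is determined by its real part up to an imaginary
  constant. Fixing that constant at 0, a point of all the balls, makes the local functions
  extensions of one another.\<close>

lemma entire_from_local_real_parts: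
  fixes h :: "complex \<Rightarrow> real"
  assumes loc: "\<And>k::nat. \<exists>A. A holomorphic_on ball 0 (real (Suc k)) \<and> (AE x in lborel. x \<in> ball 0 (real (Suc k)) \<longrightarrow> h x = Re (A x))"
  obtains f where "f holomorphic_on UNIV" "AE x in lborel. h x = Re (f x)"
proof -
  obtain A where A: "\<And>k::nat. A k holomorphic_on ball 0 (real (Suc k))"
    "\<And>k::nat. AE x in lborel. x \<in> ball 0 (real (Suc k)) \<longrightarrow> h x = Re (A k x)"
    using loc by metis
  define B where "B k x = A k x - \<i> * of_real (Im (A k 0))" for k x
  have B: "B k holomorphic_on ball 0 (real (Suc k))" for k unfolding B_def by (intro holomorphic_intros A)
  have eq: "B j x = B k x" if jk: "j \<le> k" and x: "x \<in> ball 0 (real (Suc j))" for j k x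
  proof -
    let ?S = "ball 0 (real (Suc j)) :: complex set"
    have sub: "?S \<subseteq> ball 0 (real (Suc k))" using jk by auto
    have hol: "(\<lambda>x. B j x - B k x) holomorphic_on ?S" using B[of j] B[of k] sub by (intro holomorphic_intros) (auto intro: holomorphic_on_subset)
    have re: "Re (B j x - B k x) = 0" if "x \<in> ?S" for x
    proof (rule AE_zero_imp_zero_on_open[OF open_ball _ _ that])
      show "continuous_on ?S (\<lambda>x. Re (B j x - B k x))"
        by (intro continuous_intros holomorphic_on_imp_continuous_on hol)
      show "AE x in lborel. x \<in> ?S \<longrightarrow> Re (B j x - B k x) = 0"
        using A(2)[of j] A(2)[of k] by eventually_elim (use sub in \<open>auto simp: B_def\<close>)
    qed
    have 0: "(0::complex) \<in> ?S" by simp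
    have "B j x - B k x = B j 0 - B k 0" by (rule holomorphic_Re_zero_imp_constant[OF hol re x])
    also have "\<dots> = 0" using re[OF 0] by (simp add: complex_eq_iff B_def)
    finally show ?thesis by simp
  qed
  \<comment> \<open>The ball with index k has radius k + 1, so x lies strictly inside the one chosen
    here.\<close>
  define f where "f x = B (nat \<lceil>cmod x\<rceil>) x" for x
  have fB: "f x = B k x" if x: "x \<in> ball 0 (real (Suc k))" for k x
  proof -
    let ?m = "nat \<lceil>cmod x\<rceil>"
    have xm: "x \<in> ball 0 (real (Suc ?m))" by simp linarith
    show ?thesis
      unfolding f_def
    proof (cases "?m \<le> k")
      case True then show "B ?m x = B k x" by (rule eq) (rule xm)
    next
      case False
      then have "k \<le> ?m" by linarith
      from eq[OF this x] show "B ?m x = B k x" by (rule sym)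
    qed
  qed
  have "f holomorphic_on UNIV"
  proof -
    have "f field_differentiable at x" for x
    proof -
      obtain k :: nat where "cmod x \<le> real k" using real_arch_simple by blast
      then have x: "x \<in> ball 0 (real (Suc k))" by simp
      have "f holomorphic_on ball 0 (real (Suc k))" by (rule holomorphic_transform[OF B[of k]]) (simp add: fB del: of_nat_Suc)
      then show ?thesis using x holomorphic_on_imp_differentiable_at open_ball by blast
    qed
    then show ?thesis by (simp add: holomorphic_on_def field_differentiable_at_within)
  qed
  moreover have "AE x in lborel. h x = Re (f x)"
  proof -
    have "AE x in lborel. \<forall>k::nat. x \<in> ball 0 (real (Suc k)) \<longrightarrow> h x = Re (A k x)"
      unfolding AE_all_countable using A(2) by blast
    then show ?thesis
    proof eventually_elim
      fix x assume a: "\<forall>k::nat. x \<in> ball 0 (real (Suc k)) \<longrightarrow> h x = Re (A k x)"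
      obtain k :: nat where "cmod x \<le> real k" using real_arch_simple by blast
      then have x: "x \<in> ball 0 (real (Suc k))" by simp
      then show "h x = Re (f x)" using a fB[OF x] by (simp add: B_def)
    qed
  qed
  ultimately show ?thesis using that by blast
qed

text \<open>A polynomial with a nonzero coefficient of positive degree would have a root, and an
  exponential has none. The modulus of the constant exponential gives back \<open>Re (f x)\<close>,
  the part of f that the solution involves.\<close>

lemma exp_polynomial_growth_imp_constant:
  assumes f: "f holomorphic_on UNIV" and gr: "\<And>z. A \<le> cmod z \<Longrightarrow> cmod (exp (f z)) \<le> B * cmod z ^ N"
  shows "Re (f x) = Re (f 0)"
proof -
  let ?g = "\<lambda>z. exp (f z)"
  have hol: "?g holomorphic_on UNIV" by (intro holomorphic_intros f)
  define a where "a k = (deriv ^^ k) ?g 0 / fact k" for k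
  have eq: "?g z = (\<Sum>k\<le>N. a k * z ^ k)" for z unfolding a_def by (rule Liouville_polynomial[OF hol gr])
  have "a k = 0" if k: "k \<in> {1..N}" for k
  proof (rule ccontr)
    assume "a k \<noteq> 0"
    then have "a 0 = 0 \<or> (\<exists>i\<in>{1..N}. a i \<noteq> 0)" using k by blast
    then obtain z where "(\<Sum>k\<le>N. a k * z ^ k) = 0" using Cauchy_Integral_Formula.fundamental_theorem_of_algebra by blast
    then show False using eq[of z] by simp
  qed
  then have "(\<Sum>k\<le>N. a k * z ^ k) = (\<Sum>k\<in>{0}. a k * z ^ k)" for z
    by (intro sum.mono_neutral_right) auto
  then have "?g x = ?g 0" using eq[of x] eq[of 0] by simp
  then have "cmod (?g x) = cmod (?g 0)" by simp
  then show ?thesis by (simp add: norm_exp_eq_Re)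
qed

lemma log_potential_cong_AE:
  assumes [measurable]: "f \<in> borel_measurable borel" "g \<in> borel_measurable borel" and ae: "AE y in lborel. f y = g y"
  shows "log_potential f x = log_potential g x"
  unfolding log_potential_def by (rule integral_cong_AE, measurable) (use ae in \<open>auto elim!: eventually_mono\<close>)

lemma continuous_on_log_potential:
  assumes "integrable lborel f" "\<And>y. \<bar>f y\<bar> \<le> C"
  shows "continuous_on S (log_potential f)"
proof -
  have "continuous_on S (\<lambda>x. complex_of_real (log_potential f x))" using wirtinger_continuous[OF wirtinger_log_potential[OF assms]] .
  from continuous_on_Re[OF this] show ?thesis by simp
qed

context liouville_solution
begin

text \<open>The difference between the global potential and its local piece: the mass away from the
  centre, and the normalising \<open>ln (1 + |y|)\<close> of the mass near it. For
  \<open>|y| \<ge> r\<close> the kernel is the real part of \<open>Ln (1 - x/y)\<close> plus a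
  constant in x, so the difference is the real part of a holomorphic function.\<close>

lemma far_potential:
  assumes g: "integrable lborel g" and g0: "\<And>y. 0 \<le> g y" and r: "r > 0"
  obtains B where "B holomorphic_on ball 0 (r/2)"
    "\<And>x. x \<in> ball 0 (r/2) \<Longrightarrow> Re (B x) = (\<integral>y. g y * ((1 - cutoff 0 r y) * (ln (cmod (x - y)) - ln (1 + cmod y)) - cutoff 0 r y * ln (1 + cmod y)) \<partial>lborel)"
proof -
  have [measurable]: "g \<in> borel_measurable borel" using g by auto
  define ch where "ch = cutoff (0::complex) r"
  have ch: "0 \<le> ch z" "ch z \<le> 1" "cmod z \<le> r \<Longrightarrow> ch z = 1" "2 * r \<le> cmod z \<Longrightarrow> ch z = 0" for z
    unfolding ch_def using cutoff_bounds[OF r, where ?x0.0="0::complex"] by auto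
  have "continuous_on UNIV ch" unfolding ch_def by (rule cutoff_continuous[OF r])
  then have [measurable]: "ch \<in> borel_measurable borel" by (rule borel_measurable_continuous_onI)
  define \<Phi> where "\<Phi> x y = of_real (g y) * (of_real (1 - ch y) * (indicator {y. r \<le> cmod y} y * Ln (1 - x / y) + of_real (ln (cmod y) - ln (1 + cmod y))) - of_real (ch y * ln (1 + cmod y)))" for x y
  have far: "cmod (x / y) \<le> 1/2" "y \<noteq> 0" "cmod (1 - x / y) = cmod (x - y) / cmod y" "x \<noteq> y" if "x \<in> ball 0 (r/2)" "r \<le> cmod y" for x y
  proof -
    have a: "cmod x < r / 2" "r \<le> cmod y" using that by auto
    show "y \<noteq> 0" "x \<noteq> y" using a r by auto
    then have "1 - x / y = (y - x) / y" by (simp add: field_simps)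
    then show "cmod (1 - x / y) = cmod (x - y) / cmod y" by (simp add: norm_divide norm_minus_commute)
    show "cmod (x / y) \<le> 1/2" using frac_le[of "r/2" "cmod x" r "cmod y"] a r by (simp add: norm_divide)
  qed
  \<comment> \<open>The summands bound \<open>Ln (1 - x/y)\<close>, the difference
    \<open>ln |y| - ln (1 + |y|)\<close> for \<open>|y| \<ge> r\<close>, and the normalisation on
    the support of the cut-off.\<close>
  define D where "D = 5 + 1 / r + ln (1 + 2 * r)"
  have D: "0 \<le> D" unfolding D_def using r by simp
  have bound: "cmod (\<Phi> x y) \<le> D * g y" if x: "x \<in> ball 0 (r/2)" for x y
  proof -
    have 1: "cmod (of_real (1 - ch y) * (indicator {y. r \<le> cmod y} y * Ln (1 - x / y) + of_real (ln (cmod y) - ln (1 + cmod y)))) \<le> 5 + 1 / r"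
    proof (cases "r \<le> cmod y")
      case True
      have y: "cmod y > 0" using True r by linarith
      have "ln (1 + cmod y) - ln (cmod y) = ln (1 + 1 / cmod y)"
      proof -
        have "1 + 1 / cmod y = (1 + cmod y) / cmod y" using y by (simp add: field_simps)
        moreover have "0 < 1 + cmod y" using y by linarith
        ultimately show ?thesis using y ln_divide_pos[of "1 + cmod y" "cmod y"] by metis
      qed
      moreover have "ln (1 + 1 / cmod y) \<le> 1 / cmod y" using y by (intro ln_add_one_self_le_self) auto
      moreover have "1 / cmod y \<le> 1 / r" using frac_le[of 1 1 r "cmod y"] True r by simp
      moreover have "0 \<le> ln (1 + 1 / cmod y)" using y by simp
      ultimately have l: "\<bar>ln (cmod y) - ln (1 + cmod y)\<bar> \<le> 1 / r" by linarith
      have "cmod (Ln (1 - x / y) + of_real (ln (cmod y) - ln (1 + cmod y))) \<le> 5 + 1 / r"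
        by (rule order_trans[OF norm_triangle_ineq add_mono[OF cmod_Ln_near_one(1)[OF far(1)[OF x True]]]]) (use l in \<open>simp only: norm_of_real\<close>)
      then have "\<bar>1 - ch y\<bar> * cmod (Ln (1 - x / y) + of_real (ln (cmod y) - ln (1 + cmod y))) \<le> 1 * (5 + 1 / r)"
        using ch[of y] by (intro mult_mono) auto
      then show ?thesis using True by (simp only: norm_mult norm_of_real indicator_simps mem_Collect_eq mult_1)
    next
      case False
      then show ?thesis using ch(3)[of y] r by simp
    qed
    have 2: "cmod (of_real (ch y * ln (1 + cmod y))) \<le> ln (1 + 2 * r)"
    proof (cases "2 * r \<le> cmod y")
      case False
      then have "ln (1 + cmod y) \<le> ln (1 + 2 * r)" by (subst ln_le_cancel_iff) (auto intro: add_pos_nonneg simp: r less_imp_le)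
      moreover have "0 \<le> ln (1 + cmod y)" by simp
      moreover have "\<bar>ch y * ln (1 + cmod y)\<bar> \<le> 1 * ln (1 + cmod y)" using ch[of y] by (simp add: abs_mult mult_left_le_one_le)
      ultimately show ?thesis unfolding norm_of_real by linarith
    qed (use ch(4)[of y] r in simp)
    have "cmod (of_real (1 - ch y) * (indicator {y. r \<le> cmod y} y * Ln (1 - x / y) + of_real (ln (cmod y) - ln (1 + cmod y))) - of_real (ch y * ln (1 + cmod y))) \<le> D"
      unfolding D_def using 1 2 by (intro order_trans[OF norm_triangle_ineq4 add_mono])
    then have "\<bar>g y\<bar> * cmod (of_real (1 - ch y) * (indicator {y. r \<le> cmod y} y * Ln (1 - x / y) + of_real (ln (cmod y) - ln (1 + cmod y))) - of_real (ch y * ln (1 + cmod y))) \<le> \<bar>g y\<bar> * D"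
      by (rule mult_left_mono) simp
    then show ?thesis unfolding \<Phi>_def norm_mult norm_of_real using g0[of y] by (simp only: abs_of_nonneg mult.commute)
  qed
  have meas: "\<Phi> x \<in> borel_measurable lborel" for x
  proof -
    have [measurable]: "(\<lambda>y. indicator {y. r \<le> cmod y} y * Ln (1 - x / y)) \<in> borel_measurable borel"
    proof (intro borel_measurable_times borel_measurable_indicator measurable_compose[OF _ Ln_measurable])
      show "{y. r \<le> cmod y} \<in> sets borel" by measurable
      show "(\<lambda>z. 1 - x / z) \<in> borel_measurable borel"
        by (intro borel_measurable_diff borel_measurable_divide borel_measurable_const measurable_ident[unfolded id_def])
    qed
    show ?thesis unfolding \<Phi>_def by measurable
  qed
  have Gi: "integrable lborel (\<lambda>y. D * g y)" using g by simp
  have hol: "(\<lambda>x. \<Phi> x y) holomorphic_on ball 0 (r/2)" for y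
  proof (cases "r \<le> cmod y")
    case True
    then show ?thesis unfolding \<Phi>_def by (intro holomorphic_intros cmod_Ln_near_one(2) far) auto
  next
    case False
    then show ?thesis unfolding \<Phi>_def by simp
  qed
  define B where "B x = (\<integral>y. \<Phi> x y \<partial>lborel)" for x
  have "B holomorphic_on ball 0 (r/2)" unfolding B_def
    by (rule holomorphic_on_integral[OF open_ball meas hol bound Gi])
  moreover have "Re (B x) = (\<integral>y. g y * ((1 - cutoff 0 r y) * (ln (cmod (x - y)) - ln (1 + cmod y)) - cutoff 0 r y * ln (1 + cmod y)) \<partial>lborel)"
    if x: "x \<in> ball 0 (r/2)" for x
  proof -
    have i: "integrable lborel (\<Phi> x)"
      by (rule Bochner_Integration.integrable_bound[OF Gi meas]) (use bound[OF x] in \<open>auto intro: order_trans[OF _ abs_ge_self]\<close>)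
    have "Re (\<Phi> x y) = g y * ((1 - ch y) * (ln (cmod (x - y)) - ln (1 + cmod y)) - ch y * ln (1 + cmod y))" for y
    proof (cases "r \<le> cmod y")
      case True
      have l: "Re (Ln (1 - x / y)) = ln (cmod (x - y)) - ln (cmod y)"
        using cmod_Ln_near_one(3)[OF far(1)[OF x True]] far(2-4)[OF x True] by (simp add: ln_div)
      have "Re (indicator {y. r \<le> cmod y} y * Ln (1 - x / y) + of_real (ln (cmod y) - ln (1 + cmod y))) = ln (cmod (x - y)) - ln (1 + cmod y)"
        using True l by (simp only: indicator_simps mem_Collect_eq mult_1 plus_complex.sel Re_complex_of_real)
      then show ?thesis unfolding \<Phi>_def
        by (simp only: Re_complex_of_real Im_complex_of_real times_complex.sel minus_complex.sel mult_zero_left diff_zero)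
    qed (use ch(3)[of y] in \<open>simp add: \<Phi>_def\<close>)
    then show ?thesis using integral_Re[OF i] by (simp add: B_def ch_def)
  qed
  ultimately show ?thesis using that by blast
qed

text \<open>Replaces the solution by its continuous representative, for which all relations hold at
  every point. The potential is blind to null sets, so the representative can be put back into its
  own right-hand side.\<close>

lemma integral_equation:
  shows "\<exists>u c0 C. (AE x in lborel. \<psi> x = u x)
    \<and> integrable lborel (\<lambda>z. K * cmod (z - z0) ^ (2 * n) * exp (u z))
    \<and> (\<forall>z. K * cmod (z - z0) ^ (2 * n) * exp (u z) \<le> C)
    \<and> (\<forall>x. u x = c0 - log_potential (\<lambda>z. K * cmod (z - z0) ^ (2 * n) * exp (u z)) x / kern_mass)"
proof -
  have kp: "kern_mass > 0" by (rule kern_mass_pos)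
  obtain C0 where C0: "AE z in lborel. F z \<le> C0" using AE_bounded .
  define C where "C = \<bar>C0\<bar>"
  \<comment> \<open>Agrees with \<open>F\<close> almost everywhere and is bounded everywhere, as the
    lemmas on potentials require.\<close>
  define g where "g z = min (F z) C" for z
  have C: "C \<ge> 0" by (simp add: C_def)
  have gb: "0 \<le> g z" "g z \<le> C" "\<bar>g z\<bar> \<le> C" "g z \<le> F z" for z using F_nonneg[of z] C by (auto simp: g_def)
  have [measurable]: "g \<in> borel_measurable borel" unfolding g_def by measurable
  have gi: "integrable lborel g" by (rule Bochner_Integration.integrable_bound[OF F]) (use gb F_nonneg in auto)
  have gF: "AE z in lborel. F z = g z" using C0 by eventually_elim (simp add: g_def C_def)
  define h where "h x = kern_mass * \<psi> x + log_potential g x" for x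
  have loc: "\<exists>A. A holomorphic_on ball 0 (real (Suc k)) \<and> (AE x in lborel. x \<in> ball 0 (real (Suc k)) \<longrightarrow> h x = Re (A x))" for k
  proof -
    define r where "r = 2 * real (Suc k)"
    have r: "r > 0" "r / 2 = real (Suc k)" by (auto simp: r_def)
    let ?ch = "cutoff (0::complex) r"
    have [measurable]: "?ch \<in> borel_measurable borel" by (intro borel_measurable_continuous_onI cutoff_continuous r)
    obtain A where A: "A holomorphic_on ball 0 (r/2)"
      "AE x in lborel. x \<in> ball 0 (r/2) \<longrightarrow> integrable lborel (\<lambda>z. F z * ?ch z * ln (cmod (z - x))) \<and>
         kern_mass * \<psi> x = Re (A x) - (\<integral>z. F z * ?ch z * ln (cmod (z - x)) \<partial>lborel)"
      using local_representation[OF r(1), of 0] by blast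
    obtain B where B: "B holomorphic_on ball 0 (r/2)"
      "\<And>x. x \<in> ball 0 (r/2) \<Longrightarrow> Re (B x) = (\<integral>y. g y * ((1 - ?ch y) * (ln (cmod (x - y)) - ln (1 + cmod y)) - ?ch y * ln (1 + cmod y)) \<partial>lborel)"
      using far_potential[OF gi gb(1) r(1)] by blast
    have "AE x in lborel. x \<in> ball 0 (r/2) \<longrightarrow> h x = Re (A x + B x)"
      using A(2)
    proof eventually_elim
      fix x
      assume a: "x \<in> ball 0 (r/2) \<longrightarrow> integrable lborel (\<lambda>z. F z * ?ch z * ln (cmod (z - x))) \<and>
         kern_mass * \<psi> x = Re (A x) - (\<integral>z. F z * ?ch z * ln (cmod (z - x)) \<partial>lborel)"
      show "x \<in> ball 0 (r/2) \<longrightarrow> h x = Re (A x + B x)"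
      proof
        assume x: "x \<in> ball 0 (r/2)"
        let ?p = "\<lambda>z. g z * ?ch z * ln (cmod (z - x))"
        have ae: "AE z in lborel. F z * ?ch z * ln (cmod (z - x)) = ?p z" using gF by (auto elim!: eventually_mono)
        have ip: "integrable lborel ?p"
          by (rule integrable_cong_AE_imp[of _ "\<lambda>z. F z * ?ch z * ln (cmod (z - x))"]) (use a x ae in \<open>auto elim: eventually_mono\<close>)
        have ep: "(\<integral>z. F z * ?ch z * ln (cmod (z - x)) \<partial>lborel) = (\<integral>z. ?p z \<partial>lborel)"
          by (rule integral_cong_AE, measurable) (rule ae)
        have "log_potential g x - (\<integral>z. ?p z \<partial>lborel) = (\<integral>y. g y * (ln (cmod (x - y)) - ln (1 + cmod y)) - ?p y \<partial>lborel)"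
          unfolding log_potential_def using log_potential_integrable[OF gi gb(3), of x] ip by simp
        also have "\<dots> = Re (B x)" unfolding B(2)[OF x]
          by (intro Bochner_Integration.integral_cong refl) (simp add: norm_minus_commute algebra_simps)
        finally show "h x = Re (A x + B x)" using a x ep by (simp add: h_def)
      qed
    qed
    moreover have "(\<lambda>x. A x + B x) holomorphic_on ball 0 (r/2)" by (intro holomorphic_intros A B)
    ultimately show ?thesis unfolding r(2) by blast
  qed
  obtain f where f: "f holomorphic_on UNIV" "AE x in lborel. h x = Re (f x)"
    using entire_from_local_real_parts[of h] loc by blast
  define mass where "mass = (\<integral>y. g y \<partial>lborel)"
  have mass: "mass \<ge> 0" unfolding mass_def by (intro Bochner_Integration.integral_nonneg gb)
  \<comment> \<open>The degree of growth: \<open>F\<close> is bounded and the exponential of the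
    potential over \<open>kern_mass\<close> is at most \<open>(1 + |x|)\<close> to the power
    \<open>mass / kern_mass\<close>.\<close>
  obtain N :: nat where N: "mass / kern_mass \<le> real N" using real_arch_simple by blast
  have cf: "continuous_on UNIV f" using f holomorphic_on_imp_continuous_on by blast
  have growth: "K * cmod (x - z0) ^ (2 * n) * exp (Re (f x) / kern_mass) \<le> C * (1 + cmod x) ^ N" for x
  proof (rule AE_le_imp_le[where f="\<lambda>x. K * cmod (x - z0) ^ (2 * n) * exp (Re (f x) / kern_mass)"])
    show "continuous_on UNIV (\<lambda>x. K * cmod (x - z0) ^ (2 * n) * exp (Re (f x) / kern_mass))"
      using kp by (intro continuous_intros cf) auto
    show "continuous_on UNIV (\<lambda>x::complex. C * (1 + cmod x) ^ N)" by (intro continuous_intros)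
    show "AE x in lborel. K * cmod (x - z0) ^ (2 * n) * exp (Re (f x) / kern_mass) \<le> C * (1 + cmod x) ^ N"
      using f(2) gF
    proof eventually_elim
      fix x assume hx: "h x = Re (f x)" and gx: "F x = g x"
      have "Re (f x) / kern_mass = \<psi> x + log_potential g x / kern_mass" using hx kp by (simp add: h_def field_simps)
      then have "K * cmod (x - z0) ^ (2 * n) * exp (Re (f x) / kern_mass) = F x * exp (log_potential g x / kern_mass)" by (simp add: exp_add)
      also have "\<dots> \<le> C * (1 + cmod x) ^ N"
      proof (intro mult_mono)
        show "F x \<le> C" using gx gb(2) by simp
        have l: "0 \<le> ln (1 + cmod x)" by simp
        have "log_potential g x / kern_mass \<le> mass * ln (1 + cmod x) / kern_mass"
          using log_potential_le[OF gi gb(3) gb(1), of x] kp by (intro divide_right_mono) (auto simp: mass_def)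
        also have "\<dots> = (mass / kern_mass) * ln (1 + cmod x)" by simp
        also have "\<dots> \<le> real N * ln (1 + cmod x)" by (rule mult_right_mono[OF N l])
        finally have "exp (log_potential g x / kern_mass) \<le> exp (real N * ln (1 + cmod x))" by simp
        also have "\<dots> = (1 + cmod x) ^ N"
        proof -
          have "0 < 1 + cmod x" by (intro add_pos_nonneg) auto
          then show ?thesis by (simp add: exp_of_nat_mult)
        qed
        finally show "exp (log_potential g x / kern_mass) \<le> (1 + cmod x) ^ N" .
      qed (use C in auto)
      finally show "K * cmod (x - z0) ^ (2 * n) * exp (Re (f x) / kern_mass) \<le> C * (1 + cmod x) ^ N" .
    qed
  qed
  have ref: "Re (f x) = Re (f 0)" for x
  proof -
    have "Re (f x / of_real kern_mass) = Re (f 0 / of_real kern_mass)"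
    proof (rule exp_polynomial_growth_imp_constant[of "\<lambda>x. f x / of_real kern_mass" "1 + cmod z0" "(C / K) * 2 ^ N" N])
      show "(\<lambda>x. f x / of_real kern_mass) holomorphic_on UNIV" using kp by (intro holomorphic_intros f) auto
      fix z assume z: "1 + cmod z0 \<le> cmod z"
      have z1: "1 \<le> cmod z" using z by (smt (verit) norm_ge_zero)
      have "1 \<le> cmod (z - z0)" using z norm_triangle_ineq2[of z z0] by linarith
      then have "1 \<le> cmod (z - z0) ^ (2 * n)" by (rule one_le_power)
      then have "K * 1 * exp (Re (f z) / kern_mass) \<le> K * cmod (z - z0) ^ (2 * n) * exp (Re (f z) / kern_mass)"
        using K by (intro mult_right_mono mult_left_mono) auto
      also have "\<dots> \<le> C * (1 + cmod z) ^ N" by (rule growth)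
      also have "\<dots> \<le> C * (2 * cmod z) ^ N" using z1 C by (intro mult_left_mono power_mono) auto
      finally have "exp (Re (f z) / kern_mass) \<le> (C / K) * 2 ^ N * cmod z ^ N"
        using K by (simp add: field_simps power_mult_distrib)
      then show "cmod (exp (f z / of_real kern_mass)) \<le> (C / K) * 2 ^ N * cmod z ^ N" by (simp add: norm_exp_eq_Re)
    qed
    then show ?thesis using kp by simp
  qed
  define u where "u x = Re (f 0) / kern_mass - log_potential g x / kern_mass" for x
  have pu: "AE x in lborel. \<psi> x = u x"
    using f(2)
  proof eventually_elim
    fix x assume "h x = Re (f x)"
    then show "\<psi> x = u x" using ref[of x] kp by (simp add: u_def h_def field_simps)
  qed
  have cu: "continuous_on S u" for S unfolding u_def using kp by (intro continuous_intros continuous_on_log_potential[OF gi gb(3)]) auto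
  then have [measurable]: "u \<in> borel_measurable borel" using borel_measurable_continuous_onI by blast
  let ?Fu = "\<lambda>z. K * cmod (z - z0) ^ (2 * n) * exp (u z)"
  have Fug: "AE z in lborel. g z = ?Fu z" using pu gF by eventually_elim simp
  have 2: "integrable lborel ?Fu" by (rule integrable_cong_AE_imp[OF gi]) (use Fug in \<open>auto elim: eventually_mono\<close>)
  have 3: "?Fu z \<le> C" for z
  proof (rule AE_le_imp_le[of ?Fu "\<lambda>_. C"])
    show "AE z in lborel. ?Fu z \<le> C" using Fug by eventually_elim (use gb(2) in metis)
  qed (intro continuous_intros cu)+
  have 4: "u x = Re (f 0) / kern_mass - log_potential ?Fu x / kern_mass" for x
    unfolding u_def[of x] by (subst log_potential_cong_AE[OF _ _ Fug]) measurable
  show ?thesis by (intro exI conjI allI) (rule pu 2 3 4)+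
qed

end

section \<open>The Riccati equation\<close>

locale liouville_integral_equation =
  fixes u :: "complex \<Rightarrow> real" and c0 C K :: real and z0 :: complex and n :: nat
  assumes K: "K > 0"
    and F_integrable: "integrable lborel (\<lambda>z. K * cmod (z - z0) ^ (2 * n) * exp (u z))"
    and F_le: "\<And>z. K * cmod (z - z0) ^ (2 * n) * exp (u z) \<le> C"
    and u_eq: "\<And>x. u x = c0 - log_potential (\<lambda>z. K * cmod (z - z0) ^ (2 * n) * exp (u z)) x / kern_mass"
begin

definition F :: "complex \<Rightarrow> complex" where "F z = of_real (K * cmod (z - z0) ^ (2 * n) * exp (u z))"
definition Q :: "complex \<Rightarrow> complex" where "Q = cauchy_transform F"

lemma F_props: "integrable lborel F" "cmod (F z) \<le> C" "cnj (F z) = F z" "0 \<le> C"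
proof -
  show "integrable lborel F" unfolding F_def by (rule integrable_of_real[OF F_integrable])
  show b: "cmod (F z) \<le> C" for z unfolding F_def norm_of_real using K F_le[of z] by simp
  show "cnj (F z) = F z" by (simp add: F_def)
  show "0 \<le> C" using b[of 0] norm_ge_zero order_trans by blast
qed

lemma F_borel[measurable]: "F \<in> borel_measurable borel" using F_props(1) by auto

lemma Q_continuous: "continuous_on S Q" unfolding Q_def by (rule cauchy_transform_continuous[OF F_props(1,2)])

lemma Q_borel[measurable]: "Q \<in> borel_measurable borel" using Q_continuous by (intro borel_measurable_continuous_onI)

lemma Q_bounded: obtains CQ where "\<And>x. cmod (Q x) \<le> CQ" "0 \<le> CQ"
  using cauchy_transform_bound[OF F_props(1,2)] unfolding Q_def by (meson norm_ge_zero order_trans)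

lemma wirtinger_u: "wirtinger (\<lambda>x. of_real (u x)) (- Q x / of_real (2 * kern_mass)) (- cnj (Q x) / of_real (2 * kern_mass)) x"
proof -
  have b: "\<bar>K * cmod (z - z0) ^ (2 * n) * exp (u z)\<bar> \<le> C" for z using K F_le[of z] by simp
  let ?w = "log_potential (\<lambda>z. K * cmod (z - z0) ^ (2 * n) * exp (u z))"
  have "wirtinger (\<lambda>x. of_real (?w x)) (Q x / 2) (cnj (Q x) / 2) x"
    using wirtinger_log_potential[OF F_integrable b] by (simp add: Q_def F_def[abs_def])
  moreover have "((\<lambda>t. of_real c0 - t / of_real kern_mass) has_field_derivative - (1 / of_real kern_mass)) (at t)" for t :: complex
    using kern_mass_pos by (auto intro!: derivative_eq_intros)
  ultimately have "wirtinger (\<lambda>x. of_real c0 - of_real (?w x) / of_real kern_mass) (- (1 / of_real kern_mass) * (Q x / 2)) (- (1 / of_real kern_mass) * (cnj (Q x) / 2)) x"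
    by (rule wirtinger_compose_field)
  moreover have "(\<lambda>x. of_real c0 - of_real (?w x) / of_real kern_mass) = (\<lambda>x. complex_of_real (u x))"
    by (subst u_eq) simp
  ultimately show ?thesis by (simp add: mult.commute)
qed

text \<open>The part of the z-derivative of \<open>F\<close> that comes from the weight;
  \<open>A\<close> below is the whole z-derivative.\<close>

definition D1 :: "complex \<Rightarrow> complex" where "D1 z = of_nat n * (F z / (z - z0))"

definition A :: "complex \<Rightarrow> complex" where "A z = D1 z - F z * Q z / of_real (2 * kern_mass)"

lemma F_factor: "F z = of_real K * (z - z0) ^ n * cnj (z - z0) ^ n * exp (of_real (u z))"
proof -
  have "complex_of_real (cmod (z - z0) ^ (2 * n)) = ((z - z0) * cnj (z - z0)) ^ n"
    by (simp add: power_mult complex_norm_square[symmetric] of_real_power del: complex_cnj_diff)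
  then show ?thesis unfolding F_def of_real_mult exp_of_real[symmetric] by (simp add: power_mult_distrib)
qed

text \<open>Shows that the quotient in \<open>D1\<close> is continuous at \<open>z0\<close>: there
  both sides are 0, the left by the default value of division, the right by the conjugate power, or
  by the factor n if n = 0.\<close>

lemma D1_factor: "D1 z = of_nat n * (of_real K * (z - z0) ^ (n - 1) * cnj (z - z0) ^ n * exp (of_real (u z)))"
proof (cases "n = 0 \<or> z = z0")
  case False
  then have "(z - z0) ^ n = (z - z0) * (z - z0) ^ (n - 1)" by (simp add: power_eq_if)
  then show ?thesis using False unfolding D1_def F_factor by simp
qed (auto simp: D1_def power_0_left)

lemma u_continuous: "continuous_on S u"
  using continuous_on_Re[OF wirtinger_continuous[OF wirtinger_u, of S]] by simp

lemma D1_continuous: "continuous_on S D1"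
  unfolding D1_factor[abs_def] by (intro continuous_intros u_continuous)

lemma wirtinger_F: "wirtinger F (A x) (cnj (A x)) x"
proof -
  have p: "wirtinger (\<lambda>z. (z - z0) ^ n) (of_nat n * (x - z0) ^ (n - 1)) 0 x"
    unfolding wirtinger_field_derivative by (auto intro!: derivative_eq_intros)
  have e: "wirtinger (\<lambda>z. exp (of_real (u z))) (exp (of_real (u x)) * (- Q x / of_real (2 * kern_mass))) (exp (of_real (u x)) * (- cnj (Q x) / of_real (2 * kern_mass))) x"
    by (rule wirtinger_compose_field[OF wirtinger_u DERIV_exp])
  have "wirtinger (\<lambda>z. of_real K * (z - z0) ^ n * cnj ((z - z0) ^ n) * exp (of_real (u z)))
     (A x) (cnj (A x)) x"
  proof -
    let ?a = "((0 * (x - z0) ^ n + of_real K * (of_nat n * (x - z0) ^ (n - 1))) * cnj ((x - z0) ^ n) + of_real K * (x - z0) ^ n * cnj 0) * exp (of_real (u x)) +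
      of_real K * (x - z0) ^ n * cnj ((x - z0) ^ n) * (exp (of_real (u x)) * (- Q x / of_real (2 * kern_mass)))"
    let ?b = "((0 * (x - z0) ^ n + of_real K * 0) * cnj ((x - z0) ^ n) + of_real K * (x - z0) ^ n * cnj (of_nat n * (x - z0) ^ (n - 1))) * exp (of_real (u x)) +
      of_real K * (x - z0) ^ n * cnj ((x - z0) ^ n) * (exp (of_real (u x)) * (- cnj (Q x) / of_real (2 * kern_mass)))"
    have w: "wirtinger (\<lambda>z. of_real K * (z - z0) ^ n * cnj ((z - z0) ^ n) * exp (of_real (u z))) ?a ?b x"
      by (rule wirtinger_mult[OF wirtinger_mult[OF wirtinger_mult[OF wirtinger_const p] wirtinger_cnj[OF p]] e])
    have a: "?a = A x" unfolding A_def D1_factor F_factor by (simp add: algebra_simps)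
    have "(\<lambda>z. of_real K * (z - z0) ^ n * cnj ((z - z0) ^ n) * exp (of_real (u z))) = F"
      by (auto simp: F_factor)
    then have w': "wirtinger F (A x) ?b x" using w unfolding a by simp
    \<comment> \<open>\<open>F\<close> is real, so conjugation exchanges its two derivatives, and
      uniqueness identifies the second one without computation.\<close>
    then have "wirtinger F (cnj ?b) (cnj (A x)) x" using wirtinger_cnj[OF w'] by (simp only: F_props(3))
    from wirtinger_unique(2)[OF w' this] have "?b = cnj (A x)" .
    with w a show ?thesis by simp
  qed
  moreover have "(\<lambda>z. of_real K * (z - z0) ^ n * cnj ((z - z0) ^ n) * exp (of_real (u z))) = F"
    by (auto simp: F_factor)
  ultimately show ?thesis by simp
qed

lemma A_continuous: "continuous_on S A"
proof -
  have "continuous_on S F" by (rule wirtinger_continuous[OF wirtinger_F])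
  moreover have "complex_of_real (2 * kern_mass) \<noteq> 0" using kern_mass_pos by simp
  ultimately show ?thesis unfolding A_def by (intro continuous_intros D1_continuous Q_continuous ballI)
qed

lemma integrable_F_over: "integrable lborel (\<lambda>y. F y / (x - y))" "integrable lborel (\<lambda>y. F y / (y - x))"
proof -
  show 1: "integrable lborel (\<lambda>y. F y / (x - y))" by (rule cauchy_transform_integrable'[OF F_props(1,2)])
  have "(\<lambda>y. F y / (y - x)) = (\<lambda>y. - (F y / (x - y)))" by (metis minus_diff_eq minus_divide_right)
  then show "integrable lborel (\<lambda>y. F y / (y - x))" using 1 by simp
qed

lemma FQ_integrable_bounded: "integrable lborel (\<lambda>y. F y * Q y)" "\<exists>c. \<forall>y. cmod (F y * Q y) \<le> c"
proof -
  obtain CQ where CQ: "\<And>x. cmod (Q x) \<le> CQ" "0 \<le> CQ" using Q_bounded by blast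
  show "integrable lborel (\<lambda>y. F y * Q y)" by (rule integrable_bounded_mult[OF F_props(1) Q_borel CQ(1)])
  show "\<exists>c. \<forall>y. cmod (F y * Q y) \<le> c"
    unfolding norm_mult using F_props(2,4) CQ by (intro exI[of _ "C * CQ"] allI mult_mono) auto
qed

lemma D1_integrable_bounded: "integrable lborel D1" "\<exists>c. \<forall>y. cmod (D1 y) \<le> c"
proof -
  show "integrable lborel D1" unfolding D1_def[abs_def] by (intro integrable_mult_right integrable_F_over)
  obtain b where b: "\<And>z. z \<in> cball z0 1 \<Longrightarrow> cmod (D1 z) \<le> b"
    using compact_imp_bounded[OF compact_continuous_image[OF D1_continuous compact_cball]] unfolding bounded_iff by blast
  have "cmod (D1 z) \<le> max b (real n * C)" for z
  proof (cases "z \<in> cball z0 1")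
    case False
    then have "1 \<le> cmod (z - z0)" by (simp add: dist_norm norm_minus_commute)
    then have "cmod (F z) / cmod (z - z0) \<le> C / 1" using F_props(2,4) by (intro frac_le) auto
    then have "real n * (cmod (F z) / cmod (z - z0)) \<le> real n * C" by (intro mult_left_mono) auto
    then have "cmod (D1 z) \<le> real n * C" unfolding D1_def norm_mult norm_divide by simp
    then show ?thesis by simp
  qed (use b in \<open>auto intro: max.coboundedI1\<close>)
  then show "\<exists>c. \<forall>y. cmod (D1 y) \<le> c" by blast
qed

lemma A_integrable_bounded: "integrable lborel A" "\<exists>c. \<forall>y. cmod (A y) \<le> c"
proof -
  show "integrable lborel A" unfolding A_def[abs_def] using D1_integrable_bounded(1) FQ_integrable_bounded(1) by simp
  obtain c1 c2 where c: "\<And>y. cmod (D1 y) \<le> c1" "\<And>y. cmod (F y * Q y) \<le> c2" using D1_integrable_bounded(2) FQ_integrable_bounded(2) by blast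
  have "cmod (A y) \<le> c1 + c2 / (2 * kern_mass)" for y
  proof -
    have "cmod (F y * Q y / of_real (2 * kern_mass)) \<le> c2 / (2 * kern_mass)"
      unfolding norm_divide using c(2)[of y] kern_mass_pos by (simp add: divide_right_mono)
    then show ?thesis unfolding A_def using c(1)[of y] by (intro order_trans[OF norm_triangle_ineq4 add_mono])
  qed
  then show "\<exists>c. \<forall>y. cmod (A y) \<le> c" by blast
qed

lemma product_integrable:
  fixes f :: "complex \<Rightarrow> complex"
  assumes f: "integrable lborel f"
  shows "integrable (lborel \<Otimes>\<^sub>M lborel) (\<lambda>(y, y'). f y * (F y' / (y - y')))"
proof (rule lborel_pair.Fubini_integrable)
  have [measurable]: "f \<in> borel_measurable borel" using f by auto
  define D where "D = C * inv_norm_mass + (\<integral>y. norm (F y) \<partial>lborel)"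
  have D: "(\<integral>y'. norm (F y') / cmod (y - y') \<partial>lborel) \<le> D" for y unfolding D_def by (rule cauchy_transform_integrable(2)[OF F_props(1,2)])
  have D0: "0 \<le> D" using D[of 0] by (rule order_trans[rotated]) (intro Bochner_Integration.integral_nonneg, simp)
  show "(\<lambda>(y, y'). f y * (F y' / (y - y'))) \<in> borel_measurable (lborel \<Otimes>\<^sub>M lborel)" by measurable
  show "AE y in lborel. integrable lborel (\<lambda>y'. case (y, y') of (y, y') \<Rightarrow> f y * (F y' / (y - y')))"
    unfolding prod.case by (intro AE_I2 integrable_mult_right integrable_F_over)
  show "integrable lborel (\<lambda>y. \<integral>y'. norm (case (y, y') of (y, y') \<Rightarrow> f y * (F y' / (y - y'))) \<partial>lborel)"
  proof (rule Bochner_Integration.integrable_bound)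
    show "integrable lborel (\<lambda>y. D * norm (f y))" using f by simp
    show "AE y in lborel. norm (\<integral>y'. norm (case (y, y') of (y, y') \<Rightarrow> f y * (F y' / (y - y'))) \<partial>lborel) \<le> norm (D * norm (f y))"
    proof (intro AE_I2)
      fix y
      have "(\<integral>y'. norm (case (y, y') of (y, y') \<Rightarrow> f y * (F y' / (y - y'))) \<partial>lborel) = norm (f y) * (\<integral>y'. norm (F y') / cmod (y - y') \<partial>lborel)"
        unfolding prod.case norm_mult norm_divide by (rule integral_mult_right_zero)
      moreover have "0 \<le> (\<integral>y'. norm (F y') / cmod (y - y') \<partial>lborel)" by (intro Bochner_Integration.integral_nonneg) simp
      ultimately show "norm (\<integral>y'. norm (case (y, y') of (y, y') \<Rightarrow> f y * (F y' / (y - y'))) \<partial>lborel) \<le> norm (D * norm (f y))"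
        using mult_left_mono[OF D[of y] norm_ge_zero[of "f y"]] D0 by (simp add: abs_mult mult.commute)
    qed
  qed measurable
qed

lemma FQ_iterated: "(\<integral>y'. f y * (F y' / (y - y')) \<partial>lborel) = f y * Q y"
  unfolding integral_mult_right_zero Q_def cauchy_transform_def ..

text \<open>As a double integral it has the symmetric density \<open>F y * F y'\<close> against the
  antisymmetric kernel \<open>1 / (y - y')\<close>; exchanging the variables changes the
  sign.\<close>

lemma integral_FQ: "(\<integral>y. F y * Q y \<partial>lborel) = 0"
proof -
  have i: "integrable (lborel \<Otimes>\<^sub>M lborel) (\<lambda>(y, y'). F y * (F y' / (y - y')))" by (rule product_integrable[OF F_props(1)])
  let ?I = "\<integral>y. F y * Q y \<partial>lborel"
  have "?I = (\<integral>y. (\<integral>y'. F y * (F y' / (y - y')) \<partial>lborel) \<partial>lborel)" unfolding FQ_iterated ..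
  also have "\<dots> = (\<integral>y'. (\<integral>y. F y * (F y' / (y - y')) \<partial>lborel) \<partial>lborel)" using lborel_pair.Fubini_integral[OF i] by simp
  also have "\<dots> = (\<integral>y'. (\<integral>y. - (F y' * (F y / (y' - y))) \<partial>lborel) \<partial>lborel)"
  proof (intro Bochner_Integration.integral_cong refl)
    fix y y' show "F y * (F y' / (y - y')) = - (F y' * (F y / (y' - y)))"
      using minus_divide_right[of "F y * F y'" "y' - y"] by (simp add: mult.commute)
  qed
  also have "\<dots> = - ?I" unfolding Bochner_Integration.integral_minus FQ_iterated ..
  finally show ?thesis by (simp add: eq_neg_iff_add_eq_0)
qed

text \<open>\<open>A\<close> is a derivative of an integrable function, so its integral vanishes,
  and its second summand already integrates to zero.\<close>

lemma integral_D1: "(\<integral>y. D1 y \<partial>lborel) = 0"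
proof -
  have "continuous_on UNIV (\<lambda>x. cnj (A x))" by (intro continuous_intros A_continuous)
  then have "(\<integral>y. A y \<partial>lborel) = 0"
    using wirtinger_integral_zero(1)[OF wirtinger_F A_continuous _ F_props(1) A_integrable_bounded(1)] A_integrable_bounded(1) by simp
  moreover have "(\<integral>y. A y \<partial>lborel) = (\<integral>y. D1 y \<partial>lborel) - (\<integral>y. F y * Q y \<partial>lborel) / of_real (2 * kern_mass)"
    unfolding A_def using D1_integrable_bounded(1) FQ_integrable_bounded(1) by simp
  ultimately show ?thesis by (simp add: integral_FQ)
qed

text \<open>Symmetrisation of the partial fraction \<open>1/((x-y)(x-y')) = 1/((x-y)(y-y')) + 1/((x-y')(y'-y))\<close>.\<close>

lemma cauchy_transform_FQ: "cauchy_transform (\<lambda>y. F y * Q y) x = (Q x)\<^sup>2 / 2"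
proof -
  let ?G = "\<lambda>y y'. (F y / (x - y)) * (F y' / (y - y'))"
  have i: "integrable (lborel \<Otimes>\<^sub>M lborel) (\<lambda>(y, y'). ?G y y')" by (rule product_integrable[OF integrable_F_over(1)])
  have i': "integrable (lborel \<Otimes>\<^sub>M lborel) (\<lambda>(y, y'). ?G y' y)" using lborel_pair.integrable_product_swap[OF i] by simp
  have G: "(\<integral>y. (\<integral>y'. ?G y y' \<partial>lborel) \<partial>lborel) = cauchy_transform (\<lambda>y. F y * Q y) x"
    unfolding FQ_iterated[where f="\<lambda>y. F y / (x - y)"] cauchy_transform_def by simp
  have "(Q x)\<^sup>2 = (\<integral>y. (F y / (x - y)) * Q x \<partial>lborel)"
    unfolding integral_mult_left_zero by (simp add: Q_def cauchy_transform_def power2_eq_square)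
  also have "\<dots> = (\<integral>y. (\<integral>y'. (F y / (x - y)) * (F y' / (x - y')) \<partial>lborel) \<partial>lborel)"
    unfolding integral_mult_right_zero by (simp add: Q_def cauchy_transform_def)
  also have "\<dots> = (\<integral>y. (\<integral>y'. ?G y y' \<partial>lborel) + (\<integral>y'. ?G y' y \<partial>lborel) \<partial>lborel)"
  proof (rule integral_cong_AE)
    have "AE y in lborel. integrable lborel (\<lambda>y'. ?G y' y)" using lborel_pair.AE_integrable_fst'[OF i'] by simp
    moreover have "AE y in lborel. y \<noteq> x" by (rule AE_lborel_singleton)
    ultimately show "AE y in lborel. (\<integral>y'. (F y / (x - y)) * (F y' / (x - y')) \<partial>lborel) = (\<integral>y'. ?G y y' \<partial>lborel) + (\<integral>y'. ?G y' y \<partial>lborel)"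
    proof eventually_elim
      fix y assume iy: "integrable lborel (\<lambda>y'. ?G y' y)" and yx: "y \<noteq> x"
      have iy': "integrable lborel (\<lambda>y'. ?G y y')" by (intro integrable_mult_right integrable_F_over)
      have "(\<integral>y'. (F y / (x - y)) * (F y' / (x - y')) \<partial>lborel) = (\<integral>y'. ?G y y' + ?G y' y \<partial>lborel)"
      proof (rule integral_cong_AE)
        have "AE y' in lborel. y' \<noteq> x" "AE y' in lborel. y' \<noteq> y" by (rule AE_lborel_singleton)+
        then show "AE y' in lborel. (F y / (x - y)) * (F y' / (x - y')) = ?G y y' + ?G y' y"
        proof eventually_elim
          fix y' assume "y' \<noteq> x" "y' \<noteq> y"
          then have nz: "x - y \<noteq> 0" "x - y' \<noteq> 0" "y - y' \<noteq> 0" "y' - y \<noteq> 0" using yx by auto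
          have "1 / ((x - y) * (x - y')) = 1 / ((x - y) * (y - y')) + 1 / ((x - y') * (y' - y))"
          proof -
            have "1 / ((x - y') * (y' - y)) = - (1 / ((x - y') * (y - y')))" by (metis minus_diff_eq minus_divide_right mult_minus_right)
            moreover have "1 / ((x - y) * (y - y')) - 1 / ((x - y') * (y - y')) = 1 / ((x - y) * (x - y'))"
              using nz by (simp add: divide_simps) 
            ultimately show ?thesis by simp
          qed
          then have "F y * F y' * (1 / ((x - y) * (x - y'))) = F y * F y' * (1 / ((x - y) * (y - y'))) + F y * F y' * (1 / ((x - y') * (y' - y)))"
            by (simp only: distrib_left)
          then show "(F y / (x - y)) * (F y' / (x - y')) = ?G y y' + ?G y' y" by (simp add: mult.commute)
        qed
      qed measurable
      then show "(\<integral>y'. (F y / (x - y)) * (F y' / (x - y')) \<partial>lborel) = (\<integral>y'. ?G y y' \<partial>lborel) + (\<integral>y'. ?G y' y \<partial>lborel)"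
        using iy iy' by simp
    qed
  qed measurable
  also have "\<dots> = (\<integral>y. (\<integral>y'. ?G y y' \<partial>lborel) \<partial>lborel) + (\<integral>y. (\<integral>y'. ?G y' y \<partial>lborel) \<partial>lborel)"
    by (rule Bochner_Integration.integral_add) (use lborel_pair.integrable_fst'[OF i] lborel_pair.integrable_fst'[OF i'] in simp_all)
  \<comment> \<open>Exchanging the order makes the second half equal to the first; this is the 2 in
    the denominator of the claim.\<close>
  also have "(\<integral>y. (\<integral>y'. ?G y' y \<partial>lborel) \<partial>lborel) = (\<integral>y'. (\<integral>y. ?G y' y \<partial>lborel) \<partial>lborel)"
    using lborel_pair.Fubini_integral[OF i] by simp
  finally show ?thesis unfolding G by simp
qed

text \<open>Partial fractions: \<open>1/((y - z0)(x - y))\<close> is \<open>1/(x - z0)\<close> times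
  the sum of \<open>1/(y - z0)\<close> and \<open>1/(x - y)\<close>. The first summand reproduces
  the integral of \<open>D1\<close>, which is zero, and the second reproduces
  \<open>Q x\<close>.\<close>

lemma cauchy_transform_D1: assumes x: "x \<noteq> z0" shows "cauchy_transform D1 x = of_nat n * (Q x / (x - z0))"
proof -
  have "AE y in lborel. y \<noteq> x" "AE y in lborel. y \<noteq> z0" by (rule AE_lborel_singleton)+
  then have ae: "AE y in lborel. D1 y / (x - y) = (1 / (x - z0)) * (D1 y + of_nat n * (F y / (x - y)))"
  proof eventually_elim
    fix y assume "y \<noteq> x" "y \<noteq> z0"
    then have nz: "x - y \<noteq> 0" "y - z0 \<noteq> 0" "x - z0 \<noteq> 0" using x by auto
    have "1 / ((y - z0) * (x - y)) = (1 / (x - z0)) * (1 / (y - z0) + 1 / (x - y))"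
      using nz by (simp add: divide_simps)
    then have "of_nat n * F y * (1 / ((y - z0) * (x - y))) = of_nat n * F y * ((1 / (x - z0)) * (1 / (y - z0) + 1 / (x - y)))"
      by (simp only:)
    then show "D1 y / (x - y) = (1 / (x - z0)) * (D1 y + of_nat n * (F y / (x - y)))"
      unfolding D1_def by (simp add: distrib_left add_divide_distrib mult.commute)
  qed
  have [measurable]: "D1 \<in> borel_measurable borel" using D1_integrable_bounded(1) by auto
  have i: "integrable lborel (\<lambda>y. of_nat n * (F y / (x - y)))" by (intro integrable_mult_right integrable_F_over)
  have "cauchy_transform D1 x = (\<integral>y. (1 / (x - z0)) * (D1 y + of_nat n * (F y / (x - y))) \<partial>lborel)"
    unfolding cauchy_transform_def by (rule integral_cong_AE[OF _ _ ae]) measurable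
  also have "\<dots> = (1 / (x - z0)) * ((\<integral>y. D1 y \<partial>lborel) + of_nat n * Q x)"
    unfolding Q_def cauchy_transform_def by (simp only: integral_mult_right_zero Bochner_Integration.integral_add[OF D1_integrable_bounded(1) i])
  finally show ?thesis by (simp add: integral_D1)
qed

text \<open>The z-derivative is the Cauchy transform of \<open>A\<close>, evaluated by the two
  preceding formulas. The other derivative is the Cauchy transform of \<open>cnj A\<close>, the
  derivative of \<open>F\<close> with respect to \<open>cnj z\<close>, so Cauchy--Pompeiu returns
  \<open>F\<close>.\<close>

lemma wirtinger_Q:
  assumes x: "x \<noteq> z0"
  shows "wirtinger Q (of_nat n * (Q x / (x - z0)) - (Q x)\<^sup>2 / of_real (4 * kern_mass)) (of_real (kern_mass / 2) * F x) x"
proof -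
  obtain c where c: "\<And>y. cmod (A y) \<le> c" using A_integrable_bounded(2) by blast
  have cA: "continuous_on UNIV (\<lambda>x. cnj (A x))" by (intro continuous_intros A_continuous)
  have iA: "integrable lborel (\<lambda>x. cnj (A x))" using A_integrable_bounded(1) by simp
  have b: "cmod (F y) \<le> max C c" "cmod (A y) \<le> max C c" "cmod (cnj (A y)) \<le> max C c" for y
    using F_props(2)[of y] c[of y] by (auto intro: max.coboundedI1 max.coboundedI2)
  have w: "wirtinger Q (cauchy_transform A x) (cauchy_transform (\<lambda>x. cnj (A x)) x) x"
    unfolding Q_def by (rule wirtinger_cauchy_transform[OF wirtinger_F A_continuous cA F_props(1) A_integrable_bounded(1) iA b])
  have "cauchy_transform (\<lambda>x. cnj (A x)) x = of_real (kern_mass / 2) * F x"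
    by (rule cauchy_pompeiu[OF wirtinger_F A_continuous cA F_props(1) A_integrable_bounded(1) iA b(1) b(3)])
  moreover have "cauchy_transform A x = of_nat n * (Q x / (x - z0)) - (Q x)\<^sup>2 / of_real (4 * kern_mass)"
  proof -
    obtain c1 c2 where c12: "\<And>y. cmod (D1 y) \<le> c1" "\<And>y. cmod (F y * Q y) \<le> c2" using D1_integrable_bounded(2) FQ_integrable_bounded(2) by blast
    have "cauchy_transform A x = (\<integral>y. D1 y / (x - y) - (1 / of_real (2 * kern_mass)) * (F y * Q y / (x - y)) \<partial>lborel)"
      unfolding cauchy_transform_def A_def by (simp add: diff_divide_distrib mult.commute)
    also have "\<dots> = cauchy_transform D1 x - (1 / of_real (2 * kern_mass)) * cauchy_transform (\<lambda>y. F y * Q y) x"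
      unfolding cauchy_transform_def
      by (subst Bochner_Integration.integral_diff, rule cauchy_transform_integrable'[OF D1_integrable_bounded(1) c12(1)],
          intro integrable_mult_right cauchy_transform_integrable'[OF FQ_integrable_bounded(1) c12(2)], simp only: integral_mult_right_zero)
    finally show ?thesis unfolding cauchy_transform_D1[OF x] cauchy_transform_FQ by simp
  qed
  ultimately show ?thesis using w by (simp only:)
qed

end

section \<open>Classification\<close>

lemma of_real_norm_power_even: "complex_of_real (cmod z ^ (2 * n)) = (z * cnj z) ^ n"
  by (simp add: power_mult complex_norm_square[symmetric] of_real_power)

lemma DERIV_shift_power: "((\<lambda>z. (z - a) ^ Suc n) has_field_derivative of_nat (Suc n) * (x - a) ^ n) (at x)"
  for x :: complex
proof -
  have "((\<lambda>z. z - a) has_field_derivative 1) (at x)" by (auto intro!: derivative_eq_intros)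
  from DERIV_power[OF this, of "Suc n"] show ?thesis by simp
qed

lemma holomorphic_real_valued_imp_constant:
  assumes S: "open S" "connected S" and f: "f holomorphic_on S" and im: "\<And>x. x \<in> S \<Longrightarrow> Im (f x) = 0"
  obtains c where "\<And>x. x \<in> S \<Longrightarrow> f x = of_real c"
proof -
  have "(f has_field_derivative 0) (at z)" if z: "z \<in> S" for z
  proof -
    have d: "(f has_field_derivative deriv f z) (at z)" using f z holomorphic_derivI S by blast
    then have "((\<lambda>x. Im (f x)) has_derivative (\<lambda>h. Im (deriv f z * h))) (at z)"
      unfolding has_field_derivative_def by (rule bounded_linear.has_derivative[OF bounded_linear_Im])
    moreover have "((\<lambda>x. Im (f x)) has_derivative (\<lambda>h. 0)) (at z)"
    proof -
      have "((\<lambda>x. 0) has_derivative (\<lambda>h. 0)) (at z)" by simp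
      then show ?thesis by (rule has_derivative_transform_within_open[OF _ S(1) z]) (simp add: im)
    qed
    ultimately have e: "(\<lambda>h. Im (deriv f z * h)) = (\<lambda>h. 0)" by (rule has_derivative_unique)
    from fun_cong[OF e, of 1] fun_cong[OF e, of \<i>] have "deriv f z = 0" by (simp add: complex_eq_iff)
    with d show ?thesis by simp
  qed
  then have "f constant_on S"
    using DERIV_zero_connected_constant_on[of S "{}" f] S holomorphic_on_imp_continuous_on[OF f] by auto
  then obtain k where k: "\<And>x. x \<in> S \<Longrightarrow> f x = k" unfolding constant_on_def by blast
  have "f x = of_real (Re k)" if "x \<in> S" for x using k[OF that] im[OF that] by (simp add: complex_eq_iff)
  then show ?thesis using that by blast
qed

section \<open>Integration of the Riccati equation\<close>

context liouville_integral_equation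
begin

definition v :: "complex \<Rightarrow> complex" where "v x = of_real (exp (- u x / 2))"

lemma wirtinger_v: "wirtinger v (v x * Q x / of_real (4 * kern_mass)) (v x * cnj (Q x) / of_real (4 * kern_mass)) x"
proof -
  have e: "v = (\<lambda>x. exp (- (1/2) * of_real (u x)))" by (auto simp: v_def exp_of_real[symmetric])
  have "((\<lambda>t. exp (- (1/2) * t)) has_field_derivative (- (1/2) * exp (- (1/2) * of_real (u x)))) (at (of_real (u x)))"
    by (auto intro!: derivative_eq_intros)
  from wirtinger_compose_field[OF wirtinger_u this]
  have "wirtinger v (- (1/2) * v x * (- Q x / of_real (2 * kern_mass))) (- (1/2) * v x * (- cnj (Q x) / of_real (2 * kern_mass))) x"
    unfolding e .
  moreover have "- (1/2) * v x * (- t / of_real (2 * kern_mass)) = v x * t / of_real (4 * kern_mass)" for t by simp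
  ultimately show ?thesis by (simp only:)
qed

text \<open>Up to the factor \<open>4 * kern_mass\<close> this is the derivative of \<open>v\<close>
  with respect to \<open>cnj z\<close>, divided by that of the conjugate of
  \<open>(z - z0)^(n+1) / (n+1)\<close>; the Riccati equation makes it holomorphic off
  \<open>z0\<close>.\<close>

definition p :: "complex \<Rightarrow> complex" where "p x = v x * cnj (Q x) / cnj (x - z0) ^ n"

text \<open>Off \<open>z0\<close> this is \<open>kern_mass\<close> times the Laplacian of
  \<open>v\<close>. That it is real is what pins down \<open>p\<close>.\<close>

definition E :: "complex \<Rightarrow> real" where "E x = exp (- u x / 2) * ((kern_mass / 2) * (K * cmod (x - z0) ^ (2 * n) * exp (u x)) + (cmod (Q x))\<^sup>2 / (4 * kern_mass))"

text \<open>The conjugate of \<open>p\<close> is \<open>v Q / (z - z0)^n\<close>. In its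
  z-derivative the quadratic term of the Riccati equation cancels against the derivative of
  \<open>v\<close>, and the linear term against the derivative of the inverse power. So only the
  derivative with respect to \<open>cnj z\<close> remains, which after conjugation is the complex
  derivative of \<open>p\<close>.\<close>

lemma DERIV_p:
  assumes x: "x \<noteq> z0"
  shows "(p has_field_derivative (of_real (E x) / cnj (x - z0) ^ n)) (at x)"
proof -
  define \<zeta> where "\<zeta> = x - z0"
  have \<zeta>: "\<zeta> \<noteq> 0" using x by (simp add: \<zeta>_def)
  let ?qz = "of_nat n * (Q x / (x - z0)) - (Q x)\<^sup>2 / of_real (4 * kern_mass)"
  have i: "wirtinger (\<lambda>z. inverse ((z - z0) ^ n)) (- (of_nat n * (x - z0) ^ (n - 1) * (inverse ((x - z0) ^ n))\<^sup>2)) 0 x"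
    unfolding wirtinger_field_derivative using x by (auto intro!: derivative_eq_intros simp: power2_eq_square)
  have w: "wirtinger (\<lambda>z. v z * Q z * inverse ((z - z0) ^ n))
     ((v x * Q x / of_real (4 * kern_mass) * Q x + v x * ?qz) * inverse ((x - z0) ^ n) + v x * Q x * (- (of_nat n * (x - z0) ^ (n - 1) * (inverse ((x - z0) ^ n))\<^sup>2)))
     ((v x * cnj (Q x) / of_real (4 * kern_mass) * Q x + v x * (of_real (kern_mass / 2) * F x)) * inverse ((x - z0) ^ n) + v x * Q x * 0) x"
    by (rule wirtinger_mult[OF wirtinger_mult[OF wirtinger_v wirtinger_Q[OF x]] i])
  have a: "(v x * Q x / of_real (4 * kern_mass) * Q x + v x * ?qz) * inverse ((x - z0) ^ n) + v x * Q x * (- (of_nat n * (x - z0) ^ (n - 1) * (inverse ((x - z0) ^ n))\<^sup>2)) = 0"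
  proof -
    have 1: "of_nat n * \<zeta> ^ (n - 1) * (inverse (\<zeta> ^ n))\<^sup>2 = of_nat n / \<zeta> * inverse (\<zeta> ^ n)"
      using \<zeta> by (cases n) (auto simp: power2_eq_square field_simps)
    have "v x * Q x / of_real (4 * kern_mass) * Q x + v x * ?qz = v x * Q x * (of_nat n / \<zeta>)"
      by (simp add: \<zeta>_def algebra_simps power2_eq_square)
    then show ?thesis unfolding \<zeta>_def[symmetric] 1 by simp
  qed
  have b: "(v x * cnj (Q x) / of_real (4 * kern_mass) * Q x + v x * (of_real (kern_mass / 2) * F x)) * inverse ((x - z0) ^ n) + v x * Q x * 0 = of_real (E x) / (x - z0) ^ n"
  proof -
    have "cnj (Q x) * Q x = of_real ((cmod (Q x))\<^sup>2)" by (metis complex_norm_square mult.commute)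
    then have "v x * cnj (Q x) / of_real (4 * kern_mass) * Q x + v x * (of_real (kern_mass / 2) * F x) = v x * (of_real (kern_mass / 2) * F x + of_real ((cmod (Q x))\<^sup>2) / of_real (4 * kern_mass))"
      by (simp add: algebra_simps)
    also have "\<dots> = of_real (E x)" by (simp add: v_def F_def E_def)
    finally have eq: "v x * cnj (Q x) / of_real (4 * kern_mass) * Q x + v x * (of_real (kern_mass / 2) * F x) = of_real (E x)" .
    show ?thesis unfolding eq by (simp only: divide_inverse mult_zero_right add_0_right)
  qed
  have "cnj (v z * Q z * inverse ((z - z0) ^ n)) = p z" for z
  proof -
    have "cnj (v z) = v z" by (simp add: v_def)
    then show ?thesis by (simp only: complex_cnj_mult complex_cnj_inverse complex_cnj_power p_def divide_inverse)
  qed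
  then have "wirtinger p (cnj (of_real (E x) / (x - z0) ^ n)) (cnj 0) x"
    using wirtinger_cnj[OF w] unfolding a b by (simp only:)
  then have "wirtinger p (of_real (E x) / cnj (x - z0) ^ n) 0 x"
    by (simp only: complex_cnj_divide complex_cnj_power complex_cnj_complex_of_real complex_cnj_zero)
  then show ?thesis by (simp only: wirtinger_field_derivative)
qed

lemma punctured: "open (- {z0})" "connected (- {z0})"
  by (auto intro: connected_punctured_universe)

text \<open>The quotient of the derivative of \<open>p\<close> by \<open>(z - z0)^n\<close> is
  holomorphic on the connected punctured plane and equals the real number
  \<open>E / |z - z0|^(2n)\<close>, hence is constant.\<close>

lemma p_eq:
  obtains b \<gamma> where "\<And>x. x \<noteq> z0 \<Longrightarrow> p x = b + of_real \<gamma> * (x - z0) ^ Suc n"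
    "\<And>x. x \<noteq> z0 \<Longrightarrow> E x = real (Suc n) * \<gamma> * cmod (x - z0) ^ (2 * n)"
proof -
  let ?S = "- {z0}"
  have ph: "p holomorphic_on ?S" using DERIV_p punctured by (auto simp: holomorphic_on_open)
  have dp: "deriv p x = of_real (E x) / cnj (x - z0) ^ n" if "x \<in> ?S" for x using DERIV_imp_deriv[OF DERIV_p] that by auto
  define s where "s x = deriv p x / (x - z0) ^ n" for x
  have sh: "s holomorphic_on ?S" unfolding s_def by (intro holomorphic_intros holomorphic_deriv ph punctured) auto
  have seq: "s x = of_real (E x / cmod (x - z0) ^ (2 * n))" if "x \<in> ?S" for x
  proof -
    have "cnj (x - z0) ^ n * (x - z0) ^ n = of_real (cmod (x - z0) ^ (2 * n))"
      unfolding of_real_norm_power_even power_mult_distrib by (rule mult.commute)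
    then show ?thesis unfolding s_def dp[OF that] by (simp del: complex_cnj_diff)
  qed
  obtain c where c: "\<And>x. x \<in> ?S \<Longrightarrow> s x = of_real c"
    using holomorphic_real_valued_imp_constant[OF punctured sh] seq by (metis Im_complex_of_real)
  \<comment> \<open>The integration of \<open>c (z - z0)^n\<close> divides by n + 1.\<close>
  define \<gamma> where "\<gamma> = c / real (Suc n)"
  have cg: "c = real (Suc n) * \<gamma>" by (simp add: \<gamma>_def)
  have E: "E x = real (Suc n) * \<gamma> * cmod (x - z0) ^ (2 * n)" if "x \<noteq> z0" for x
  proof -
    have "E x / cmod (x - z0) ^ (2 * n) = c" using c[of x] seq[of x] that by (metis ComplI of_real_eq_iff singletonD)
    then show ?thesis using that cg by (simp add: field_simps)
  qed
  have "((\<lambda>x. p x - of_real \<gamma> * (x - z0) ^ Suc n) has_field_derivative 0) (at x)" if x: "x \<in> ?S" for x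
  proof -
    have "deriv p x = of_real c * (x - z0) ^ n" using c[OF x] x by (simp add: s_def field_simps)
    then have "(p has_field_derivative of_real c * (x - z0) ^ n) (at x)" using DERIV_p[of x] dp[OF x] x by auto
    moreover have "((\<lambda>x. of_real \<gamma> * (x - z0) ^ Suc n) has_field_derivative of_real c * (x - z0) ^ n) (at x)"
      using DERIV_cmult[OF DERIV_shift_power, of "of_real \<gamma>" z0 n x] unfolding cg by (simp add: algebra_simps)
    ultimately show ?thesis using DERIV_diff by fastforce
  qed
  then have "(\<lambda>x. p x - of_real \<gamma> * (x - z0) ^ Suc n) constant_on ?S"
  proof (intro DERIV_zero_connected_constant_on[where K="{}"] punctured)
    show "continuous_on ?S (\<lambda>x. p x - of_real \<gamma> * (x - z0) ^ Suc n)"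
      by (intro continuous_intros holomorphic_on_imp_continuous_on ph)
  qed auto
  then obtain b where "\<And>x. x \<in> ?S \<Longrightarrow> p x - of_real \<gamma> * (x - z0) ^ Suc n = b" unfolding constant_on_def by blast
  then have "p x = b + of_real \<gamma> * (x - z0) ^ Suc n" if "x \<noteq> z0" for x using that by (metis ComplI add.commute diff_add_cancel singletonD)
  then show ?thesis using E that by blast
qed

text \<open>With \<open>p\<close> known, both derivatives of \<open>v\<close> are known off
  \<open>z0\<close>. The real polynomial \<open>h\<close> in \<zeta> = \<open>(z - z0)^(n+1)\<close>
  has the matching derivatives, so \<open>v\<close> and \<open>h\<close> differ by a factor and an
  additive constant. The relation between the coefficients is the equation for \<open>E\<close>,
  read off at one point.\<close>

lemma explicit_v:
  shows "\<exists>\<alpha> \<gamma> b. (\<forall>x. exp (- u x / 2) = \<alpha> + (2 * Re (cnj b * (x - z0) ^ Suc n) + \<gamma> * (cmod ((x - z0) ^ Suc n))\<^sup>2) / (4 * kern_mass * real (Suc n)))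
    \<and> \<alpha> > 0 \<and> real (Suc n) * \<gamma> * \<alpha> = (kern_mass / 2) * K + (cmod b)\<^sup>2 / (4 * kern_mass)"
proof -
  obtain b \<gamma> where pb: "\<And>x. x \<noteq> z0 \<Longrightarrow> p x = b + of_real \<gamma> * (x - z0) ^ Suc n"
    and Eg: "\<And>x. x \<noteq> z0 \<Longrightarrow> E x = real (Suc n) * \<gamma> * cmod (x - z0) ^ (2 * n)"
    using p_eq by blast
  \<comment> \<open>Clears the \<open>4 * kern_mass\<close> in the derivatives of \<open>v\<close>
    and the n + 1 from differentiating \<zeta>.\<close>
  define M where "M = 4 * kern_mass * real (Suc n)"
  have M: "M > 0" unfolding M_def using kern_mass_pos by simp
  define h where "h x = (cnj b * (x - z0) ^ Suc n + b * cnj ((x - z0) ^ Suc n) + of_real \<gamma> * ((x - z0) ^ Suc n * cnj ((x - z0) ^ Suc n)))" for x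
  have h_real: "h x = of_real (2 * Re (cnj b * (x - z0) ^ Suc n) + \<gamma> * (cmod ((x - z0) ^ Suc n))\<^sup>2)" for x
  proof -
    have "cnj b * w + b * cnj w + of_real \<gamma> * (w * cnj w) = of_real (2 * Re (cnj b * w) + \<gamma> * (cmod w)\<^sup>2)" for w
    proof -
      have "b * cnj w = cnj (cnj b * w)" by simp
      then have "cnj b * w + b * cnj w = of_real (2 * Re (cnj b * w))" by (simp only: complex_add_cnj)
      moreover have "w * cnj w = of_real ((cmod w)\<^sup>2)" by (metis complex_norm_square)
      ultimately show ?thesis by (simp only: of_real_add of_real_mult)
    qed
    then show ?thesis unfolding h_def .
  qed
  have dh: "wirtinger h (of_nat (Suc n) * (x - z0) ^ n * cnj (b + of_real \<gamma> * (x - z0) ^ Suc n)) (of_nat (Suc n) * cnj (x - z0) ^ n * (b + of_real \<gamma> * (x - z0) ^ Suc n)) x" for x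
  proof -
    have w: "wirtinger (\<lambda>z. (z - z0) ^ Suc n) (of_nat (Suc n) * (x - z0) ^ n) 0 x"
      unfolding wirtinger_field_derivative by (rule DERIV_shift_power)
    have 1: "wirtinger (\<lambda>z. cnj b * (z - z0) ^ Suc n) (0 * (x - z0) ^ Suc n + cnj b * (of_nat (Suc n) * (x - z0) ^ n)) (0 * (x - z0) ^ Suc n + cnj b * 0) x"
      by (rule wirtinger_mult[OF wirtinger_const w])
    have 2: "wirtinger (\<lambda>z. b * cnj ((z - z0) ^ Suc n)) (0 * cnj ((x - z0) ^ Suc n) + b * cnj 0) (0 * cnj ((x - z0) ^ Suc n) + b * cnj (of_nat (Suc n) * (x - z0) ^ n)) x"
      by (rule wirtinger_mult[OF wirtinger_const wirtinger_cnj[OF w]])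
    have 3: "wirtinger (\<lambda>z. of_real \<gamma> * ((z - z0) ^ Suc n * cnj ((z - z0) ^ Suc n)))
       (0 * ((x - z0) ^ Suc n * cnj ((x - z0) ^ Suc n)) + of_real \<gamma> * (of_nat (Suc n) * (x - z0) ^ n * cnj ((x - z0) ^ Suc n) + (x - z0) ^ Suc n * cnj 0))
       (0 * ((x - z0) ^ Suc n * cnj ((x - z0) ^ Suc n)) + of_real \<gamma> * (0 * cnj ((x - z0) ^ Suc n) + (x - z0) ^ Suc n * cnj (of_nat (Suc n) * (x - z0) ^ n))) x"
      by (rule wirtinger_mult[OF wirtinger_const wirtinger_mult[OF w wirtinger_cnj[OF w]]])
    show ?thesis using wirtinger_add[OF wirtinger_add[OF 1 2] 3] unfolding h_def[abs_def]
      by (rule back_subst[of "\<lambda>(a, b). wirtinger _ a b x" "(_, _)" "(_, _)", simplified]) (simp add: algebra_simps)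
  qed
  define d where "d x = of_real M * v x - h x" for x
  have d0: "(d has_derivative (\<lambda>v. 0)) (at x)" if x: "x \<noteq> z0" for x
  proof -
    have 1: "v x * cnj (Q x) = cnj (x - z0) ^ n * (b + of_real \<gamma> * (x - z0) ^ Suc n)"
      using pb[OF x] x by (simp add: p_def field_simps del: complex_cnj_diff)
    then have "cnj (v x * cnj (Q x)) = cnj (cnj (x - z0) ^ n * (b + of_real \<gamma> * (x - z0) ^ Suc n))" by (simp only:)
    then have 2: "v x * Q x = (x - z0) ^ n * cnj (b + of_real \<gamma> * (x - z0) ^ Suc n)" by (simp add: v_def)
    have Mk: "of_real M / of_real (4 * kern_mass) = (of_nat (Suc n) :: complex)" unfolding M_def using kern_mass_pos by simp
    have "wirtinger (\<lambda>x. of_real M * v x) (0 * v x + of_real M * (v x * Q x / of_real (4 * kern_mass))) (0 * v x + of_real M * (v x * cnj (Q x) / of_real (4 * kern_mass))) x"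
      by (rule wirtinger_mult[OF wirtinger_const wirtinger_v])
    moreover have "0 * v x + of_real M * (t / of_real (4 * kern_mass)) = of_nat (Suc n) * t" for t
      unfolding Mk[symmetric] by simp
    ultimately have "wirtinger (\<lambda>x. of_real M * v x) (of_nat (Suc n) * (x - z0) ^ n * cnj (b + of_real \<gamma> * (x - z0) ^ Suc n)) (of_nat (Suc n) * cnj (x - z0) ^ n * (b + of_real \<gamma> * (x - z0) ^ Suc n)) x"
      unfolding 1 2 by (simp only: mult.assoc)
    from has_derivative_diff[OF this[unfolded wirtinger_def] dh[of x, unfolded wirtinger_def]]
    show ?thesis by (simp add: d_def[abs_def])
  qed
  have cd: "continuous_on UNIV d" unfolding d_def
    by (intro continuous_intros wirtinger_continuous[OF wirtinger_v] wirtinger_continuous[OF dh])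
  have "d constant_on UNIV"
    \<comment> \<open>The derivative of \<open>d\<close> is known off \<open>z0\<close> only;
      continuity of \<open>d\<close> bridges the exceptional point.\<close>
    by (rule has_derivative_zero_connected_constant_on[of UNIV "{z0}"]) (use cd d0 in auto)
  then obtain k where "\<And>x. d x = k" unfolding constant_on_def by auto
  then have dc: "d x = d z0" for x by simp
  define \<alpha> where "\<alpha> = exp (- u z0 / 2)"
  have "d z0 = of_real (M * \<alpha>)" by (simp add: d_def h_def v_def \<alpha>_def)
  then have main: "M * exp (- u x / 2) = M * \<alpha> + (2 * Re (cnj b * (x - z0) ^ Suc n) + \<gamma> * (cmod ((x - z0) ^ Suc n))\<^sup>2)" for x
  proof -
    have "of_real M * v x = of_real (M * \<alpha>) + h x" using dc[of x] \<open>d z0 = of_real (M * \<alpha>)\<close> by (simp add: d_def algebra_simps)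
    then have "complex_of_real (M * exp (- u x / 2)) = of_real (M * \<alpha> + (2 * Re (cnj b * (x - z0) ^ Suc n) + \<gamma> * (cmod ((x - z0) ^ Suc n))\<^sup>2))"
      unfolding v_def h_real by (simp only: of_real_mult of_real_add)
    then show ?thesis by (simp only: of_real_eq_iff)
  qed
  have 1: "exp (- u x / 2) = \<alpha> + (2 * Re (cnj b * (x - z0) ^ Suc n) + \<gamma> * (cmod ((x - z0) ^ Suc n))\<^sup>2) / M" for x
    using main[of x] M by (simp add: field_simps)
  have 2: "\<alpha> > 0" by (simp add: \<alpha>_def)
  have 3: "real (Suc n) * \<gamma> * \<alpha> = (kern_mass / 2) * K + (cmod b)\<^sup>2 / (4 * kern_mass)"
  proof -
    \<comment> \<open>All powers of \<open>x - z0\<close> equal 1 here, and the terms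
      \<open>\<gamma> * (2 * Re b + \<gamma>)\<close> from \<open>V\<close> and from
      \<open>|b + \<gamma>|^2\<close> cancel.\<close>
    define x where "x = z0 + 1"
    have x: "x \<noteq> z0" "x - z0 = 1" by (auto simp: x_def)
    define V where "V = exp (- u x / 2)"
    have V: "V > 0" by (simp add: V_def)
    have px: "p x = b + of_real \<gamma>" using pb[OF x(1)] x(2) by simp
    have "p x = of_real V * cnj (Q x)" unfolding p_def v_def x(2) V_def by simp
    then have np: "(cmod (b + of_real \<gamma>))\<^sup>2 = V\<^sup>2 * (cmod (Q x))\<^sup>2" unfolding px[symmetric] using V by (simp add: norm_mult power_mult_distrib)
    have uV: "exp (u x) * V\<^sup>2 = 1" unfolding V_def by (simp add: power2_eq_square flip: exp_add)
    have "real (Suc n) * \<gamma> = V * ((kern_mass / 2) * (K * exp (u x)) + (cmod (Q x))\<^sup>2 / (4 * kern_mass))"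
      using Eg[OF x(1)] unfolding E_def x(2) V_def by simp
    then have "real (Suc n) * \<gamma> * V = (kern_mass / 2) * (K * (exp (u x) * V\<^sup>2)) + (V\<^sup>2 * (cmod (Q x))\<^sup>2) / (4 * kern_mass)"
      by (simp add: power2_eq_square algebra_simps add_divide_distrib)
    then have e: "real (Suc n) * \<gamma> * V = (kern_mass / 2) * K + (cmod (b + of_real \<gamma>))\<^sup>2 / (4 * kern_mass)" unfolding uV np by simp
    have "V = \<alpha> + (2 * Re (cnj b) + \<gamma>) / M" using 1[of x] unfolding x(2) V_def by simp
    then have "real (Suc n) * \<gamma> * \<alpha> = real (Suc n) * \<gamma> * V - real (Suc n) * \<gamma> * ((2 * Re (cnj b) + \<gamma>) / M)" by (simp add: algebra_simps)
    also have "real (Suc n) * \<gamma> * ((2 * Re (cnj b) + \<gamma>) / M) = \<gamma> * (2 * Re b + \<gamma>) / (4 * kern_mass)"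
    proof -
      have "real (Suc n) \<noteq> 0" by simp
      then show ?thesis unfolding M_def using kern_mass_pos by (simp add: field_simps del: of_nat_Suc)
    qed
    finally have f: "real (Suc n) * \<gamma> * \<alpha> = real (Suc n) * \<gamma> * V - \<gamma> * (2 * Re b + \<gamma>) / (4 * kern_mass)" .
    have g: "(cmod (b + of_real \<gamma>))\<^sup>2 = (cmod b)\<^sup>2 + \<gamma> * (2 * Re b + \<gamma>)"
      unfolding cmod_power2 by (simp add: power2_eq_square algebra_simps)
    show ?thesis unfolding f e g add_divide_distrib by simp
  qed
  show ?thesis using 1[unfolded M_def] 2 3 by blast
qed

text \<open>Completing the square: the coefficients of \<open>|w|^2\<close> and of w prescribe
  \<open>a^2\<close> and \<open>c\<close>, and the relation among \<alpha>, \<gamma> and b says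
  exactly that the remaining constant is \<open>K / (a^2 (n+1)^2)\<close>. A positive real a
  suffices.\<close>

lemma explicit_u:
  obtains a c :: complex where "a \<noteq> 0"
    "\<And>z. u z = ln (8 / ((cmod (a * (z - z0) ^ (n + 1) + c))\<^sup>2 + K / ((cmod a)\<^sup>2 * (real n + 1)\<^sup>2))\<^sup>2)"
proof -
  obtain \<alpha> \<gamma> b where ex: "\<And>x. exp (- u x / 2) = \<alpha> + (2 * Re (cnj b * (x - z0) ^ Suc n) + \<gamma> * (cmod ((x - z0) ^ Suc n))\<^sup>2) / (4 * kern_mass * real (Suc n))"
    and \<alpha>: "\<alpha> > 0" and rel: "real (Suc n) * \<gamma> * \<alpha> = (kern_mass / 2) * K + (cmod b)\<^sup>2 / (4 * kern_mass)"
    using explicit_v by blast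
  have kp: "kern_mass > 0" by (rule kern_mass_pos)
  define N where "N = real (Suc n)"
  have N: "N > 0" "real n + 1 = N" by (auto simp: N_def)
  define M where "M = 4 * kern_mass * N"
  have M: "M > 0" unfolding M_def using kp N by simp
  \<comment> \<open>Positivity of K forces \<gamma> > 0, without which no real square root a would
    exist.\<close>
  have "0 < N * \<gamma> * \<alpha>" unfolding rel[folded N_def] using kp K by (intro add_pos_nonneg) auto
  then have \<gamma>: "\<gamma> > 0" using \<alpha> N by (simp add: zero_less_mult_iff)
  \<comment> \<open>Absorbs the 8 of the normal form: with \<open>V = exp (- u / 2)\<close> one has
    \<open>u = ln (8 / (s V)^2)\<close>.\<close>
  define s where "s = sqrt 8"
  have s: "s > 0" "s\<^sup>2 = 8" by (auto simp: s_def)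
  define t where "t = s * \<gamma> / M"
  have t: "t > 0" unfolding t_def using s \<gamma> M by simp
  define a where "a = sqrt t"
  have a: "a > 0" "a\<^sup>2 = t" using t by (auto simp: a_def)
  define c where "c = of_real (s / (M * a)) * b"
  have key: "(cmod (of_real a * w + c))\<^sup>2 + K / (a\<^sup>2 * N\<^sup>2) = s * (\<alpha> + (2 * Re (cnj b * w) + \<gamma> * (cmod w)\<^sup>2) / M)" for w
  proof -
    have 1: "(cmod (of_real a * w + c))\<^sup>2 = a\<^sup>2 * (cmod w)\<^sup>2 + 2 * (a * (s / (M * a))) * Re (cnj b * w) + (s / (M * a))\<^sup>2 * (cmod b)\<^sup>2"
      unfolding c_def cmod_power2 by (simp add: power2_eq_square algebra_simps add_divide_distrib)
    have 2: "a * (s / (M * a)) = s / M" using a by simp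
    have 3: "(s / (M * a))\<^sup>2 = 8 / (M\<^sup>2 * t)" using a s by (simp add: power_divide power_mult_distrib)
    have 4: "8 / (M\<^sup>2 * t) * (cmod b)\<^sup>2 + K / (t * N\<^sup>2) = s * \<alpha>"
    proof -
      have "8 / M\<^sup>2 * (cmod b)\<^sup>2 + K / N\<^sup>2 = (8 / (M * N)) * ((kern_mass / 2) * K + (cmod b)\<^sup>2 / (4 * kern_mass))"
        using M N kp unfolding M_def by (simp add: field_simps power2_eq_square)
      also have "\<dots> = (8 / (M * N)) * (N * \<gamma> * \<alpha>)" using rel by (simp add: N_def)
      also have "\<dots> = 8 * \<gamma> * \<alpha> / M" using N by simp
      also have "\<dots> = s * \<alpha> * t" unfolding t_def s(2)[symmetric] by (simp add: power2_eq_square)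
      finally have "(8 / M\<^sup>2 * (cmod b)\<^sup>2 + K / N\<^sup>2) / t = s * \<alpha>" using t by simp
      then show ?thesis by (simp add: add_divide_distrib mult.commute)
    qed
    have "(cmod (of_real a * w + c))\<^sup>2 + K / (a\<^sup>2 * N\<^sup>2) = t * (cmod w)\<^sup>2 + 2 * (s / M) * Re (cnj b * w) + s * \<alpha>"
      unfolding 1 2 3 a(2) using 4 by simp
    also have "\<dots> = s * (\<alpha> + (2 * Re (cnj b * w) + \<gamma> * (cmod w)\<^sup>2) / M)"
      unfolding t_def by (simp add: algebra_simps add_divide_distrib)
    finally show ?thesis .
  qed
  have "u z = ln (8 / ((cmod (of_real a * (z - z0) ^ (n + 1) + c))\<^sup>2 + K / ((cmod (of_real a))\<^sup>2 * (real n + 1)\<^sup>2))\<^sup>2)" for z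
  proof -
    define V where "V = exp (- u z / 2)"
    have V: "V > 0" "ln V = - u z / 2" by (auto simp: V_def)
    have ca: "(cmod (of_real a))\<^sup>2 = a\<^sup>2" by simp
    have "(cmod (of_real a * (z - z0) ^ (n + 1) + c))\<^sup>2 + K / ((cmod (of_real a))\<^sup>2 * (real n + 1)\<^sup>2) = s * V"
    proof -
      have "(cmod (of_real a * (z - z0) ^ (n + 1) + c))\<^sup>2 + K / ((cmod (of_real a))\<^sup>2 * (real n + 1)\<^sup>2)
          = (cmod (of_real a * (z - z0) ^ Suc n + c))\<^sup>2 + K / (a\<^sup>2 * N\<^sup>2)"
        unfolding ca N(2) by simp
      also have "\<dots> = s * V"
        unfolding key using ex by (simp only: V_def M_def N_def)
      finally show ?thesis .
    qed
    moreover have "8 / (s * V)\<^sup>2 = 1 / V\<^sup>2" using s by (simp add: power_mult_distrib)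
    moreover have "ln (1 / V\<^sup>2) = u z" using V by (simp add: ln_div ln_realpow)
    ultimately show ?thesis by simp
  qed
  moreover have "complex_of_real a \<noteq> 0" using a by simp
  ultimately show ?thesis using that by blast
qed

end

section \<open>Radial solutions\<close>

lemma AE_lborel_mult:
  fixes \<omega> :: complex
  assumes ae: "AE z in lborel. P z" and \<omega>: "\<omega> \<noteq> 0"
  shows "AE z in lborel. P (\<omega> * z)"
proof -
  have "AE z in lebesgue. P z" using ae by (simp add: AE_completion_iff)
  then obtain N where N: "N \<in> null_sets lebesgue" "{z. \<not> P z} \<subseteq> N" by (auto simp: eventually_ae_filter)
  have "negligible ((\<lambda>z. z / \<omega>) ` N)"
  proof (rule negligible_differentiable_image_negligible)
    show "(\<lambda>z. z / \<omega>) differentiable_on N" using \<omega> by (auto simp: differentiable_on_def intro!: derivative_intros)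
    show "negligible N" using N by (simp add: negligible_iff_null_sets)
  qed simp
  from negligible_AE_lborel[OF this] show ?thesis
  proof eventually_elim
    fix z assume z: "z \<notin> (\<lambda>z. z / \<omega>) ` N"
    show "P (\<omega> * z)"
    proof (rule ccontr)
      assume "\<not> P (\<omega> * z)"
      then have "\<omega> * z \<in> N" using N(2) by auto
      then have "(\<omega> * z) / \<omega> \<in> (\<lambda>z. z / \<omega>) ` N" by (rule imageI)
      then show False using z \<omega> by simp
    qed
  qed
qed

text \<open>Multiplication by a number \<omega> with \<open>\<omega> ^ (n + 1) = -1\<close>
  preserves \<open>|z|\<close> and changes the sign of \<open>a z^(n+1)\<close>. Hence
  \<open>|w + c| = |- w + c|\<close> for all w of this form, which is every complex number, and w =
  c gives c = 0. Continuity removes the exceptional null set.\<close>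

lemma radial_imp_centred:
  fixes a c :: complex and B :: real
  assumes a: "a \<noteq> 0" and B: "B > 0"
    and ex: "AE z in lborel. \<psi> z = ln (8 / ((cmod (a * z ^ (n + 1) + c))\<^sup>2 + B)\<^sup>2)"
    and rad: "AE z in lborel. \<psi> z = g (cmod z)"
  shows "c = 0"
proof -
  define q where "q z = (cmod (a * z ^ (n + 1) + c))\<^sup>2 + B" for z
  have q: "q z > 0" for z unfolding q_def using B by (intro add_nonneg_pos) auto
  obtain \<omega> :: complex where \<omega>: "\<omega> ^ (n + 1) = -1" using exists_complex_root[of "n + 1" "-1"] by (metis Suc_eq_plus1 nat.simps(3))
  have n\<omega>: "cmod \<omega> = 1"
  proof -
    have "cmod \<omega> ^ (n + 1) = 1" using \<omega> by (metis norm_minus_cancel norm_one norm_power)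
    then show ?thesis using power_eq_1_iff[of "cmod \<omega>" "n + 1"] by simp
  qed
  then have \<omega>0: "\<omega> \<noteq> 0" by auto
  have "AE z in lborel. q z - q (\<omega> * z) = 0"
    using ex rad AE_lborel_mult[OF ex \<omega>0] AE_lborel_mult[OF rad \<omega>0]
  proof eventually_elim
    fix z
    assume 1: "\<psi> z = ln (8 / ((cmod (a * z ^ (n + 1) + c))\<^sup>2 + B)\<^sup>2)" "\<psi> z = g (cmod z)"
      "\<psi> (\<omega> * z) = ln (8 / ((cmod (a * (\<omega> * z) ^ (n + 1) + c))\<^sup>2 + B)\<^sup>2)" "\<psi> (\<omega> * z) = g (cmod (\<omega> * z))"
    have "cmod (\<omega> * z) = cmod z" by (simp add: norm_mult n\<omega>)
    then have "ln (8 / (q z)\<^sup>2) = ln (8 / (q (\<omega> * z))\<^sup>2)" using 1 by (simp add: q_def)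
    then have "8 / (q z)\<^sup>2 = 8 / (q (\<omega> * z))\<^sup>2" using q[of z] q[of "\<omega> * z"] by (subst (asm) ln_inj_iff) auto
    then have "(q z)\<^sup>2 = (q (\<omega> * z))\<^sup>2" using q[of z] q[of "\<omega> * z"] by (simp add: field_simps)
    then have "q z = q (\<omega> * z)" using q[of z] q[of "\<omega> * z"] by (simp add: power2_eq_iff)
    then show "q z - q (\<omega> * z) = 0" by simp
  qed
  then have "q z - q (\<omega> * z) = 0" for z
    by (intro AE_zero_imp_zero_on_open[of UNIV "\<lambda>z. q z - q (\<omega> * z)"]) (auto simp: q_def intro!: continuous_intros)
  then have eq: "cmod (a * z ^ (n + 1) + c) = cmod (- (a * z ^ (n + 1)) + c)" for z
  proof -
    have "(\<omega> * z) ^ (n + 1) = - (z ^ (n + 1))" unfolding power_mult_distrib \<omega> by simp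
    then have "(cmod (a * z ^ (n + 1) + c))\<^sup>2 = (cmod (- (a * z ^ (n + 1)) + c))\<^sup>2"
      using \<open>\<And>z. q z - q (\<omega> * z) = 0\<close>[of z] unfolding q_def by (simp only: mult_minus_right)
    then show ?thesis by simp
  qed
  obtain z where z: "z ^ (n + 1) = c / a" using exists_complex_root[of "n + 1" "c / a"] by (metis Suc_eq_plus1 nat.simps(3))
  have "a * z ^ (n + 1) = c" unfolding z using a by simp
  with eq[of z] have "cmod (c + c) = 0" by simp
  then show ?thesis by simp
qed

section \<open>Borel representatives and conclusion\<close>

lemma test_function_continuous:
  assumes "test_function \<phi>"
  shows "continuous_on UNIV \<phi>" "continuous_on UNIV (laplacian \<phi>)"
proof -
  have c: "Ck k \<phi>" for k using assms by (simp add: test_function_def)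
  show "continuous_on UNIV \<phi>" using c[of 0] by simp
  have "continuous_on UNIV (\<lambda>x. frechet_derivative (\<lambda>y. frechet_derivative \<phi> (at y) v) (at x) v)" for v
    using c[of "Suc (Suc 0)"] by simp
  then show "continuous_on UNIV (laplacian \<phi>)" unfolding laplacian_def by (intro continuous_intros)
qed

lemma locally_integrable_imp_measurable:
  assumes "locally_integrable \<psi>" shows "\<psi> \<in> borel_measurable lebesgue"
proof (rule borel_measurable_LIMSEQ_real)
  show "(\<lambda>x. indicator (cball 0 (real k)) x *\<^sub>R \<psi> x) \<in> borel_measurable lebesgue" for k
    using assms unfolding locally_integrable_def set_integrable_def by (intro borel_measurable_integrable) auto
  show "(\<lambda>k. indicator (cball 0 (real k)) x *\<^sub>R \<psi> x) \<longlonglongrightarrow> \<psi> x" for x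
  proof (rule tendsto_eventually)
    obtain k where "norm x \<le> real k" using real_arch_simple by blast
    then show "\<forall>\<^sub>F k in sequentially. indicator (cball 0 (real k)) x *\<^sub>R \<psi> x = \<psi> x"
      by (intro eventually_sequentiallyI[of k]) (auto simp: indicator_def)
  qed
qed

theorem corollary2p14:
  fixes z0 :: complex and n :: nat and K :: real and \<psi> :: "complex \<Rightarrow> real"
  assumes K: "K > 0"
    and loc: "locally_integrable \<psi>"
    and sol: "weak_solution_neg_laplacian \<psi> (\<lambda>z. K * cmod (z - z0) ^ (2 * n) * exp (\<psi> z))"
    and fin: "integrable lebesgue (\<lambda>z. cmod (z - z0) ^ (2 * n) * exp (\<psi> z))"
  shows "(\<exists>a c :: complex. a \<noteq> 0 \<and>
            (AE z in lebesgue. \<psi> z =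
               ln (8 / ((cmod (a * (z - z0) ^ (n + 1) + c))\<^sup>2
                        + K / ((cmod a)\<^sup>2 * (real n + 1)\<^sup>2))\<^sup>2)))
       \<and> (z0 = 0 \<and> radially_symmetric \<psi> \<longrightarrow>
           (\<exists>a :: complex. a \<noteq> 0 \<and>
            (AE z in lebesgue. \<psi> z =
               ln (8 / ((cmod a)\<^sup>2 * cmod z ^ (2 * n + 2)
                        + K / ((cmod a)\<^sup>2 * (real n + 1)\<^sup>2))\<^sup>2))))"
proof -
  have psi_meas[measurable]: "\<psi> \<in> borel_measurable lebesgue" by (rule locally_integrable_imp_measurable[OF loc])
  \<comment> \<open>The statement is about Lebesgue measurable functions, whereas Fubini's theorem
    on products of \<open>lborel\<close> asks for Borel functions; a Borel representative
    mediates.\<close>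
  obtain \<psi>' where psi'[measurable]: "\<psi>' \<in> borel_measurable lborel" and ae: "AE x in lborel. \<psi> x = \<psi>' x"
    using completion_ex_borel_measurable_real[OF psi_meas] by blast
  have ae': "AE x in lebesgue. \<psi> x = \<psi>' x" using ae by (simp add: AE_completion_iff)
  let ?F = "\<lambda>z. K * cmod (z - z0) ^ (2 * n) * exp (\<psi>' z)"
  have transfer: "integrable lborel h \<longleftrightarrow> integrable lebesgue k" "integral\<^sup>L lborel h = integral\<^sup>L lebesgue k"
    if h: "h \<in> borel_measurable lborel" and k: "k \<in> borel_measurable lebesgue" and hk: "AE x in lebesgue. h x = k x" for h k :: "complex \<Rightarrow> real"
  proof -
    have h': "h \<in> borel_measurable lebesgue" using h by (rule measurable_completion)
    show "integrable lborel h \<longleftrightarrow> integrable lebesgue k"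
      using integrable_completion[OF h] integrable_cong_AE[OF h' k hk] by simp
    show "integral\<^sup>L lborel h = integral\<^sup>L lebesgue k"
      using integral_completion[OF h] integral_cong_AE[OF h' k hk] by simp
  qed
  have borel_leb: "h \<in> borel_measurable borel \<Longrightarrow> h \<in> borel_measurable lebesgue" for h :: "complex \<Rightarrow> real"
    by (rule measurable_completion) simp
  have Fi: "integrable lborel ?F"
  proof -
    have i: "integrable lebesgue (\<lambda>z. K * (cmod (z - z0) ^ (2 * n) * exp (\<psi> z)))" using fin by (rule integrable_mult_right)
    show ?thesis
    proof (rule transfer(1)[THEN iffD2, OF _ _ _ i])
      show "AE z in lebesgue. ?F z = K * (cmod (z - z0) ^ (2 * n) * exp (\<psi> z))"
        using ae' by eventually_elim simp
    qed (use i in auto)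
  qed
  interpret liouville_solution \<psi>' K z0 n
  proof
    show "\<psi>' \<in> borel_measurable borel" using psi' by simp
    show "K > 0" by (rule K)
    show "integrable lborel ?F" by (rule Fi)
    show "set_integrable lborel S \<psi>'" if S: "compact S" for S
    proof -
      have i: "integrable lebesgue (\<lambda>x. indicator S x *\<^sub>R \<psi> x)" using loc S by (simp add: locally_integrable_def set_integrable_def)
      have [measurable]: "S \<in> sets borel" using S by (simp add: borel_compact)
      show ?thesis unfolding set_integrable_def
        by (rule transfer(1)[THEN iffD2, OF _ _ _ i]) (use ae' i in \<open>auto elim!: eventually_mono\<close>)
    qed
    show "- (\<integral>x. \<psi>' x * laplacian \<phi> x \<partial>lborel) = (\<integral>x. ?F x * \<phi> x \<partial>lborel)" if \<phi>: "test_function \<phi>" for \<phi>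
    proof -
      have [measurable]: "\<phi> \<in> borel_measurable borel" "laplacian \<phi> \<in> borel_measurable borel"
        using test_function_continuous[OF \<phi>] by (auto intro: borel_measurable_continuous_onI)
      note bl = borel_leb[OF \<open>\<phi> \<in> borel_measurable borel\<close>] borel_leb[OF \<open>laplacian \<phi> \<in> borel_measurable borel\<close>]
      have 1: "(\<integral>x. \<psi>' x * laplacian \<phi> x \<partial>lborel) = (\<integral>x. \<psi> x * laplacian \<phi> x \<partial>lebesgue)"
        by (rule transfer(2)) (use ae' bl in \<open>auto elim!: eventually_mono\<close>)
      have w: "(\<lambda>z. cmod (z - z0) ^ (2 * n)) \<in> borel_measurable lebesgue" by (rule borel_leb) measurable
      have 2: "(\<integral>x. ?F x * \<phi> x \<partial>lborel) = (\<integral>x. K * cmod (x - z0) ^ (2 * n) * exp (\<psi> x) * \<phi> x \<partial>lebesgue)"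
        by (rule transfer(2)) (use ae' bl w in \<open>auto elim!: eventually_mono\<close>)
      show ?thesis unfolding 1 2 using sol \<phi> by (simp add: weak_solution_neg_laplacian_def)
    qed
  qed
  obtain u c0 C where u: "AE x in lborel. \<psi>' x = u x"
    "integrable lborel (\<lambda>z. K * cmod (z - z0) ^ (2 * n) * exp (u z))"
    "\<And>z. K * cmod (z - z0) ^ (2 * n) * exp (u z) \<le> C"
    "\<And>x. u x = c0 - log_potential (\<lambda>z. K * cmod (z - z0) ^ (2 * n) * exp (u z)) x / kern_mass"
    using integral_equation by blast
  interpret eq: liouville_integral_equation u c0 C K z0 n by unfold_locales (rule K u)+
  obtain a c where a: "a \<noteq> 0"
    and ua: "\<And>z. u z = ln (8 / ((cmod (a * (z - z0) ^ (n + 1) + c))\<^sup>2 + K / ((cmod a)\<^sup>2 * (real n + 1)\<^sup>2))\<^sup>2)"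
    using eq.explicit_u by blast
  have ex: "AE z in lborel. \<psi> z = ln (8 / ((cmod (a * (z - z0) ^ (n + 1) + c))\<^sup>2 + K / ((cmod a)\<^sup>2 * (real n + 1)\<^sup>2))\<^sup>2)"
    using ae u(1) by eventually_elim (simp only: ua)
  have rad: "\<exists>a :: complex. a \<noteq> 0 \<and> (AE z in lebesgue. \<psi> z =
      ln (8 / ((cmod a)\<^sup>2 * cmod z ^ (2 * n + 2) + K / ((cmod a)\<^sup>2 * (real n + 1)\<^sup>2))\<^sup>2))"
    if z0: "z0 = 0" and r: "radially_symmetric \<psi>"
  proof -
    obtain g where g: "AE z in lebesgue. \<psi> z = g (cmod z)" using r unfolding radially_symmetric_def by blast
    have B: "K / ((cmod a)\<^sup>2 * (real n + 1)\<^sup>2) > 0"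
      using K a by (intro divide_pos_pos mult_pos_pos zero_less_power) auto
    have ex0: "AE z in lborel. \<psi> z = ln (8 / ((cmod (a * z ^ (n + 1) + c))\<^sup>2 + K / ((cmod a)\<^sup>2 * (real n + 1)\<^sup>2))\<^sup>2)"
      using ex unfolding z0 by simp
    \<comment> \<open>The constants a and c are those found for the general form, so the radial form
      is its special case with the same a.\<close>
    have c: "c = 0"
      by (rule radial_imp_centred[OF a B ex0]) (use g in \<open>simp add: AE_completion_iff\<close>)
    have e: "(cmod (a * z ^ (n + 1) + c))\<^sup>2 = (cmod a)\<^sup>2 * cmod z ^ (2 * n + 2)" for z
    proof -
      have "(cmod z ^ (n + 1))\<^sup>2 = cmod z ^ (2 * n + 2)" 
      proof -
        have "(n + 1) * 2 = 2 * n + 2" by simp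
        then show ?thesis by (simp only: power_mult[symmetric])
      qed
      then show ?thesis by (simp add: c norm_mult norm_power power_mult_distrib)
    qed
    have "AE z in lebesgue. \<psi> z = ln (8 / ((cmod a)\<^sup>2 * cmod z ^ (2 * n + 2) + K / ((cmod a)\<^sup>2 * (real n + 1)\<^sup>2))\<^sup>2)"
      using ex0 unfolding e by (simp add: AE_completion_iff)
    then show ?thesis using a by blast
  qed
  have "AE z in lebesgue. \<psi> z = ln (8 / ((cmod (a * (z - z0) ^ (n + 1) + c))\<^sup>2 + K / ((cmod a)\<^sup>2 * (real n + 1)\<^sup>2))\<^sup>2)"
    using ex by (simp add: AE_completion_iff)
  then show ?thesis using a rad by blast
qed

end
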